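(* Let $p=q^k$ for some $k\in\mathbb Z$ and let $f\in \mathbb I^d$ be anti-dominant. (1) There exists an anti-linear bar involution $\psi_\imath$ on $\mathbb M_f$ such that $\psi_\imath(M_f)=M_f$, which is compatible with the bar operator on $\mathscr H_{B_d}$, i.e., $\psi_\imath(xh)=\psi_\imath(x)\,\bar h$ for all $x\in\mathbb M_f$, $h\in\mathscr H_{B_d}$. (2) The module $\mathbb M_f$ admits a basis (canonical basis) $\{C_\sigma\mid \sigma\in {}^fW\}$ such that each $C_\sigma$ is bar invariant, i.e. $\psi_\imath(C_\sigma)=C_\sigma$, and $$C_\sigma\in M_{f\cdot\sigma}+\sum_{w\in {}^fW,\ w<\sigma} q^{-1}\mathbb Z[q^{-1}]\,M_{f\cdot w}.$$
   Context: Fix $r,m\in\mathbb N=\{0,1,2,\dots\}$, not both zero, and $d\ge 1$. For $x\in\mathbb R$, $k\in\mathbb N$ write $[x,x+k]=\{x,x+1,\dots,x+k\}$. Let $\mathbb I=[\frac{1-2r-m}2,\frac{2r+m-1}2]=\mathbb I_\circ^-\cup\mathbb I_\bullet\cup\mathbb I_\circ^+$, where $\mathbb I_\circ^+=[\frac{m+1}2,r+\frac{m-1}2]$, $\mathbb I_\bullet=[\frac{1-m}2,\frac{m-1}2]$, $\mathbb I_\circ^-=-\mathbb I_\circ^+$ (of sizes $r,m,r$). $W_d$ is the Weyl group of type $B_d$ with simple reflections $s_0,\dots,s_{d-1}$, identified with the permutations $\sigma$ of $\{\pm1,\dots,\pm d\}$ with $\sigma(-i)=-\sigma(i)$: $s_0$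 swaps $1,-1$ and $s_i$ ($i\ge1$) swaps $i,i+1$. Let $l$ be its length function and $\le$ the Chevalley–Bruhat order. $W_d$ acts on the right on $\mathbb I^d$ (tuples $f=(f(1),\dots,f(d))$): for $j>0$, $f\cdot s_j$ swaps the entries $f(j),f(j+1)$; $f\cdot s_0=(-f(1),f(2),\dots,f(d))$ if $f(1)\in\mathbb I_\circ^-\cup\mathbb I_\circ^+$, and $f\cdot s_0=f$ if $f(1)\in\mathbb I_\bullet$. $f\in\mathbb I^d$ is anti-dominant if $\frac{m-1}2\ge f(1)\ge f(2)\ge\dots\ge f(d)$. $W_f$ is the stabilizer of $f$ in $W_d$ (a reflection subgroup, of the form $W_{m_1}\times\dots\times W_{m_k}\times S_{m_{k+1}}\times\dots\times S_{m_l}$, not necessarily parabolic). Every right coset of $W_f$ in $W_d$ has a unique minimal length element; ${}^fW$ denotes the set of these minimal length representatives of right cosets $W_f\sigma$, with the restriction of the Bruhat order. $\mathscr H_{B_d}$ is the Hecke algebra over $\mathbb Q(q)$ generated by $H_0,\dots,H_{d-1}$ with the type $B_d$ braid relations and $(H_i-q_i)(H_i+q_i^{-1})=0$, where $q_0=p$, $q_i=q$ for $i\ge1$. Its bar operator is the $\mathbb Q$-algebra automorphism with $\bar H_i=H_i^{-1}$, $\bar q=q^{-1}$. "Anti-linear" means $\mathbb Q$-linear with $q^k x\mapsto q^{-k}\psi_\imath(x)$ (semilinear for $q\mapsto q^{-1}$). $\mathbb V=\bigoplus_{a\in\mathbb I}\mathbb Q(q)v_a$, and for $f\in\mathbb I^d$,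 $M_f=v_{f(1)}\otimes\dots\otimes v_{f(d)}\in\mathbb V^{\otimes d}$. $\mathbb V^{\otimes d}$ is a right $\mathscr H_{B_d}$-module via: for $i>0$, $M_fH_i=M_{f\cdot s_i}+(q-q^{-1})M_f$ if $f(i)<f(i+1)$; $M_{f\cdot s_i}$ if $f(i)>f(i+1)$; $qM_f$ if $f(i)=f(i+1)$; and $M_fH_0=M_{f\cdot s_0}+(p-p^{-1})M_f$ if $f(1)\in\mathbb I_\circ^+$; $M_{f\cdot s_0}$ if $f(1)\in\mathbb I_\circ^-$; $pM_f$ if $f(1)\in\mathbb I_\bullet$. For anti-dominant $f$, $\mathbb M_f=M_f\mathscr H_{B_d}$, which has the standard basis $\{M_{f\cdot\sigma}\mid\sigma\in{}^fW\}$. *)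

theory Defs
  imports
    "HOL-Library.Poly_Mapping"
    "HOL-Computational_Algebra.Polynomial_Factorial"
    "HOL-Combinatorics.Permutations"
    "HOL-Algebra.QuotRing"
begin

section \<open>The field of rational functions and its bar involution\<close>

type_synonym ratfun = "rat poly fract"

definition q :: ratfun where
  "q = to_fract [:0, 1:]"

definition ev_inv :: "rat poly \<Rightarrow> ratfun" where
  "ev_inv a = poly (map_poly of_rat a) (inverse q)"

lemma of_rat_ratfun: "(of_rat c :: ratfun) = to_fract [:c:]"
proof -
  obtain a b where c: "c = Rat.Fract a b" and b: "b > 0" by (cases c) auto
  have *: "(of_int n :: ratfun) = to_fract [:of_int n:]" for n
    by (induction n rule: int_induct[of _ 0])
       (simp_all add: to_fract_def of_int_poly Zero_fract_def One_fract_def one_pCons)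
  have "of_rat c * of_int b = (of_int a :: ratfun)" using b by (simp add: c of_rat_rat)
  moreover have "to_fract [:c:] * of_int b = (of_int a :: ratfun)"
    using b by (simp add: * c Rat.Fract_of_int_quotient flip: to_fract_mult)
  moreover have "(of_int b :: ratfun) \<noteq> 0" using b by simp
  ultimately show ?thesis by (metis mult_right_cancel)
qed

lemma ev_inv_0 [simp]: "ev_inv 0 = 0"
  and ev_inv_1 [simp]: "ev_inv 1 = 1"
  and ev_inv_pCons: "ev_inv (pCons c a) = of_rat c + inverse q * ev_inv a"
  by (simp_all add: ev_inv_def map_poly_pCons map_poly_1)

lemma ev_inv_add: "ev_inv (a + b) = ev_inv a + ev_inv b"
  by (induction a b rule: poly_induct2) (simp_all add: ev_inv_pCons of_rat_add algebra_simps)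

lemma ev_inv_smult: "ev_inv (Polynomial.smult c a) = of_rat c * ev_inv a"
  by (induction a) (simp_all add: ev_inv_pCons of_rat_mult algebra_simps)

lemma ev_inv_mult: "ev_inv (a * b) = ev_inv a * ev_inv b"
  by (induction a) (simp_all add: ev_inv_pCons ev_inv_add ev_inv_smult algebra_simps)

lemma to_fract_eq_poly: "to_fract a = poly (map_poly of_rat a) q"
proof (induction a)
  case (pCons c a)
  have "to_fract (pCons c a) = to_fract ([:c:] + [:0, 1:] * a)" by simp
  also have "\<dots> = of_rat c + q * to_fract a"
    by (simp only: to_fract_add to_fract_mult of_rat_ratfun q_def)
  finally show ?case using pCons by (simp add: map_poly_pCons)
qed simp

lemma q_nonzero [simp]: "q \<noteq> 0"
  by (simp add: q_def)

lemma ev_inv_eq_0_iff: "ev_inv a = 0 \<longleftrightarrow> a = 0"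
proof
  assume "ev_inv a = 0"
  have "reflect_poly (map_poly of_rat a) = (map_poly of_rat (reflect_poly a) :: ratfun poly)"
    by (rule poly_eqI) (simp add: coeff_reflect_poly coeff_map_poly degree_map_poly)
  hence "to_fract (reflect_poly a) = q ^ degree a * ev_inv a"
    by (simp add: to_fract_eq_poly ev_inv_def degree_map_poly poly_reflect_poly_nz
             flip: \<open>reflect_poly _ = _\<close>)
  thus "a = 0" using \<open>ev_inv a = 0\<close> by simp
qed simp

text \<open>The field automorphism \<open>a(q)/b(q) \<mapsto> a(q\<^sup>-\<^sup>1)/b(q\<^sup>-\<^sup>1)\<close>.\<close>

definition bar :: "ratfun \<Rightarrow> ratfun" where
  "bar x = (THE y. \<exists>a b. b \<noteq> 0 \<and> x = Fract a b \<and> y = ev_inv a / ev_inv b)"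

lemma bar_Fract:
  assumes "b \<noteq> 0"
  shows "bar (Fract a b) = ev_inv a / ev_inv b"
  unfolding bar_def
proof (rule the_equality)
  fix y assume "\<exists>a' b'. b' \<noteq> 0 \<and> Fract a b = Fract a' b' \<and> y = ev_inv a' / ev_inv b'"
  then obtain a' b' where "b' \<noteq> 0" "Fract a b = Fract a' b'" "y = ev_inv a' / ev_inv b'" by blast
  with assms show "y = ev_inv a / ev_inv b"
    by (simp add: eq_fract frac_eq_eq ev_inv_eq_0_iff flip: ev_inv_mult)
qed (use assms in blast)

lemma bar_add: "bar (x + y) = bar x + bar y"
  by (cases x, cases y) (simp add: bar_Fract ev_inv_add ev_inv_mult ev_inv_eq_0_iff add_frac_eq)

lemma bar_mult: "bar (x * y) = bar x * bar y"
  by (cases x, cases y) (simp add: bar_Fract ev_inv_mult)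

lemma bar_to_fract: "bar (to_fract a) = ev_inv a"
  by (simp add: to_fract_def bar_Fract)

lemma bar_0 [simp]: "bar 0 = 0"
  using bar_to_fract[of 0] by simp

lemma bar_1 [simp]: "bar 1 = 1"
  using bar_to_fract[of 1] by simp

lemma bar_of_rat [simp]: "bar (of_rat c) = of_rat c"
  by (simp add: of_rat_ratfun[of c] bar_to_fract) (simp add: ev_inv_pCons of_rat_ratfun)

lemma bar_q: "bar q = inverse q"
  by (simp add: q_def bar_to_fract) (simp add: ev_inv_pCons q_def)

lemma bar_minus: "bar (- x) = - bar x"
  using bar_add[of x "- x"] by (simp add: eq_neg_iff_add_eq_0 add.commute)

lemma bar_diff: "bar (x - y) = bar x - bar y"
  using bar_add[of x "- y"] by (simp add: bar_minus)

lemma bar_eq_0_iff: "bar x = 0 \<longleftrightarrow> x = 0"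
  by (metis bar_0 bar_1 bar_mult mult_zero_left right_inverse zero_neq_one)

lemma bar_inverse: "bar (inverse x) = inverse (bar x)"
proof (cases "x = 0")
  case False
  hence "bar x * bar (inverse x) = 1" by (simp flip: bar_mult)
  thus ?thesis by (metis inverse_unique)
qed simp

lemma bar_bar [simp]: "bar (bar x) = x"
proof -
  have *: "bar (ev_inv a) = to_fract a" for a
  proof (induction a)
    case (pCons c a)
    have "to_fract (pCons c a) = of_rat c + q * to_fract a"
      by (simp add: to_fract_eq_poly map_poly_pCons)
    thus ?case using pCons by (simp add: ev_inv_pCons bar_add bar_mult bar_inverse bar_q)
  qed simp
  show ?thesis
  proof (cases x)
    case (Fract a b)
    thus ?thesis
      by (simp add: bar_Fract divide_inverse bar_mult bar_inverse *)
         (simp add: to_fract_def)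
  qed
qed

text \<open>\<open>q\<^sup>-\<^sup>1\<int>[q\<^sup>-\<^sup>1]\<close>\<close>

definition qinv_int_polys :: "ratfun set" where
  "qinv_int_polys = {inverse q * poly (map_poly of_int a) (inverse q) | a :: int poly. True}"

definition hecke_param :: "int \<Rightarrow> nat \<Rightarrow> ratfun" where
  "hecke_param k i = (if i = 0 then q powi k else q)"

section \<open>The Weyl group of type B\<close>

definition weyl :: "nat \<Rightarrow> (int \<Rightarrow> int) monoid" where
  "weyl d = \<lparr>carrier = {\<sigma>. \<sigma> permutes ({- int d..int d} - {0}) \<and> (\<forall>i. \<sigma> (- i) = - \<sigma> i)},
             mult = (\<circ>), one = id\<rparr>"

definition simple_refl :: "nat \<Rightarrow> int \<Rightarrow> int" where
  "simple_refl i = (if i = 0 then transpose 1 (- 1)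
     else transpose (int i) (int i + 1) \<circ> transpose (- int i) (- (int i + 1)))"

definition weyl_word :: "nat list \<Rightarrow> int \<Rightarrow> int" where
  "weyl_word ws = foldr (\<lambda>i \<sigma>. simple_refl i \<circ> \<sigma>) ws id"

definition weyl_length :: "nat \<Rightarrow> (int \<Rightarrow> int) \<Rightarrow> nat" where
  "weyl_length d \<sigma> = (LEAST n. \<exists>ws. length ws = n \<and> set ws \<subseteq> {..<d} \<and> weyl_word ws = \<sigma>)"

definition reflections :: "nat \<Rightarrow> (int \<Rightarrow> int) set" where
  "reflections d =
     {u \<otimes>\<^bsub>weyl d\<^esub> simple_refl i \<otimes>\<^bsub>weyl d\<^esub> inv\<^bsub>weyl d\<^esub> u | u i. u \<in> carrier (weyl d) \<and> i < d}"

definition bruhat_step :: "nat \<Rightarrow> (int \<Rightarrow> int) \<Rightarrow> (int \<Rightarrow> int) \<Rightarrow> bool" where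
  "bruhat_step d \<sigma> \<tau> \<longleftrightarrow> \<sigma> \<in> carrier (weyl d) \<and> weyl_length d \<sigma> < weyl_length d \<tau> \<and>
     (\<exists>t\<in>reflections d. \<tau> = \<sigma> \<otimes>\<^bsub>weyl d\<^esub> t)"

definition bruhat_less :: "nat \<Rightarrow> (int \<Rightarrow> int) \<Rightarrow> (int \<Rightarrow> int) \<Rightarrow> bool" where
  "bruhat_less d = (bruhat_step d)\<^sup>+\<^sup>+"

section \<open>Weights\<close>

text \<open>\<open>{a, a + 1, \<dots>, b}\<close>, which is empty if \<open>b < a\<close> (needed for \<open>r = 0\<close> or \<open>m = 0\<close>).\<close>

definition seg :: "real \<Rightarrow> real \<Rightarrow> real set" where
  "seg a b = {x. \<exists>j::nat. x = a + real j \<and> x \<le> b}"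

definition wt :: "nat \<Rightarrow> nat \<Rightarrow> real set" where
  "wt r m = seg ((1 - 2 * real r - real m) / 2) ((2 * real r + real m - 1) / 2)"

definition wt_pos :: "nat \<Rightarrow> nat \<Rightarrow> real set" where
  "wt_pos r m = seg ((real m + 1) / 2) (real r + (real m - 1) / 2)"

definition wt_mid :: "nat \<Rightarrow> real set" where
  "wt_mid m = seg ((1 - real m) / 2) ((real m - 1) / 2)"

definition wt_neg :: "nat \<Rightarrow> nat \<Rightarrow> real set" where
  "wt_neg r m = uminus ` wt_pos r m"

definition tuples :: "nat \<Rightarrow> nat \<Rightarrow> nat \<Rightarrow> (nat \<Rightarrow> real) set" where
  "tuples r m d = {1..d} \<rightarrow>\<^sub>E wt r m"

definition flip :: "nat \<Rightarrow> nat \<Rightarrow> real \<Rightarrow> real" where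
  "flip r m a = (if a \<in> wt_neg r m \<union> wt_pos r m then - a else a)"

definition simple_act :: "nat \<Rightarrow> nat \<Rightarrow> (nat \<Rightarrow> real) \<Rightarrow> nat \<Rightarrow> nat \<Rightarrow> real" where
  "simple_act r m f j = (if j = 0 then f(1 := flip r m (f 1)) else f(j := f (j + 1), j + 1 := f j))"

text \<open>
  The right action of the whole group is \<open>(f \<cdot> \<sigma>)(i) = f (\<sigma> i)\<close> once \<open>f\<close> is extended to negative
  indices by \<open>f (- j) = flip (f j)\<close>; the lemmas \<open>weyl_act_simple\<close>, \<open>weyl_act_mult\<close> and \<open>weyl_act_id\<close>
  below show that it is the right action extending \<open>simple_act\<close>.
\<close>

definition weyl_act :: "nat \<Rightarrow> nat \<Rightarrow> nat \<Rightarrow> (nat \<Rightarrow> real) \<Rightarrow> (int \<Rightarrow> int) \<Rightarrow> nat \<Rightarrow> real" where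
  "weyl_act r m d f \<sigma> = (\<lambda>i\<in>{1..d}.
     if \<sigma> (int i) > 0 then f (nat (\<sigma> (int i))) else flip r m (f (nat (- \<sigma> (int i)))))"

definition antidominant :: "nat \<Rightarrow> nat \<Rightarrow> (nat \<Rightarrow> real) \<Rightarrow> bool" where
  "antidominant m d f \<longleftrightarrow> f 1 \<le> (real m - 1) / 2 \<and> (\<forall>i\<in>{1..<d}. f (i + 1) \<le> f i)"

definition stabilizer :: "nat \<Rightarrow> nat \<Rightarrow> nat \<Rightarrow> (nat \<Rightarrow> real) \<Rightarrow> (int \<Rightarrow> int) set" where
  "stabilizer r m d f = {\<sigma> \<in> carrier (weyl d). weyl_act r m d f \<sigma> = f}"

definition min_reps :: "nat \<Rightarrow> nat \<Rightarrow> nat \<Rightarrow> (nat \<Rightarrow> real) \<Rightarrow> (int \<Rightarrow> int) set" where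
  "min_reps r m d f = {\<sigma> \<in> carrier (weyl d).
     \<forall>\<tau> \<in> stabilizer r m d f #>\<^bsub>weyl d\<^esub> \<sigma>. weyl_length d \<sigma> \<le> weyl_length d \<tau>}"

section \<open>The Hecke algebra\<close>

text \<open>
  Words over \<open>nat\<close> form a (noncommutative) monoid, written additively so that the convolution product
  on finitely supported functions is the multiplication of the free algebra.
\<close>

datatype word = Word (letters: "nat list")

instantiation word :: monoid_add
begin
definition zero_word :: word where "0 = Word []"
definition plus_word :: "word \<Rightarrow> word \<Rightarrow> word" where "u + v = Word (letters u @ letters v)"
instance by standard (simp_all add: zero_word_def plus_word_def)
end

type_synonym free_elem = "word \<Rightarrow>\<^sub>0 ratfun"

definition free_alg :: "nat \<Rightarrow> free_elem ring" where
  "free_alg d = \<lparr>carrier = {a. \<forall>w \<in> Poly_Mapping.keys a. set (letters w) \<subseteq> {..<d}},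
                 mult = (*), one = 1, zero = 0, add = (+)\<rparr>"

abbreviation fword :: "nat list \<Rightarrow> free_elem" where
  "fword ws \<equiv> Poly_Mapping.single (Word ws) 1"

abbreviation fconst :: "ratfun \<Rightarrow> free_elem" where
  "fconst c \<equiv> Poly_Mapping.single 0 c"

definition braid_pairs :: "nat \<Rightarrow> (nat list \<times> nat list) set" where
  "braid_pairs d =
     {([i, j], [j, i]) | i j. i < d \<and> j < d \<and> i + 1 < j} \<union>
     {([i, i + 1, i], [i + 1, i, i + 1]) | i. 1 \<le> i \<and> i + 1 < d} \<union>
     (if 1 < d then {([0, 1, 0, 1], [1, 0, 1, 0])} else {})"

definition hecke_rels :: "nat \<Rightarrow> int \<Rightarrow> free_elem set" where
  "hecke_rels d k =
     (\<lambda>(u, v). fword u - fword v) ` braid_pairs d \<union>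
     {(fword [i] - fconst (hecke_param k i)) * (fword [i] + fconst (inverse (hecke_param k i))) | i. i < d}"

definition hecke_ideal :: "nat \<Rightarrow> int \<Rightarrow> free_elem set" where
  "hecke_ideal d k = Idl\<^bsub>free_alg d\<^esub> (hecke_rels d k)"

definition hecke :: "nat \<Rightarrow> int \<Rightarrow> free_elem set ring" where
  "hecke d k = free_alg d Quot hecke_ideal d k"

definition hecke_gen :: "nat \<Rightarrow> int \<Rightarrow> nat \<Rightarrow> free_elem set" where
  "hecke_gen d k i = hecke_ideal d k +>\<^bsub>free_alg d\<^esub> fword [i]"

definition hecke_const :: "nat \<Rightarrow> int \<Rightarrow> ratfun \<Rightarrow> free_elem set" where
  "hecke_const d k c = hecke_ideal d k +>\<^bsub>free_alg d\<^esub> fconst c"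

definition is_hecke_bar :: "nat \<Rightarrow> int \<Rightarrow> (free_elem set \<Rightarrow> free_elem set) \<Rightarrow> bool" where
  "is_hecke_bar d k \<beta> \<longleftrightarrow>
     \<beta> \<in> ring_iso (hecke d k) (hecke d k) \<and>
     (\<forall>c. \<forall>h\<in>carrier (hecke d k).
        \<beta> (hecke_const d k (of_rat c) \<otimes>\<^bsub>hecke d k\<^esub> h) = hecke_const d k (of_rat c) \<otimes>\<^bsub>hecke d k\<^esub> \<beta> h) \<and>
     (\<forall>i<d. \<beta> (hecke_gen d k i) = inv\<^bsub>hecke d k\<^esub> hecke_gen d k i) \<and>
     \<beta> (hecke_const d k q) = hecke_const d k (inverse q)"

text \<open>Existence and uniqueness are shown in \<open>hecke_bar_ex1\<close> below.\<close>

definition hecke_bar :: "nat \<Rightarrow> int \<Rightarrow> free_elem set \<Rightarrow> free_elem set" where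
  "hecke_bar d k = (THE \<beta>. \<beta> \<in> extensional (carrier (hecke d k)) \<and> is_hecke_bar d k \<beta>)"

section \<open>The tensor space as a right module\<close>

text \<open>
  The \<open>d\<close>-th tensor power of the free module on \<open>wt r m\<close> is realized as the free module on the set
  \<open>tuples r m d\<close>: the pure tensor of the basis vectors indexed by \<open>f 1, \<dots>, f d\<close> is \<open>std f\<close>.
\<close>

type_synonym tensor = "(nat \<Rightarrow> real) \<Rightarrow>\<^sub>0 ratfun"

definition smult :: "ratfun \<Rightarrow> tensor \<Rightarrow> tensor" where
  "smult c x = Poly_Mapping.map ((*) c) x"

abbreviation std :: "(nat \<Rightarrow> real) \<Rightarrow> tensor" where
  "std f \<equiv> Poly_Mapping.single f 1"

definition tensor_space :: "nat \<Rightarrow> nat \<Rightarrow> nat \<Rightarrow> tensor set" where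
  "tensor_space r m d = {x. Poly_Mapping.keys x \<subseteq> tuples r m d}"

text \<open>
  For \<open>f \<in> tuples r m d\<close>, the last case \<open>i = 0\<close> is the one where \<open>f 1 \<in> wt_mid m\<close>; see \<open>wt_cases\<close>.
\<close>

definition std_act :: "nat \<Rightarrow> nat \<Rightarrow> int \<Rightarrow> nat \<Rightarrow> (nat \<Rightarrow> real) \<Rightarrow> tensor" where
  "std_act r m k i f =
     (if i > 0 then
        if f i < f (i + 1) then std (simple_act r m f i) + smult (q - inverse q) (std f)
        else if f i > f (i + 1) then std (simple_act r m f i)
        else smult q (std f)
      else
        let p = q powi k in
        if f 1 \<in> wt_pos r m then std (simple_act r m f 0) + smult (p - inverse p) (std f)
        else if f 1 \<in> wt_neg r m then std (simple_act r m f 0)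
        else smult p (std f))"

definition gen_act :: "nat \<Rightarrow> nat \<Rightarrow> int \<Rightarrow> nat \<Rightarrow> tensor \<Rightarrow> tensor" where
  "gen_act r m k i x = (\<Sum>f\<in>Poly_Mapping.keys x. smult (Poly_Mapping.lookup x f) (std_act r m k i f))"

definition free_act :: "nat \<Rightarrow> nat \<Rightarrow> int \<Rightarrow> tensor \<Rightarrow> free_elem \<Rightarrow> tensor" where
  "free_act r m k x a =
     (\<Sum>w\<in>Poly_Mapping.keys a. smult (Poly_Mapping.lookup a w) (fold (gen_act r m k) (letters w) x))"

text \<open>
  The action of a coset is that of any representative; \<open>hecke_act_coset\<close> below shows that this does not
  depend on the choice.
\<close>

definition hecke_act :: "nat \<Rightarrow> nat \<Rightarrow> int \<Rightarrow> tensor \<Rightarrow> free_elem set \<Rightarrow> tensor" where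
  "hecke_act r m k x h = the_elem (free_act r m k x ` h)"

definition perm_module :: "nat \<Rightarrow> nat \<Rightarrow> nat \<Rightarrow> int \<Rightarrow> (nat \<Rightarrow> real) \<Rightarrow> tensor set" where
  "perm_module r m d k f = hecke_act r m k (std f) ` carrier (hecke d k)"

definition antilinear_on :: "tensor set \<Rightarrow> (tensor \<Rightarrow> tensor) \<Rightarrow> bool" where
  "antilinear_on S \<psi> \<longleftrightarrow>
     (\<forall>x\<in>S. \<forall>y\<in>S. \<psi> (x + y) = \<psi> x + \<psi> y) \<and> (\<forall>c. \<forall>x\<in>S. \<psi> (smult c x) = smult (bar c) (\<psi> x))"

section \<open>Consistency of the definitions\<close>

subsection \<open>Weights and the action of the Weyl group\<close>

lemma wt_cases:
  fixes x :: real
  assumes "x \<in> wt r m"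
  shows "x \<in> wt_neg r m \<or> x \<in> wt_mid m \<or> x \<in> wt_pos r m"
proof -
  from assms obtain j where x: "x = (1 - 2 * real r - real m) / 2 + real j"
    and "x \<le> (2 * real r + real m - 1) / 2" by (auto simp: wt_def seg_def)
  hence "real j + 1 \<le> real (2 * r + m)" by (simp add: field_simps)
  hence j: "j + 1 \<le> 2 * r + m" by linarith
  consider "j < r" | "r \<le> j" "j < r + m" | "r + m \<le> j" by linarith
  thus ?thesis
  proof cases
    case 1
    have "- x = (real m + 1) / 2 + real (r - 1 - j)" using 1 x by (simp add: of_nat_diff field_simps)
    moreover have "- x \<le> real r + (real m - 1) / 2" using x by (simp add: field_simps)
    ultimately have "- x \<in> wt_pos r m" unfolding wt_pos_def seg_def by blast
    thus ?thesis unfolding wt_neg_def by (metis image_eqI minus_minus)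
  next
    case 2
    have "x = (1 - real m) / 2 + real (j - r)" using 2 x by (simp add: of_nat_diff field_simps)
    moreover have "x \<le> (real m - 1) / 2" using 2 x by (simp add: field_simps)
    ultimately show ?thesis unfolding wt_mid_def seg_def by blast
  next
    case 3
    have "x = (real m + 1) / 2 + real (j - r - m)" using 3 x by (simp add: of_nat_diff field_simps)
    moreover have "x \<le> real r + (real m - 1) / 2" using j x by (simp add: field_simps)
    ultimately show ?thesis unfolding wt_pos_def seg_def by blast
  qed
qed

lemma wt_uminus:
  assumes "x \<in> wt r m"
  shows "- x \<in> wt r m"
proof -
  from assms obtain j where x: "x = (1 - 2 * real r - real m) / 2 + real j"
    and "x \<le> (2 * real r + real m - 1) / 2" by (auto simp: wt_def seg_def)
  hence "real j + 1 \<le> real (2 * r + m)" by (simp add: field_simps)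
  hence j: "j + 1 \<le> 2 * r + m" by linarith
  have "- x = (1 - 2 * real r - real m) / 2 + real (2 * r + m - 1 - j)"
    using j x by (simp add: of_nat_diff field_simps)
  moreover have "- x \<le> (2 * real r + real m - 1) / 2" using x by (simp add: field_simps)
  ultimately show ?thesis unfolding wt_def seg_def by blast
qed

lemma wt_pos_bounds: "x \<in> wt_pos r m \<Longrightarrow> (real m + 1) / 2 \<le> x"
  unfolding wt_pos_def seg_def using of_nat_0_le_iff by fastforce

lemma wt_neg_iff: "x \<in> wt_neg r m \<longleftrightarrow> - x \<in> wt_pos r m"
  by (force simp: wt_neg_def)

lemma wt_mid_bounds: "x \<in> wt_mid m \<Longrightarrow> \<bar>x\<bar> \<le> (real m - 1) / 2"
  by (auto simp: wt_mid_def seg_def field_simps)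

lemma flip_flip [simp]: "flip r m (flip r m a) = a"
  by (simp add: flip_def wt_neg_iff)

lemma flip_wt: "a \<in> wt r m \<Longrightarrow> flip r m a \<in> wt r m"
  by (simp add: flip_def wt_uminus)

lemma weyl_act_simple:
  assumes "f \<in> tuples r m d" "j < d"
  shows "weyl_act r m d f (simple_refl j) = simple_act r m f j"
proof
  fix i
  show "weyl_act r m d f (simple_refl j) i = simple_act r m f j i"
  proof (cases "i \<in> {1..d}")
    case True
    thus ?thesis using assms
      by (auto simp: weyl_act_def simple_refl_def simple_act_def transpose_def nat_add_distrib)
  next
    case False
    moreover have "f i = undefined" using False assms(1) by (auto simp: tuples_def)
    ultimately show ?thesis using assms by (auto simp: weyl_act_def simple_act_def)
  qed
qed

lemma weyl_mem_range:
  assumes "\<sigma> \<in> carrier (weyl d)" "i \<noteq> 0" "\<bar>i\<bar> \<le> int d"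
  shows "\<sigma> i \<noteq> 0" "\<bar>\<sigma> i\<bar> \<le> int d"
proof -
  have "\<sigma> permutes ({- int d..int d} - {0})" using assms(1) by (simp add: weyl_def)
  hence "\<sigma> i \<in> {- int d..int d} - {0} \<longleftrightarrow> i \<in> {- int d..int d} - {0}"
    by (rule permutes_in_image)
  thus "\<sigma> i \<noteq> 0" "\<bar>\<sigma> i\<bar> \<le> int d" using assms by auto
qed

lemma weyl_act_tuples:
  assumes "f \<in> tuples r m d" "\<sigma> \<in> carrier (weyl d)"
  shows "weyl_act r m d f \<sigma> \<in> tuples r m d"
  unfolding tuples_def
proof (rule PiE_I)
  fix i assume i: "i \<in> {1..d}"
  have *: "\<sigma> (int i) \<noteq> 0" "\<bar>\<sigma> (int i)\<bar> \<le> int d"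
    using weyl_mem_range[OF assms(2), of "int i"] i by auto
  have "f n \<in> wt r m" if "1 \<le> n" "n \<le> d" for n
    using assms(1) that by (auto simp: tuples_def)
  thus "weyl_act r m d f \<sigma> i \<in> wt r m"
    using i * by (auto simp: weyl_act_def intro!: flip_wt)
next
  fix i assume "i \<notin> {1..d}"
  thus "weyl_act r m d f \<sigma> i = undefined" by (simp only: weyl_act_def restrict_def if_False)
qed

lemma weyl_act_id: "f \<in> tuples r m d \<Longrightarrow> weyl_act r m d f \<one>\<^bsub>weyl d\<^esub> = f"
  by (rule ext) (auto simp: weyl_act_def weyl_def tuples_def)

lemma weyl_act_mult:
  assumes "\<sigma> \<in> carrier (weyl d)" "\<tau> \<in> carrier (weyl d)"
  shows "weyl_act r m d f (\<sigma> \<otimes>\<^bsub>weyl d\<^esub> \<tau>) = weyl_act r m d (weyl_act r m d f \<sigma>) \<tau>"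
proof
  fix i
  show "weyl_act r m d f (\<sigma> \<otimes>\<^bsub>weyl d\<^esub> \<tau>) i = weyl_act r m d (weyl_act r m d f \<sigma>) \<tau> i"
  proof (cases "i \<in> {1..d}")
    case True
    define n where "n = \<tau> (int i)"
    have n: "n \<noteq> 0" "\<bar>n\<bar> \<le> int d"
      using weyl_mem_range[OF assms(2), of "int i"] True by (auto simp: n_def)
    have s: "\<sigma> n \<noteq> 0" using weyl_mem_range[OF assms(1) n] by simp
    have neg: "\<sigma> (- n) = - \<sigma> n" using assms(1) by (simp add: weyl_def)
    show ?thesis using True n s neg
      by (auto simp: weyl_act_def weyl_def simp flip: n_def)
  next
    case False
    thus ?thesis by (simp only: weyl_act_def restrict_def if_False)
  qed
qed

lemma weyl_group: "Group.group (weyl d)"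
proof (rule groupI)
  fix \<sigma> assume s: "\<sigma> \<in> carrier (weyl d)"
  hence p: "\<sigma> permutes ({- int d..int d} - {0})" and n: "\<And>i. \<sigma> (- i) = - \<sigma> i"
    by (auto simp: weyl_def)
  have "Hilbert_Choice.inv \<sigma> (- i) = - Hilbert_Choice.inv \<sigma> i" for i
    using n p by (metis permutes_inverses)
  hence "Hilbert_Choice.inv \<sigma> \<in> carrier (weyl d)" using permutes_inv[OF p] by (simp add: weyl_def)
  thus "\<exists>\<tau>\<in>carrier (weyl d). \<tau> \<otimes>\<^bsub>weyl d\<^esub> \<sigma> = \<one>\<^bsub>weyl d\<^esub>"
    by (rule bexI[rotated]) (simp add: weyl_def permutes_inv_o[OF p])
qed (auto simp: weyl_def permutes_compose permutes_id)

lemma simple_refl_weyl: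
  assumes "i < d"
  shows "simple_refl i \<in> carrier (weyl d)"
proof -
  have "simple_refl i permutes ({- int d..int d} - {0})"
    using assms by (auto simp: simple_refl_def intro!: permutes_compose permutes_swap_id)
  moreover have "simple_refl i (- j) = - simple_refl i j" for j
    by (auto simp: simple_refl_def transpose_def)
  ultimately show ?thesis by (simp add: weyl_def)
qed

subsection \<open>The right module structure\<close>

lemma lookup_smult [simp]: "Poly_Mapping.lookup (smult c x) f = c * Poly_Mapping.lookup x f"
  unfolding smult_def by transfer (auto simp: when_def)

interpretation tensor: vector_space smult
  by standard (auto intro!: poly_mapping_eqI simp: lookup_add algebra_simps)

lemma smult_single: "smult c (Poly_Mapping.single f a) = Poly_Mapping.single f (c * a)"
  by (rule poly_mapping_eqI) (simp add: lookup_single when_def)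

lemma poly_mapping_induct [consumes 1, case_names single zero add]:
  fixes a :: "'a \<Rightarrow>\<^sub>0 'b::comm_monoid_add"
  assumes "Poly_Mapping.keys a \<subseteq> S"
    and "\<And>w c. w \<in> S \<Longrightarrow> P (Poly_Mapping.single w c)"
    and "P 0" and "\<And>a b. P a \<Longrightarrow> P b \<Longrightarrow> P (a + b)"
  shows "P a"
proof -
  have "a = (\<Sum>w\<in>Poly_Mapping.keys a. Poly_Mapping.single w (Poly_Mapping.lookup a w))"
    by (rule poly_mapping_eqI)
       (simp add: lookup_sum lookup_single when_def in_keys_iff sum.delta)
  moreover have "P (\<Sum>w\<in>K. Poly_Mapping.single w (Poly_Mapping.lookup a w))"
    if "finite K" "K \<subseteq> Poly_Mapping.keys a" for K
    using that by (induction K) (use assms in auto)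
  ultimately show ?thesis by (metis finite_keys order_refl)
qed

lemma gen_act_add: "gen_act r m k i (x + y) = gen_act r m k i x + gen_act r m k i y"
  unfolding gen_act_def by (rule setsum_keys_plus_distrib) (simp_all add: tensor.scale_left_distrib)

lemma gen_act_single: "gen_act r m k i (Poly_Mapping.single f c) = smult c (std_act r m k i f)"
  by (simp add: gen_act_def)

lemma gen_act_0 [simp]: "gen_act r m k i 0 = 0"
  by (simp add: gen_act_def)

lemma gen_act_smult: "gen_act r m k i (smult c x) = smult c (gen_act r m k i x)"
proof -
  have "Poly_Mapping.keys x \<subseteq> UNIV" by simp
  thus ?thesis
    by (induction rule: poly_mapping_induct)
       (simp_all add: smult_single gen_act_single gen_act_add tensor.scale_right_distrib)
qed

lemma gen_act_diff: "gen_act r m k i (x - y) = gen_act r m k i x - gen_act r m k i y"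
  using gen_act_add[of r m k i "x - y" y] by simp

lemma word_act_0 [simp]: "fold (gen_act r m k) ws 0 = 0"
  by (induction ws) auto

lemma word_act_add:
  "fold (gen_act r m k) ws (x + y) = fold (gen_act r m k) ws x + fold (gen_act r m k) ws y"
  by (induction ws arbitrary: x y) (auto simp: gen_act_add)

lemma word_act_smult:
  "fold (gen_act r m k) ws (smult c x) = smult c (fold (gen_act r m k) ws x)"
  by (induction ws arbitrary: x) (auto simp: gen_act_smult)

lemma free_act_add_right: "free_act r m k x (a + b) = free_act r m k x a + free_act r m k x b"
  unfolding free_act_def by (rule setsum_keys_plus_distrib) (simp_all add: tensor.scale_left_distrib)

lemma free_act_0_right [simp]: "free_act r m k x 0 = 0"
  by (simp add: free_act_def)

lemma free_act_single:
  "free_act r m k x (Poly_Mapping.single w c) = smult c (fold (gen_act r m k) (letters w) x)"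
  by (simp add: free_act_def)

lemma free_act_add_left: "free_act r m k (x + y) a = free_act r m k x a + free_act r m k y a"
  by (simp add: free_act_def word_act_add tensor.scale_right_distrib sum.distrib)

lemma free_act_0_left [simp]: "free_act r m k 0 a = 0"
  by (simp add: free_act_def)

lemma free_act_smult_left: "free_act r m k (smult c x) a = smult c (free_act r m k x a)"
  by (simp add: free_act_def word_act_smult tensor.scale_sum_right mult.commute)

lemma free_act_minus_right: "free_act r m k x (- a) = - free_act r m k x a"
  using free_act_add_right[of r m k x a "- a"] by (simp add: eq_neg_iff_add_eq_0 add.commute)

lemma free_act_diff_right: "free_act r m k x (a - b) = free_act r m k x a - free_act r m k x b"
  using free_act_add_right[of r m k x a "- b"] by (simp add: free_act_minus_right)

lemma letters_0 [simp]: "letters 0 = []"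
  by (simp add: zero_word_def)

lemma letters_add [simp]: "letters (u + v) = letters u @ letters v"
  by (simp add: plus_word_def)

lemma free_act_1 [simp]: "free_act r m k x 1 = x"
  using free_act_single[of r m k x 0 1] by simp

lemma free_act_mult: "free_act r m k x (a * b) = free_act r m k (free_act r m k x a) b"
proof -
  have "Poly_Mapping.keys b \<subseteq> UNIV" "Poly_Mapping.keys a \<subseteq> UNIV" by simp_all
  thus ?thesis
  proof (induction b rule: poly_mapping_induct)
    case (single w c)
    from single(2) show ?case
    proof (induction a rule: poly_mapping_induct)
      case (single v e)
      show ?case
        by (simp add: mult_single free_act_single word_act_smult mult.commute)
    qed (simp_all add: free_act_add_left free_act_add_right distrib_right)
  qed (simp_all add: free_act_add_right distrib_left)
qed

lemma simple_act_0_pos: "f 1 \<in> wt_pos r m \<Longrightarrow> simple_act r m f 0 = f(1 := - f 1)"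
  and simple_act_0_neg: "f 1 \<in> wt_neg r m \<Longrightarrow> simple_act r m f 0 = f(1 := - f 1)"
  by (simp_all add: simple_act_def flip_def)

lemma simple_act_tuples:
  assumes "f \<in> tuples r m d" "i < d"
  shows "simple_act r m f i \<in> tuples r m d"
  using weyl_act_tuples[OF assms(1) simple_refl_weyl[OF assms(2)]] weyl_act_simple[OF assms] by simp

lemma std_act_tensor_space:
  assumes "f \<in> tuples r m d" "i < d"
  shows "std_act r m k i f \<in> tensor_space r m d"
proof -
  have "i = 0 \<Longrightarrow> simple_act r m f 0 \<in> tuples r m d"
    using simple_act_tuples[OF assms] by simp
  thus ?thesis
    using simple_act_tuples[OF assms] assms(1)
    by (auto simp: std_act_def tensor_space_def Let_def smult_single split: if_splits
             dest!: Poly_Mapping.keys_add[THEN subsetD])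
qed

lemma tensor_space_0 [simp]: "0 \<in> tensor_space r m d"
  by (simp add: tensor_space_def)

lemma tensor_space_add: "x \<in> tensor_space r m d \<Longrightarrow> y \<in> tensor_space r m d \<Longrightarrow> x + y \<in> tensor_space r m d"
  unfolding tensor_space_def using Poly_Mapping.keys_add[of x y] by blast

lemma tensor_space_smult: "x \<in> tensor_space r m d \<Longrightarrow> smult c x \<in> tensor_space r m d"
  by (auto simp: tensor_space_def in_keys_iff)

lemma gen_act_tensor_space:
  assumes "x \<in> tensor_space r m d" "i < d"
  shows "gen_act r m k i x \<in> tensor_space r m d"
proof -
  have "Poly_Mapping.keys x \<subseteq> tuples r m d" using assms by (simp add: tensor_space_def)
  thus ?thesis
    by (induction rule: poly_mapping_induct)
       (simp_all add: gen_act_single gen_act_add tensor_space_add tensor_space_smult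
          std_act_tensor_space assms(2))
qed

lemma word_act_tensor_space:
  "x \<in> tensor_space r m d \<Longrightarrow> set ws \<subseteq> {..<d} \<Longrightarrow> fold (gen_act r m k) ws x \<in> tensor_space r m d"
  by (induction ws arbitrary: x) (simp_all add: gen_act_tensor_space)

lemma free_act_tensor_space:
  assumes "x \<in> tensor_space r m d" "a \<in> carrier (free_alg d)"
  shows "free_act r m k x a \<in> tensor_space r m d"
proof -
  have "Poly_Mapping.keys a \<subseteq> {w. set (letters w) \<subseteq> {..<d}}" using assms by (auto simp: free_alg_def)
  thus ?thesis
    by (induction rule: poly_mapping_induct)
       (simp_all add: free_act_single free_act_add_right tensor_space_add tensor_space_smult
          word_act_tensor_space assms(1))
qed

text \<open>It suffices to check the defining relations on basis vectors.\<close>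

lemma word_act_eqI:
  assumes "x \<in> tensor_space r m d"
    and "\<And>f. f \<in> tuples r m d \<Longrightarrow> fold (gen_act r m k) u (std f) = fold (gen_act r m k) v (std f)"
  shows "fold (gen_act r m k) u x = fold (gen_act r m k) v x"
proof -
  have "Poly_Mapping.keys x \<subseteq> tuples r m d" using assms by (simp add: tensor_space_def)
  thus ?thesis
  proof (induction rule: poly_mapping_induct)
    case (single f c)
    have "Poly_Mapping.single f c = smult c (std f)" by (simp add: smult_single)
    thus ?case using assms(2)[OF single] by (simp only: word_act_smult)
  qed (simp_all add: word_act_add)
qed

lemma gen_act_std: "gen_act r m k i (std f) = std_act r m k i f"
  by (simp add: gen_act_single)

lemma param_quadratic: "(p::ratfun) \<noteq> 0 \<Longrightarrow> p * (p - inverse p) + 1 = p * p"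
  by (simp add: algebra_simps)

lemma braid3:
  fixes T\<^sub>1 T\<^sub>2 :: "('i \<Rightarrow>\<^sub>0 'k::field) \<Rightarrow> 'i \<Rightarrow>\<^sub>0 'k" and M :: "real \<Rightarrow> real \<Rightarrow> real \<Rightarrow> 'i \<Rightarrow>\<^sub>0 'k"
  assumes lk: "\<And>c x i. Poly_Mapping.lookup (sm c x) i = c * Poly_Mapping.lookup x i"
    and add: "\<And>x y. T\<^sub>1 (x + y) = T\<^sub>1 x + T\<^sub>1 y" "\<And>x y. T\<^sub>2 (x + y) = T\<^sub>2 x + T\<^sub>2 y"
    and smul: "\<And>c x. T\<^sub>1 (sm c x) = sm c (T\<^sub>1 x)" "\<And>c x. T\<^sub>2 (sm c x) = sm c (T\<^sub>2 x)"
    and T1: "\<And>a b c. T\<^sub>1 (M a b c) = (if a < b then M b a c + sm t (M a b c)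
               else if a > b then M b a c else sm e (M a b c))"
    and T2: "\<And>a b c. T\<^sub>2 (M a b c) = (if b < c then M a c b + sm t (M a b c)
               else if b > c then M a c b else sm e (M a b c))"
    and t: "e * t + 1 = e * e"
  shows "T\<^sub>1 (T\<^sub>2 (T\<^sub>1 (M a b c))) = T\<^sub>2 (T\<^sub>1 (T\<^sub>2 (M a b c)))"
proof (rule poly_mapping_eqI)
  fix g
  have r1: "e * e = 1 + e * t" using t by (simp add: add.commute)
  have r2: "e * (e * x) = x + e * (t * x)" for x
    unfolding mult.assoc[symmetric] r1 by (simp add: distrib_right)
  note r = r1 r2
  have "a < b \<or> a = b \<or> b < a" "b < c \<or> b = c \<or> c < b" "a < c \<or> a = c \<or> c < a" by linarith+
  thus "Poly_Mapping.lookup (T\<^sub>1 (T\<^sub>2 (T\<^sub>1 (M a b c)))) g =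
      Poly_Mapping.lookup (T\<^sub>2 (T\<^sub>1 (T\<^sub>2 (M a b c)))) g"
    by (elim disjE; simp add: add smul T1 T2 lookup_add lk; (simp add: algebra_simps r)?)
qed

lemma braid4:
  fixes T\<^sub>0 T\<^sub>1 :: "('i \<Rightarrow>\<^sub>0 'k::field) \<Rightarrow> 'i \<Rightarrow>\<^sub>0 'k" and M :: "real \<Rightarrow> real \<Rightarrow> 'i \<Rightarrow>\<^sub>0 'k"
  assumes lk: "\<And>c x i. Poly_Mapping.lookup (sm c x) i = c * Poly_Mapping.lookup x i"
    and add: "\<And>x y. T\<^sub>0 (x + y) = T\<^sub>0 x + T\<^sub>0 y" "\<And>x y. T\<^sub>1 (x + y) = T\<^sub>1 x + T\<^sub>1 y"
    and smul: "\<And>c x. T\<^sub>0 (sm c x) = sm c (T\<^sub>0 x)" "\<And>c x. T\<^sub>1 (sm c x) = sm c (T\<^sub>1 x)"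
    and T0: "\<And>a b. T\<^sub>0 (M a b) = (if a \<in> P then M (- a) b + sm s (M a b)
               else if - a \<in> P then M (- a) b else sm p (M a b))"
    and T1: "\<And>a b. T\<^sub>1 (M a b) = (if a < b then M b a + sm t (M a b)
               else if a > b then M b a else sm e (M a b))"
    and t: "e * t + 1 = e * e" and s: "p * s + 1 = p * p"
    and P: "\<And>a. a \<in> P \<Longrightarrow> a > C" "C \<ge> 0"
    and a: "a \<in> P \<or> - a \<in> P \<or> \<bar>a\<bar> \<le> C" and b: "b \<in> P \<or> - b \<in> P \<or> \<bar>b\<bar> \<le> C"
  shows "T\<^sub>1 (T\<^sub>0 (T\<^sub>1 (T\<^sub>0 (M a b)))) = T\<^sub>0 (T\<^sub>1 (T\<^sub>0 (T\<^sub>1 (M a b))))"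
proof (rule poly_mapping_eqI)
  fix g
  have r1: "e * e = 1 + e * t" using t by (simp add: add.commute)
  have r2: "e * (e * x) = x + e * (t * x)" for x
    unfolding mult.assoc[symmetric] r1 by (simp add: distrib_right)
  note r = r1 r2
  have u1: "p * p = 1 + p * s" using s by (simp add: add.commute)
  have u2: "p * (p * x) = x + p * (s * x)" for x
    unfolding mult.assoc[symmetric] u1 by (simp add: distrib_right)
  note u = u1 u2
  have ord: "a < b \<or> a = b \<or> b < a" "a < - b \<or> a = - b \<or> - b < a" by linarith+
  consider (p) "a > C" "a \<in> P" "- a \<notin> P"
      | (n) "a < - C" "a \<notin> P" "- a \<in> P"
      | (m) "a \<le> C" "- C \<le> a" "a \<notin> P" "- a \<notin> P"
    using a P(1)[of a] P(1)[of "- a"] P(2) by fastforce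
  note A = this
  consider (p) "b > C" "b \<in> P" "- b \<notin> P"
      | (n) "b < - C" "b \<notin> P" "- b \<in> P"
      | (m) "b \<le> C" "- C \<le> b" "b \<notin> P" "- b \<notin> P"
    using b P(1)[of b] P(1)[of "- b"] P(2) by fastforce
  note B = this
  show "Poly_Mapping.lookup (T\<^sub>1 (T\<^sub>0 (T\<^sub>1 (T\<^sub>0 (M a b))))) g =
      Poly_Mapping.lookup (T\<^sub>0 (T\<^sub>1 (T\<^sub>0 (T\<^sub>1 (M a b))))) g"
  proof (cases rule: A)
    case p
    note a = this
    show ?thesis
    proof (cases rule: B)
      case p
      thus ?thesis using ord P(2) a
        by (elim disjE; simp add: add smul T0 T1 lookup_add lk; (simp add: algebra_simps r u)?)
    next
      case n
      thus ?thesis using ord P(2) a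
        by (elim disjE; simp add: add smul T0 T1 lookup_add lk; (simp add: algebra_simps r u)?)
    next
      case m
      thus ?thesis using ord P(2) a
        by (elim disjE; simp add: add smul T0 T1 lookup_add lk; (simp add: algebra_simps r u)?)
    qed
  next
    case n
    note a = this
    show ?thesis
    proof (cases rule: B)
      case p
      thus ?thesis using ord P(2) a
        by (elim disjE; simp add: add smul T0 T1 lookup_add lk; (simp add: algebra_simps r u)?)
    next
      case n
      thus ?thesis using ord P(2) a
        by (elim disjE; simp add: add smul T0 T1 lookup_add lk; (simp add: algebra_simps r u)?)
    next
      case m
      thus ?thesis using ord P(2) a
        by (elim disjE; simp add: add smul T0 T1 lookup_add lk; (simp add: algebra_simps r u)?)
    qed
  next
    case m
    note a = this
    show ?thesis
    proof (cases rule: B)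
      case p
      thus ?thesis using ord P(2) a
        by (elim disjE; simp add: add smul T0 T1 lookup_add lk; (simp add: algebra_simps r u)?)
    next
      case n
      thus ?thesis using ord P(2) a
        by (elim disjE; simp add: add smul T0 T1 lookup_add lk; (simp add: algebra_simps r u)?)
    next
      case m
      thus ?thesis using ord P(2) a
        by (elim disjE; simp add: add smul T0 T1 lookup_add lk; (simp add: algebra_simps r u)?)
    qed
  qed
qed

lemma gen_act_pos:
  assumes "i > 0"
  shows "gen_act r m k i (std f) =
    (if f i < f (Suc i) then std (f(i := f (Suc i), Suc i := f i)) + smult (q - inverse q) (std f)
     else if f i > f (Suc i) then std (f(i := f (Suc i), Suc i := f i)) else smult q (std f))"
  using assms by (simp add: gen_act_std std_act_def simple_act_def)

lemma gen_act_zero: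
  "gen_act r m k 0 (std f) =
    (if f 1 \<in> wt_pos r m then std (f(1 := - f 1)) + smult (q powi k - inverse (q powi k)) (std f)
     else if - f 1 \<in> wt_pos r m then std (f(1 := - f 1)) else smult (q powi k) (std f))"
  by (simp add: gen_act_std std_act_def Let_def simple_act_0_pos simple_act_0_neg wt_neg_iff)

lemma gen_act_braid3:
  assumes "i > 0"
  shows "gen_act r m k i (gen_act r m k (Suc i) (gen_act r m k i (std f))) =
         gen_act r m k (Suc i) (gen_act r m k i (gen_act r m k (Suc i) (std f)))"
proof -
  define M where "M a b c = std (f(i := a, Suc i := b, Suc (Suc i) := c))" for a b c
  have f: "std f = M (f i) (f (Suc i)) (f (Suc (Suc i)))" by (simp add: M_def)
  show ?thesis
    unfolding f
    by (rule braid3[where sm = smult and t = "q - inverse q" and e = q])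
       (use assms in \<open>simp_all add: gen_act_add gen_act_smult param_quadratic gen_act_pos M_def
          fun_upd_twist fun_upd_upd\<close>)
qed

lemma gen_act_braid4:
  assumes "f 1 \<in> wt r m" "f 2 \<in> wt r m"
  shows "gen_act r m k 1 (gen_act r m k 0 (gen_act r m k 1 (gen_act r m k 0 (std f)))) =
         gen_act r m k 0 (gen_act r m k 1 (gen_act r m k 0 (gen_act r m k 1 (std f))))"
proof -
  define M where "M a b = std (f(1 := a, 2 := b))" for a b
  have f: "std f = M (f 1) (f 2)" by (simp add: M_def)
  have wt: "a \<in> wt_pos r m \<or> - a \<in> wt_pos r m \<or> \<bar>a\<bar> \<le> real m / 2" if "a \<in> wt r m" for a
    using wt_cases[OF that] wt_mid_bounds[of a m] by (auto simp: wt_neg_iff)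
  show ?thesis
    unfolding f
  proof (rule braid4[where sm = smult and t = "q - inverse q" and e = q and P = "wt_pos r m"
        and C = "real m / 2" and p = "q powi k" and s = "q powi k - inverse (q powi k)"])
    show "real m / 2 < a" if "a \<in> wt_pos r m" for a using wt_pos_bounds[OF that] by simp
  qed (use wt[OF assms(1)] wt[OF assms(2)] in
        \<open>simp_all add: gen_act_add gen_act_smult param_quadratic gen_act_pos gen_act_zero M_def
          fun_upd_twist numeral_2_eq_2\<close>)
qed

lemma gen_act_commute:
  assumes "Suc i < j"
  shows "gen_act r m k i (gen_act r m k j (std f)) = gen_act r m k j (gen_act r m k i (std f))"
proof (cases "i = 0")
  case True
  have [simp]: "f(Suc 0 := a, j := b, Suc j := c) = f(j := b, Suc j := c, Suc 0 := a)" for a b c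
    using assms by (auto simp: fun_upd_def)
  show ?thesis using assms True
    by (simp add: gen_act_pos gen_act_zero gen_act_add gen_act_smult tensor.scale_right_distrib
          tensor.scale_left_commute add_ac)
next
  case False
  have [simp]: "f(i := a, Suc i := a', j := b, Suc j := c) = f(j := b, Suc j := c, i := a, Suc i := a')"
    for a a' b c using assms by (auto simp: fun_upd_def)
  show ?thesis using assms False
    by (simp add: gen_act_pos gen_act_add gen_act_smult tensor.scale_right_distrib
          tensor.scale_left_commute add_ac)
qed

lemma gen_act_quadratic:
  assumes "p = hecke_param k i"
  shows "gen_act r m k i (gen_act r m k i (std f)) =
           smult (p - inverse p) (gen_act r m k i (std f)) + std f"
proof (cases "i = 0")
  case True
  hence "p \<noteq> 0" and p: "p = q powi k" using assms by (simp_all add: hecke_param_def)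
  define s where "s = p - inverse p"
  have ps: "p * p = 1 + p * s" using param_quadratic[OF \<open>p \<noteq> 0\<close>] by (simp add: s_def)
  have ps': "p * (p * x) = x + p * (s * x)" for x
    unfolding mult.assoc[symmetric] ps by (simp add: distrib_right)
  have notboth: "- a \<notin> wt_pos r m" if "a \<in> wt_pos r m" for a
    using wt_pos_bounds[OF that] wt_pos_bounds[of "- a" r m] by fastforce
  show ?thesis
    unfolding True s_def[symmetric]
    by (auto intro!: poly_mapping_eqI dest: notboth
        simp: gen_act_zero gen_act_add gen_act_smult lookup_add ps ps' distrib_right mult.commute[of p s] add.commute
        simp flip: p s_def)
next
  case False
  hence p: "p = q" using assms by (simp add: hecke_param_def)
  define s where "s = q - inverse q"
  have qs: "q * q = 1 + q * s" using param_quadratic[of q] by (simp add: s_def)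
  have qs': "q * (q * x) = x + q * (s * x)" for x
    unfolding mult.assoc[symmetric] qs by (simp add: distrib_right)
  show ?thesis
    unfolding p s_def[symmetric] using False
    by (auto intro!: poly_mapping_eqI
        simp: gen_act_pos gen_act_add gen_act_smult lookup_add qs qs' distrib_right mult.commute[of q s]
          add.commute
        simp flip: s_def)
qed

lemma free_alg_simps [simp]:
  "mult (free_alg d) = (*)" "one (free_alg d) = 1" "zero (free_alg d) = 0" "add (free_alg d) = (+)"
  by (simp_all add: free_alg_def)

lemma free_alg_carrier:
  "a \<in> carrier (free_alg d) \<longleftrightarrow> Poly_Mapping.keys a \<subseteq> {w. set (letters w) \<subseteq> {..<d}}"
  by (auto simp: free_alg_def)

lemma free_alg_0: "0 \<in> carrier (free_alg d)"
  and free_alg_1: "1 \<in> carrier (free_alg d)"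
  and free_alg_fconst: "fconst c \<in> carrier (free_alg d)"
  by (auto simp: free_alg_carrier)

lemma free_alg_single:
  "set (letters w) \<subseteq> {..<d} \<Longrightarrow> Poly_Mapping.single w c \<in> carrier (free_alg d)"
  by (auto simp: free_alg_carrier)

lemma free_alg_add:
  "a \<in> carrier (free_alg d) \<Longrightarrow> b \<in> carrier (free_alg d) \<Longrightarrow> a + b \<in> carrier (free_alg d)"
  unfolding free_alg_carrier using Poly_Mapping.keys_add[of a b] by blast

lemma free_alg_uminus: "a \<in> carrier (free_alg d) \<Longrightarrow> - a \<in> carrier (free_alg d)"
  by (auto simp: free_alg_carrier in_keys_iff)

lemma free_alg_diff:
  "a \<in> carrier (free_alg d) \<Longrightarrow> b \<in> carrier (free_alg d) \<Longrightarrow> a - b \<in> carrier (free_alg d)"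
  using free_alg_add[OF _ free_alg_uminus, of a d b] by simp

lemma free_alg_mult:
  "a \<in> carrier (free_alg d) \<Longrightarrow> b \<in> carrier (free_alg d) \<Longrightarrow> a * b \<in> carrier (free_alg d)"
  unfolding free_alg_carrier using Poly_Mapping.keys_mult[of a b] by fastforce

lemmas free_alg_closed =
  free_alg_0 free_alg_1 free_alg_fconst free_alg_single free_alg_add free_alg_uminus free_alg_diff free_alg_mult

lemma free_alg_induct [consumes 1, case_names single zero add]:
  assumes "a \<in> carrier (free_alg d)"
    and "\<And>ws c. set ws \<subseteq> {..<d} \<Longrightarrow> P (Poly_Mapping.single (Word ws) c)"
    and "P 0" and "\<And>a b. a \<in> carrier (free_alg d) \<Longrightarrow> b \<in> carrier (free_alg d) \<Longrightarrow> P a \<Longrightarrow> P b \<Longrightarrow> P (a + b)"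
  shows "P a"
proof -
  have "a \<in> carrier (free_alg d) \<and> P a"
    using assms(1)[unfolded free_alg_carrier]
  proof (induction rule: poly_mapping_induct)
    case (single w c)
    thus ?case using assms(2)[of "letters w" c] by (simp add: free_alg_single)
  qed (use assms(3,4) in \<open>auto intro: free_alg_closed\<close>)
  thus ?thesis ..
qed

lemma free_alg_ring: "ring (free_alg d)"
proof (rule ringI)
  show "abelian_group (free_alg d)"
    by (rule abelian_groupI)
       (auto simp: free_alg_closed add_ac intro!: bexI[of _ "- _"])
  show "Group.monoid (free_alg d)"
    by (rule Group.monoidI) (auto simp: free_alg_closed mult.assoc)
qed (auto simp: distrib_left distrib_right)

lemma free_alg_a_minus:
  assumes "a \<in> carrier (free_alg d)" "b \<in> carrier (free_alg d)"
  shows "a \<ominus>\<^bsub>free_alg d\<^esub> b = a - b"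
proof -
  interpret ring "free_alg d" by (rule free_alg_ring)
  have "\<ominus>\<^bsub>free_alg d\<^esub> b = - b"
    by (rule minus_equality) (simp_all add: assms free_alg_closed)
  thus ?thesis by (simp add: a_minus_def)
qed

lemma braid_pairs_letters: "(u, v) \<in> braid_pairs d \<Longrightarrow> set u \<subseteq> {..<d} \<and> set v \<subseteq> {..<d}"
  by (auto simp: braid_pairs_def split: if_splits)

lemma hecke_rels_carrier: "hecke_rels d k \<subseteq> carrier (free_alg d)"
  using braid_pairs_letters
  by (auto simp: hecke_rels_def intro!: free_alg_closed) blast+

lemma hecke_ideal_ideal: "ideal (hecke_ideal d k) (free_alg d)"
  unfolding hecke_ideal_def by (rule ring.genideal_ideal[OF free_alg_ring hecke_rels_carrier])

lemma hecke_ring: "ring (hecke d k)"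
  unfolding hecke_def by (rule ideal.quotient_is_ring[OF hecke_ideal_ideal])

lemma hecke_rels_ideal: "hecke_rels d k \<subseteq> hecke_ideal d k"
  unfolding hecke_ideal_def by (rule ring.genideal_self[OF free_alg_ring hecke_rels_carrier])

lemma hecke_ideal_minimal: "ideal J (free_alg d) \<Longrightarrow> hecke_rels d k \<subseteq> J \<Longrightarrow> hecke_ideal d k \<subseteq> J"
  unfolding hecke_ideal_def by (rule ring.genideal_minimal[OF free_alg_ring])

lemma free_alg_idealI:
  assumes "J \<subseteq> carrier (free_alg d)" "0 \<in> J"
    and "\<And>a b. a \<in> J \<Longrightarrow> b \<in> J \<Longrightarrow> a + b \<in> J"
    and "\<And>a b. a \<in> J \<Longrightarrow> b \<in> carrier (free_alg d) \<Longrightarrow> b * a \<in> J"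
    and "\<And>a b. a \<in> J \<Longrightarrow> b \<in> carrier (free_alg d) \<Longrightarrow> a * b \<in> J"
  shows "ideal J (free_alg d)"
proof -
  interpret ring "free_alg d" by (rule free_alg_ring)
  have "additive_subgroup J (free_alg d)"
  proof
    show "inv\<^bsub>add_monoid (free_alg d)\<^esub> a \<in> J" if "a \<in> J" for a
    proof -
      have "- 1 \<in> carrier (free_alg d)" by (simp add: free_alg_closed)
      hence "- 1 * a \<in> J" using assms(4) that by blast
      moreover have "\<ominus>\<^bsub>free_alg d\<^esub> a = - a"
        using that assms(1) by (intro minus_equality) (auto intro: free_alg_closed)
      ultimately show ?thesis by (simp add: a_inv_def)
    qed
  qed (use assms in auto)
  thus ?thesis using assms(4,5) by (intro idealI free_alg_ring) (auto simp: additive_subgroup_def)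
qed

lemma gen_act_hecke_rels:
  assumes "x \<in> tensor_space r m d" "a \<in> hecke_rels d k"
  shows "free_act r m k x a = 0"
proof -
  have braid: "fold (gen_act r m k) u x = fold (gen_act r m k) v x" if "(u, v) \<in> braid_pairs d" for u v
  proof (rule word_act_eqI[OF assms(1)])
    fix f assume f: "f \<in> tuples r m d"
    have "f 1 \<in> wt r m \<and> f 2 \<in> wt r m" if "1 < d" using f that by (auto simp: tuples_def)
    thus "fold (gen_act r m k) u (std f) = fold (gen_act r m k) v (std f)"
      using that gen_act_braid3[where r = r and m = m and k = k and f = f]
        gen_act_braid4[of f r m k]
      by (auto simp: braid_pairs_def split: if_splits intro: gen_act_commute[symmetric])
  qed
  have quad: "fold (gen_act r m k) [i, i] x = smult (hecke_param k i - inverse (hecke_param k i)) (gen_act r m k i x) + x"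
    for i
  proof -
    have "Poly_Mapping.keys x \<subseteq> UNIV" by simp
    thus ?thesis
    proof (induction rule: poly_mapping_induct)
      case (single f c)
      have "Poly_Mapping.single f c = smult c (std f)" by (simp add: smult_single)
      thus ?case
        by (simp add: gen_act_smult gen_act_quadratic[OF refl] tensor.scale_right_distrib
              tensor.scale_left_commute mult.commute)
    qed (simp_all add: gen_act_add tensor.scale_right_distrib add_ac)
  qed
  from assms(2) consider u v where "(u, v) \<in> braid_pairs d" "a = fword u - fword v"
    | i where "a = (fword [i] - fconst (hecke_param k i)) * (fword [i] + fconst (inverse (hecke_param k i)))"
    by (auto simp: hecke_rels_def)
  thus ?thesis
  proof cases
    case 1
    thus ?thesis using braid by (simp add: free_act_diff_right free_act_single)
  next
    case (2 i)
    have "hecke_param k i \<noteq> 0" by (simp add: hecke_param_def)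
    thus ?thesis using quad[of i]
      by (simp add: 2 free_act_mult free_act_diff_right free_act_add_right free_act_single
            gen_act_diff gen_act_smult tensor.scale_right_distrib
            tensor.scale_left_diff_distrib tensor.scale_right_diff_distrib)
  qed
qed

lemma hecke_ideal_act:
  assumes "a \<in> hecke_ideal d k" "x \<in> tensor_space r m d"
  shows "free_act r m k x a = 0"
proof -
  define J where "J = {a \<in> carrier (free_alg d). \<forall>x\<in>tensor_space r m d. free_act r m k x a = 0}"
  have "ideal J (free_alg d)"
    by (rule free_alg_idealI)
       (auto simp: J_def free_alg_closed free_act_add_right free_act_mult free_act_tensor_space)
  moreover have "hecke_rels d k \<subseteq> J"
    using hecke_rels_carrier gen_act_hecke_rels by (auto simp: J_def)
  ultimately have "hecke_ideal d k \<subseteq> J" by (rule hecke_ideal_minimal)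
  thus ?thesis using assms by (auto simp: J_def)
qed

lemma hecke_coset_iff:
  assumes "a \<in> carrier (free_alg d)"
  shows "b \<in> hecke_ideal d k +>\<^bsub>free_alg d\<^esub> a \<longleftrightarrow> b - a \<in> hecke_ideal d k"
  by (force simp: a_r_coset_def' algebra_simps intro: bexI[of _ "b - a"])

lemma hecke_carrier:
  "carrier (hecke d k) = (+>\<^bsub>free_alg d\<^esub>) (hecke_ideal d k) ` carrier (free_alg d)"
  by (auto simp: hecke_def FactRing_def A_RCOSETS_def')

lemma hecke_act_coset:
  assumes "x \<in> tensor_space r m d" "a \<in> carrier (free_alg d)"
  shows "hecke_act r m k x (hecke_ideal d k +>\<^bsub>free_alg d\<^esub> a) = free_act r m k x a"
proof -
  have "a \<in> hecke_ideal d k +>\<^bsub>free_alg d\<^esub> a"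
    using hecke_coset_iff[OF assms(2)] additive_subgroup.zero_closed[OF ideal.axioms(1)[OF hecke_ideal_ideal]]
    by simp
  moreover have "free_act r m k x b = free_act r m k x a"
    if "b \<in> hecke_ideal d k +>\<^bsub>free_alg d\<^esub> a" for b
    using hecke_ideal_act[OF _ assms(1), of "b - a" k] that hecke_coset_iff[OF assms(2)]
    by (simp add: free_act_diff_right)
  ultimately have "free_act r m k x ` (hecke_ideal d k +>\<^bsub>free_alg d\<^esub> a) = {free_act r m k x a}"
    by blast
  thus ?thesis by (simp add: hecke_act_def)
qed

lemma hecke_act_gen:
  assumes "f \<in> tuples r m d" "i < d"
  shows "hecke_act r m k (std f) (hecke_gen d k i) = std_act r m k i f"
proof -
  have "std f \<in> tensor_space r m d" using assms(1) by (simp add: tensor_space_def)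
  thus ?thesis
    unfolding hecke_gen_def using assms(2)
    by (subst hecke_act_coset) (auto intro!: free_alg_single simp: free_act_single gen_act_std)
qed

lemma hecke_act_mult:
  assumes "x \<in> tensor_space r m d" "h \<in> carrier (hecke d k)" "h' \<in> carrier (hecke d k)"
  shows "hecke_act r m k x (h \<otimes>\<^bsub>hecke d k\<^esub> h') = hecke_act r m k (hecke_act r m k x h) h'"
proof -
  from assms obtain a b where ab: "a \<in> carrier (free_alg d)" "b \<in> carrier (free_alg d)"
    "h = hecke_ideal d k +>\<^bsub>free_alg d\<^esub> a" "h' = hecke_ideal d k +>\<^bsub>free_alg d\<^esub> b"
    by (auto simp: hecke_carrier)
  have "h \<otimes>\<^bsub>hecke d k\<^esub> h' = hecke_ideal d k +>\<^bsub>free_alg d\<^esub> (a * b)"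
    using ideal.rcoset_mult_add[OF hecke_ideal_ideal ab(1,2), of k] by (simp add: hecke_def FactRing_def ab)
  thus ?thesis
    using ab by (simp add: hecke_act_coset assms free_act_tensor_space free_alg_mult free_act_mult)
qed

subsection \<open>The bar operator of the Hecke algebra\<close>

lemma fconst_add: "fconst (a + b) = fconst a + fconst b"
  and fconst_mult: "fconst (a * b) = fconst a * fconst b"
  and fconst_uminus: "fconst (- a) = - fconst a"
  and fconst_diff: "fconst (a - b) = fconst a - fconst b"
  by (simp_all add: single_add mult_single single_uminus single_diff)

lemma fconst_times_single: "fconst c * Poly_Mapping.single w e = Poly_Mapping.single w (c * e)"
  by (simp add: mult_single)

lemma fconst_commute: "fconst c * a = a * fconst c"
proof -
  have "Poly_Mapping.keys a \<subseteq> UNIV" by simp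
  thus ?thesis
    by (induction rule: poly_mapping_induct)
       (simp_all add: mult_single distrib_left distrib_right mult.commute)
qed

lemma fword_Cons: "fword (i # ws) = fword [i] * fword ws"
  and fword_append: "fword (us @ ws) = fword us * fword ws"
  and fword_Nil: "fword [] = 1"
  by (simp_all add: mult_single plus_word_def flip: zero_word_def)

definition gen_inv :: "int \<Rightarrow> nat \<Rightarrow> free_elem" where
  "gen_inv k i = fword [i] - fconst (hecke_param k i - inverse (hecke_param k i))"

definition word_inv :: "int \<Rightarrow> nat list \<Rightarrow> free_elem" where
  "word_inv k ws = prod_list (map (gen_inv k) ws)"

definition free_bar :: "int \<Rightarrow> free_elem \<Rightarrow> free_elem" where
  "free_bar k a = (\<Sum>w\<in>Poly_Mapping.keys a. fconst (bar (Poly_Mapping.lookup a w)) * word_inv k (letters w))"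

lemma bar_power: "bar (x ^ n) = bar x ^ n"
  by (induction n) (simp_all add: bar_mult)

lemma hecke_param_nonzero [simp]: "hecke_param k i \<noteq> 0"
  by (simp add: hecke_param_def)

lemma bar_hecke_param: "bar (hecke_param k i) = inverse (hecke_param k i)"
  by (simp add: hecke_param_def power_int_def bar_power bar_inverse bar_q power_inverse)

lemma free_bar_add: "free_bar k (a + b) = free_bar k a + free_bar k b"
  unfolding free_bar_def
  by (rule setsum_keys_plus_distrib) (simp_all add: bar_add fconst_add distrib_right)

lemma free_bar_0 [simp]: "free_bar k 0 = 0"
  by (simp add: free_bar_def)

lemma free_bar_single: "free_bar k (Poly_Mapping.single w c) = fconst (bar c) * word_inv k (letters w)"
  by (simp add: free_bar_def)

lemma word_inv_Nil [simp]: "word_inv k [] = 1"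
  by (simp add: word_inv_def)

lemma free_bar_fconst [simp]: "free_bar k (fconst c) = fconst (bar c)"
  by (simp add: free_bar_single)

lemma free_bar_1 [simp]: "free_bar k 1 = 1"
  using free_bar_fconst[of k 1] by simp

lemma free_bar_gen: "free_bar k (fword [i]) = gen_inv k i"
  by (simp add: free_bar_single word_inv_def)

lemma free_bar_uminus: "free_bar k (- a) = - free_bar k a"
  using free_bar_add[of k a "- a"] by (simp add: eq_neg_iff_add_eq_0 add.commute)

lemma free_bar_diff: "free_bar k (a - b) = free_bar k a - free_bar k b"
  using free_bar_add[of k a "- b"] by (simp add: free_bar_uminus)

lemma free_bar_mult: "free_bar k (a * b) = free_bar k a * free_bar k b"
proof -
  have "Poly_Mapping.keys b \<subseteq> UNIV" "Poly_Mapping.keys a \<subseteq> UNIV" by simp_all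
  thus ?thesis
  proof (induction b rule: poly_mapping_induct)
    case (single w c)
    from single(2) show ?case
    proof (induction a rule: poly_mapping_induct)
      case (single v e)
      have "fconst (bar e) * fconst (bar c) * (word_inv k (letters v) * word_inv k (letters w)) =
            fconst (bar e) * (word_inv k (letters v) * fconst (bar c)) * word_inv k (letters w)"
        unfolding fconst_commute[of "bar c" "word_inv k (letters v)", symmetric] by (simp only: mult.assoc)
      thus ?case
        by (simp add: mult_single[of v e w c] free_bar_single bar_mult fconst_mult word_inv_def mult.assoc)
    qed (simp_all add: free_bar_add distrib_right)
  qed (simp_all add: free_bar_add distrib_left)
qed

lemma gen_inv_carrier: "i < d \<Longrightarrow> gen_inv k i \<in> carrier (free_alg d)"
  unfolding gen_inv_def by (intro free_alg_closed) auto

lemma word_inv_carrier: "set ws \<subseteq> {..<d} \<Longrightarrow> word_inv k ws \<in> carrier (free_alg d)"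
  by (induction ws) (auto simp: word_inv_def gen_inv_carrier intro!: free_alg_closed)

lemma free_bar_carrier: "a \<in> carrier (free_alg d) \<Longrightarrow> free_bar k a \<in> carrier (free_alg d)"
  by (induction rule: free_alg_induct)
     (auto simp: free_bar_single free_bar_add word_inv_carrier free_alg_closed)

lemma free_bar_bar: "free_bar k (free_bar k a) = a"
proof -
  have gen: "free_bar k (gen_inv k i) = fword [i]" for i
    by (simp add: gen_inv_def free_bar_diff free_bar_gen bar_diff bar_inverse bar_hecke_param)
       (simp add: gen_inv_def fconst_diff)
  have word: "free_bar k (word_inv k ws) = fword ws" for ws
  proof (induction ws)
    case (Cons i ws)
    thus ?case unfolding fword_Cons[of i ws] by (simp add: word_inv_def free_bar_mult gen)
  qed (simp add: word_inv_def fword_Nil)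
  have "Poly_Mapping.keys a \<subseteq> UNIV" by simp
  thus ?thesis
  proof (induction rule: poly_mapping_induct)
    case (single w c)
    show ?case by (simp add: free_bar_single free_bar_mult word fconst_times_single)
  qed (simp_all add: free_bar_add)
qed

context
  fixes d :: nat and k :: int
begin

private abbreviation "I \<equiv> hecke_ideal d k"

lemma ideal_facts:
  shows "0 \<in> I" and "a \<in> I \<Longrightarrow> b \<in> I \<Longrightarrow> a + b \<in> I"
    and "a \<in> I \<Longrightarrow> b \<in> carrier (free_alg d) \<Longrightarrow> b * a \<in> I"
    and "a \<in> I \<Longrightarrow> b \<in> carrier (free_alg d) \<Longrightarrow> a * b \<in> I"
    and "a \<in> I \<Longrightarrow> a \<in> carrier (free_alg d)"
proof -
  interpret ideal I "free_alg d" by (rule hecke_ideal_ideal)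
  show "0 \<in> I" using additive_subgroup.zero_closed[OF is_additive_subgroup] by simp
  show "a \<in> I \<Longrightarrow> b \<in> I \<Longrightarrow> a + b \<in> I"
    using additive_subgroup.a_closed[OF is_additive_subgroup] by simp
  show "a \<in> I \<Longrightarrow> b \<in> carrier (free_alg d) \<Longrightarrow> b * a \<in> I" using I_l_closed by simp
  show "a \<in> I \<Longrightarrow> b \<in> carrier (free_alg d) \<Longrightarrow> a * b \<in> I" using I_r_closed by simp
  show "a \<in> I \<Longrightarrow> a \<in> carrier (free_alg d)" using a_subset by auto
qed

lemma ideal_uminus: "a \<in> I \<Longrightarrow> - a \<in> I"
  using ideal_facts(3)[of a "- 1"] by (simp add: free_alg_closed)

lemma ideal_diff: "a \<in> I \<Longrightarrow> b \<in> I \<Longrightarrow> a - b \<in> I"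
  using ideal_facts(2)[of a "- b"] by (simp add: ideal_uminus)

lemma gen_inv_cancel:
  assumes "i < d"
  shows "fword [i] * gen_inv k i - 1 \<in> I" "gen_inv k i * fword [i] - 1 \<in> I"
proof -
  define p where "p = hecke_param k i"
  have "p \<noteq> 0" by (simp add: p_def)
  hence pp: "fconst p * fconst (inverse p) = 1" by (simp flip: fconst_mult)
  have "(fword [i] - fconst p) * (fword [i] + fconst (inverse p)) \<in> hecke_rels d k"
    using assms by (auto simp: hecke_rels_def p_def)
  hence rel: "(fword [i] - fconst p) * (fword [i] + fconst (inverse p)) \<in> I"
    using hecke_rels_ideal by blast
  have "fword [i] * gen_inv k i - 1 = (fword [i] - fconst p) * (fword [i] + fconst (inverse p))"
    "gen_inv k i * fword [i] - 1 = (fword [i] - fconst p) * (fword [i] + fconst (inverse p))"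
    using pp fconst_commute[of p "fword [i]"] fconst_commute[of "inverse p" "fword [i]"]
    by (simp_all add: gen_inv_def fconst_diff algebra_simps flip: p_def)
  thus "fword [i] * gen_inv k i - 1 \<in> I" "gen_inv k i * fword [i] - 1 \<in> I" using rel by simp_all
qed

lemma word_inv_cancel:
  assumes "set ws \<subseteq> {..<d}"
  shows "fword ws * word_inv k (rev ws) - 1 \<in> I" "word_inv k (rev ws) * fword ws - 1 \<in> I"
proof -
  have "fword ws * word_inv k (rev ws) - 1 \<in> I \<and> word_inv k (rev ws) * fword ws - 1 \<in> I"
    using assms
  proof (induction ws)
    case Nil
    thus ?case by (simp add: fword_Nil word_inv_def ideal_facts)
  next
    case (Cons i ws)
    define a b u v where "a = fword [i]" "b = gen_inv k i" "u = fword ws" "v = word_inv k (rev ws)"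
    note defs = this
    have i: "i < d" and ws: "set ws \<subseteq> {..<d}" using Cons.prems by auto
    have c: "a \<in> carrier (free_alg d)" "b \<in> carrier (free_alg d)"
      "u \<in> carrier (free_alg d)" "v \<in> carrier (free_alg d)"
      using i ws by (auto simp: defs gen_inv_carrier word_inv_carrier intro!: free_alg_single)
    have "a * (u * v - 1) * b + (a * b - 1) \<in> I" "v * (b * a - 1) * u + (v * u - 1) \<in> I"
      using c Cons.IH[OF ws] gen_inv_cancel[OF i] by (simp_all add: defs ideal_facts)
    moreover have "fword (i # ws) * word_inv k (rev (i # ws)) - 1 = a * (u * v - 1) * b + (a * b - 1)"
      "word_inv k (rev (i # ws)) * fword (i # ws) - 1 = v * (b * a - 1) * u + (v * u - 1)"
      by (simp_all add: defs fword_Cons[of i ws] word_inv_def algebra_simps)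
    ultimately show ?case by (simp only: simp_thms)
  qed
  thus "fword ws * word_inv k (rev ws) - 1 \<in> I" "word_inv k (rev ws) * fword ws - 1 \<in> I" by simp_all
qed

lemma braid_pairs_rev: "(u, v) \<in> braid_pairs d \<Longrightarrow> (rev u, rev v) \<in> braid_pairs d \<or> (rev v, rev u) \<in> braid_pairs d"
  by (auto simp: braid_pairs_def split: if_splits)

lemma braid_pairs_ideal: "(u, v) \<in> braid_pairs d \<Longrightarrow> fword u - fword v \<in> I"
  using hecke_rels_ideal by (force simp: hecke_rels_def)

lemma free_bar_ideal:
  assumes "a \<in> I"
  shows "free_bar k a \<in> I"
proof -
  define J where "J = {a \<in> carrier (free_alg d). free_bar k a \<in> I}"
  have "ideal J (free_alg d)"
    by (rule free_alg_idealI)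
       (auto simp: J_def free_alg_closed free_bar_add free_bar_mult free_bar_carrier ideal_facts)
  moreover have "hecke_rels d k \<subseteq> J"
  proof
    fix a assume a: "a \<in> hecke_rels d k"
    hence "a \<in> carrier (free_alg d)" using hecke_rels_carrier by blast
    moreover have "free_bar k a \<in> I"
    proof -
      from a consider u v where "(u, v) \<in> braid_pairs d" "a = fword u - fword v"
        | i where "i < d" "a = (fword [i] - fconst (hecke_param k i)) * (fword [i] + fconst (inverse (hecke_param k i)))"
        by (auto simp: hecke_rels_def)
      thus ?thesis
      proof cases
        case 1
        define A B X Y where "A = word_inv k u" "B = word_inv k v" "X = fword (rev u)" "Y = fword (rev v)"
        note defs = this
        have w: "set u \<subseteq> {..<d}" "set v \<subseteq> {..<d}" using braid_pairs_letters[OF 1(1)] by auto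
        have c: "A \<in> carrier (free_alg d)" "B \<in> carrier (free_alg d)"
          using w by (auto simp: defs word_inv_carrier)
        have "X - Y \<in> I"
          using braid_pairs_rev[OF 1(1)] braid_pairs_ideal ideal_uminus[of "Y - X"] by (auto simp: defs)
        moreover have "A * X - 1 \<in> I" "Y * B - 1 \<in> I"
          using word_inv_cancel[of "rev u"] word_inv_cancel[of "rev v"] w by (simp_all add: defs)
        ultimately have "A * (Y * B - 1) \<in> I" "A * (X - Y) * B \<in> I" "(A * X - 1) * B \<in> I"
          using c by (simp_all add: ideal_facts)
        hence "(A * X - 1) * B - (A * (Y * B - 1) + A * (X - Y) * B) \<in> I"
          by (intro ideal_diff ideal_facts(2))
        hence "A - B \<in> I" by (simp add: algebra_simps)
        thus ?thesis by (simp add: 1 free_bar_diff free_bar_single defs)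
      next
        case (2 i)
        have "free_bar k a = a"
          by (simp add: 2(2) free_bar_mult free_bar_diff free_bar_add free_bar_gen bar_hecke_param
                bar_inverse gen_inv_def fconst_diff)
        thus ?thesis using a hecke_rels_ideal by auto
      qed
    qed
    ultimately show "a \<in> J" by (simp add: J_def)
  qed
  ultimately have "I \<subseteq> J" by (rule hecke_ideal_minimal)
  thus ?thesis using assms by (auto simp: J_def)
qed

private abbreviation "\<pi> \<equiv> (+>\<^bsub>free_alg d\<^esub>) I"

lemma coset_hom: "ring_hom_ring (free_alg d) (hecke d k) \<pi>"
  unfolding hecke_def by (rule ideal.rcos_ring_hom_ring[OF hecke_ideal_ideal])

lemma coset_eq_iff:
  assumes "a \<in> carrier (free_alg d)" "b \<in> carrier (free_alg d)"
  shows "\<pi> a = \<pi> b \<longleftrightarrow> a - b \<in> I"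
proof
  assume "\<pi> a = \<pi> b"
  moreover have "a \<in> \<pi> a" using hecke_coset_iff[OF assms(1)] ideal_facts(1) by simp
  ultimately show "a - b \<in> I" using hecke_coset_iff[OF assms(2)] by simp
next
  assume *: "a - b \<in> I"
  have "c - a \<in> I \<longleftrightarrow> c - b \<in> I" for c
    using ideal_facts(2)[of "c - a" "a - b"] ideal_diff[of "c - b" "a - b"] * by auto
  thus "\<pi> a = \<pi> b" using hecke_coset_iff assms by blast
qed

lemma hecke_bar_unique_aux:
  assumes \<beta>: "is_hecke_bar d k \<beta>" and a: "a \<in> carrier (free_alg d)"
  shows "\<beta> (\<pi> a) = \<pi> (free_bar k a)"
proof -
  interpret \<pi>: ring_hom_ring "free_alg d" "hecke d k" \<pi> by (rule coset_hom)
  have hom: "\<beta> \<in> ring_hom (hecke d k) (hecke d k)" using \<beta> by (simp add: is_hecke_bar_def ring_iso_def)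
  interpret \<beta>: ring_hom_ring "hecke d k" "hecke d k" \<beta>
    by (rule ring_hom_ringI2[OF hecke_ring hecke_ring hom])
  note [simp] = free_alg_closed free_bar_carrier
  have mult: "\<beta> (\<pi> (a * b)) = \<beta> (\<pi> a) \<otimes>\<^bsub>hecke d k\<^esub> \<beta> (\<pi> b)"
    if "a \<in> carrier (free_alg d)" "b \<in> carrier (free_alg d)" for a b
    using that \<pi>.hom_mult[of a b] by simp
  have badd: "\<beta> (\<pi> (a + b)) = \<beta> (\<pi> a) \<oplus>\<^bsub>hecke d k\<^esub> \<beta> (\<pi> b)"
    if "a \<in> carrier (free_alg d)" "b \<in> carrier (free_alg d)" for a b
    using that \<pi>.hom_add[of a b] by simp
  have pmult: "\<pi> (a * b) = \<pi> a \<otimes>\<^bsub>hecke d k\<^esub> \<pi> b"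
    if "a \<in> carrier (free_alg d)" "b \<in> carrier (free_alg d)" for a b
    using that \<pi>.hom_mult[of a b] by simp
  have padd: "\<pi> (a + b) = \<pi> a \<oplus>\<^bsub>hecke d k\<^esub> \<pi> b"
    if "a \<in> carrier (free_alg d)" "b \<in> carrier (free_alg d)" for a b
    using that \<pi>.hom_add[of a b] by simp
  have one: "\<pi> 1 = \<one>\<^bsub>hecke d k\<^esub>" using \<pi>.hom_one by simp
  have pzero: "\<pi> 0 = \<zero>\<^bsub>hecke d k\<^esub>" using \<pi>.hom_zero by simp
  have rat: "\<beta> (\<pi> (fconst (of_rat c))) = \<pi> (fconst (of_rat c))" for c
  proof -
    have "\<beta> (hecke_const d k (of_rat c) \<otimes>\<^bsub>hecke d k\<^esub> \<one>\<^bsub>hecke d k\<^esub>) =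
        hecke_const d k (of_rat c) \<otimes>\<^bsub>hecke d k\<^esub> \<beta> \<one>\<^bsub>hecke d k\<^esub>"
      using \<beta> \<pi>.S.one_closed unfolding is_hecke_bar_def by blast
    thus ?thesis by (simp add: hecke_const_def)
  qed
  have q: "\<beta> (\<pi> (fconst q)) = \<pi> (fconst (inverse q))"
    using \<beta> by (simp add: is_hecke_bar_def hecke_const_def)
  have poly: "\<beta> (\<pi> (fconst (to_fract p))) = \<pi> (fconst (ev_inv p))" for p
  proof (induction p)
    case 0
    show ?case using rat[of 0] by simp
  next
    case (pCons c p)
    have "to_fract (pCons c p) = of_rat c + q * to_fract p"
      by (simp add: to_fract_eq_poly map_poly_pCons)
    thus ?case
      by (simp add: fconst_add fconst_mult ev_inv_pCons badd mult padd pmult rat q pCons.IH)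
  qed
  have const: "\<beta> (\<pi> (fconst c)) = \<pi> (fconst (bar c))" for c
  proof (cases c)
    case (Fract x y)
    define y' where "y' = ev_inv y"
    have y': "y' \<noteq> 0" using Fract by (simp add: y'_def ev_inv_eq_0_iff)
    have "c * to_fract y = to_fract x" using Fract by (simp add: to_fract_def eq_fract)
    hence "\<beta> (\<pi> (fconst c)) \<otimes>\<^bsub>hecke d k\<^esub> \<pi> (fconst y') = \<pi> (fconst (ev_inv x))"
      by (metis fconst_mult free_alg_fconst mult poly y'_def)
    hence "\<beta> (\<pi> (fconst c)) \<otimes>\<^bsub>hecke d k\<^esub> \<pi> (fconst y') \<otimes>\<^bsub>hecke d k\<^esub> \<pi> (fconst (inverse y')) =
        \<pi> (fconst (ev_inv x * inverse y'))"
      by (simp add: pmult fconst_mult)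
    moreover have "\<pi> (fconst y') \<otimes>\<^bsub>hecke d k\<^esub> \<pi> (fconst (inverse y')) = \<one>\<^bsub>hecke d k\<^esub>"
      using y' by (simp add: one flip: pmult fconst_mult)
    moreover have "bar c = ev_inv x * inverse y'"
      using Fract by (simp add: bar_Fract y'_def divide_inverse)
    ultimately show ?thesis by (simp add: \<pi>.S.m_assoc)
  qed
  have gen: "\<beta> (\<pi> (fword [i])) = \<pi> (gen_inv k i)" if i: "i < d" for i
  proof -
    have c: "fword [i] \<in> carrier (free_alg d)" "gen_inv k i \<in> carrier (free_alg d)"
      using i by (auto simp: gen_inv_carrier)
    have "\<pi> (fword [i]) \<otimes>\<^bsub>hecke d k\<^esub> \<pi> (gen_inv k i) = \<one>\<^bsub>hecke d k\<^esub>"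
      "\<pi> (gen_inv k i) \<otimes>\<^bsub>hecke d k\<^esub> \<pi> (fword [i]) = \<one>\<^bsub>hecke d k\<^esub>"
      using gen_inv_cancel[OF i] c coset_eq_iff by (simp_all flip: pmult one)
    hence "inv\<^bsub>hecke d k\<^esub> \<pi> (fword [i]) = \<pi> (gen_inv k i)"
      using c by (intro \<pi>.S.inv_char) simp_all
    thus ?thesis using \<beta> i by (simp add: is_hecke_bar_def hecke_gen_def)
  qed
  have word: "\<beta> (\<pi> (fword ws)) = \<pi> (word_inv k ws)" if "set ws \<subseteq> {..<d}" for ws
    using that
  proof (induction ws)
    case Nil
    show ?case by (simp add: fword_Nil word_inv_def one)
  next
    case (Cons i ws)
    have "\<beta> (\<pi> (fword (i # ws))) = \<pi> (gen_inv k i) \<otimes>\<^bsub>hecke d k\<^esub> \<pi> (word_inv k ws)"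
      using Cons by (subst fword_Cons) (simp add: mult gen)
    thus ?case
      using Cons.prems by (simp add: word_inv_def pmult gen_inv_carrier word_inv_carrier[unfolded word_inv_def])
  qed
  from a show ?thesis
  proof (induction rule: free_alg_induct)
    case (single ws c)
    have "Poly_Mapping.single (Word ws) c = fconst c * fword ws" by (simp add: mult_single)
    thus ?case
      using single
      by (simp add: mult const word free_bar_mult free_bar_single pmult word_inv_carrier)
  next
    case zero
    show ?case by (simp add: pzero)
  next
    case (add a b)
    thus ?case by (simp add: badd padd free_bar_add)
  qed
qed

lemma hecke_bar_exists:
  obtains \<beta> where "\<beta> \<in> extensional (carrier (hecke d k))" "is_hecke_bar d k \<beta>"
proof -
  interpret \<pi>: ring_hom_ring "free_alg d" "hecke d k" \<pi> by (rule coset_hom)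
  note [simp] = free_alg_closed free_bar_carrier
  define \<beta> where "\<beta> = (\<lambda>h\<in>carrier (hecke d k). \<pi> (free_bar k (SOME a. a \<in> carrier (free_alg d) \<and> \<pi> a = h)))"
  have \<beta>: "\<beta> (\<pi> a) = \<pi> (free_bar k a)" if a: "a \<in> carrier (free_alg d)" for a
  proof -
    define b where "b = (SOME b. b \<in> carrier (free_alg d) \<and> \<pi> b = \<pi> a)"
    have b: "b \<in> carrier (free_alg d)" "\<pi> b = \<pi> a"
      using someI[of "\<lambda>b. b \<in> carrier (free_alg d) \<and> \<pi> b = \<pi> a" a] a by (auto simp: b_def)
    hence "free_bar k b - free_bar k a \<in> I"
      using coset_eq_iff a free_bar_ideal[of "b - a"] by (simp add: free_bar_diff)
    hence "\<pi> (free_bar k b) = \<pi> (free_bar k a)" using coset_eq_iff a b by simp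
    thus ?thesis using a by (simp add: \<beta>_def b_def)
  qed
  have pmult: "\<pi> a \<otimes>\<^bsub>hecke d k\<^esub> \<pi> b = \<pi> (a * b)"
    if "a \<in> carrier (free_alg d)" "b \<in> carrier (free_alg d)" for a b
    using that \<pi>.hom_mult[of a b] by simp
  have padd: "\<pi> a \<oplus>\<^bsub>hecke d k\<^esub> \<pi> b = \<pi> (a + b)"
    if "a \<in> carrier (free_alg d)" "b \<in> carrier (free_alg d)" for a b
    using that \<pi>.hom_add[of a b] by simp
  have one: "\<one>\<^bsub>hecke d k\<^esub> = \<pi> 1" using \<pi>.hom_one by simp
  have mult: "\<beta> (x \<otimes>\<^bsub>hecke d k\<^esub> y) = \<beta> x \<otimes>\<^bsub>hecke d k\<^esub> \<beta> y"
    if "x \<in> carrier (hecke d k)" "y \<in> carrier (hecke d k)" for x y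
    using that by (auto simp: hecke_carrier pmult \<beta> free_bar_mult)
  have mem: "\<beta> x \<in> carrier (hecke d k)" if "x \<in> carrier (hecke d k)" for x
    using that by (auto simp: hecke_carrier \<beta>)
  have hom: "\<beta> \<in> ring_hom (hecke d k) (hecke d k)"
  proof (rule ring_hom_memI)
    show "\<beta> (x \<oplus>\<^bsub>hecke d k\<^esub> y) = \<beta> x \<oplus>\<^bsub>hecke d k\<^esub> \<beta> y"
      if "x \<in> carrier (hecke d k)" "y \<in> carrier (hecke d k)" for x y
      using that by (auto simp: hecke_carrier padd \<beta> free_bar_add)
    show "\<beta> \<one>\<^bsub>hecke d k\<^esub> = \<one>\<^bsub>hecke d k\<^esub>" by (simp add: one \<beta>)
  qed (use mult mem in auto)
  have inv: "\<beta> (\<beta> x) = x" if "x \<in> carrier (hecke d k)" for x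
    using that by (auto simp: hecke_carrier \<beta> free_bar_bar)
  have "bij_betw \<beta> (carrier (hecke d k)) (carrier (hecke d k))"
    by (rule bij_betw_byWitness[where f' = \<beta>]) (use inv mem in auto)
  moreover have const: "\<beta> (hecke_const d k c) = hecke_const d k (bar c)" for c
    by (simp add: hecke_const_def \<beta>)
  moreover have "\<beta> (hecke_const d k (of_rat c) \<otimes>\<^bsub>hecke d k\<^esub> h) =
      hecke_const d k (of_rat c) \<otimes>\<^bsub>hecke d k\<^esub> \<beta> h" if "h \<in> carrier (hecke d k)" for c h
    using that by (subst mult) (auto simp: const, simp add: hecke_const_def)
  moreover have "\<beta> (hecke_gen d k i) = inv\<^bsub>hecke d k\<^esub> hecke_gen d k i" if i: "i < d" for i
  proof -
    have c: "fword [i] \<in> carrier (free_alg d)" "gen_inv k i \<in> carrier (free_alg d)"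
      using i by (auto simp: gen_inv_carrier)
    have "\<pi> (fword [i]) \<otimes>\<^bsub>hecke d k\<^esub> \<pi> (gen_inv k i) = \<one>\<^bsub>hecke d k\<^esub>"
      "\<pi> (gen_inv k i) \<otimes>\<^bsub>hecke d k\<^esub> \<pi> (fword [i]) = \<one>\<^bsub>hecke d k\<^esub>"
      using gen_inv_cancel[OF i] c coset_eq_iff by (simp_all add: pmult one)
    hence "inv\<^bsub>hecke d k\<^esub> \<pi> (fword [i]) = \<pi> (gen_inv k i)"
      using c by (intro \<pi>.S.inv_char) simp_all
    thus ?thesis using c by (simp add: hecke_gen_def \<beta> free_bar_gen)
  qed
  ultimately have "is_hecke_bar d k \<beta>" using hom by (simp add: is_hecke_bar_def ring_iso_def bar_q)
  thus ?thesis using that[of \<beta>] by (simp add: \<beta>_def)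
qed

lemma hecke_bar_ex1: "\<exists>!\<beta>. \<beta> \<in> extensional (carrier (hecke d k)) \<and> is_hecke_bar d k \<beta>"
proof -
  have "\<beta> = \<beta>'" if "\<beta> \<in> extensional (carrier (hecke d k))" "is_hecke_bar d k \<beta>"
    "\<beta>' \<in> extensional (carrier (hecke d k))" "is_hecke_bar d k \<beta>'" for \<beta> \<beta>'
    by (rule extensionalityI[OF that(1,3)])
       (auto simp: hecke_carrier hecke_bar_unique_aux that)
  moreover obtain \<beta> where "\<beta> \<in> extensional (carrier (hecke d k))" "is_hecke_bar d k \<beta>"
    by (rule hecke_bar_exists)
  ultimately show ?thesis by blast
qed

lemma hecke_bar: "is_hecke_bar d k (hecke_bar d k)"
  using theI'[OF hecke_bar_ex1] by (simp add: hecke_bar_def)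

end

end

theory Submission
  imports Defs
begin

text \<open>
  Write \<open>M\<^sub>g\<close> for \<open>std g\<close>, \<open>H\<^sub>i\<close> for the generators of the Hecke algebra and \<open>p\<close>, \<open>q\<close> for their parameters.
  The map \<open>M\<^sub>f h \<mapsto> M\<^sub>f (bar h)\<close> is the only candidate for the bar involution, so the content of the first
  part is that it is well defined. The stabilizer of an antidominant tuple need not be a parabolic
  subgroup: middle weights are fixed by \<open>s\<^sub>0\<close> but can be exchanged with each other. So the module need not be
  induced from a one-dimensional module of a parabolic subalgebra. The involution is therefore
  constructed on the whole tensor space and for all antidominant tuples at once.

  A tuple \<open>g\<close> has a descent at \<open>i\<close> if \<open>M\<^sub>g = M\<^sub>h H\<^sub>i\<close> for the tuple \<open>h = g \<cdot> s\<^sub>i\<close>, which is closer to being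
  antidominant. Compatibility with the bar operator then forces the image of \<open>M\<^sub>g\<close> to be the image of
  \<open>M\<^sub>h\<close> times the inverse of \<open>H\<^sub>i\<close>, and an antidominant tuple has no descents. Descending paths from \<open>g\<close>
  give the same value (\<open>bar_path_unique\<close>), because at two descents \<open>i\<close> and \<open>j\<close> the subgroup generated by
  \<open>s\<^sub>i\<close> and \<open>s\<^sub>j\<close> acts freely on the orbit of \<open>g\<close>, so that the two ways down are the two sides of a braid
  relation. What remains is that \<open>H\<^sub>i\<close> acts on the image of \<open>M\<^sub>g\<close> by its parameter if \<open>g \<cdot> s\<^sub>i = g\<close>
  (\<open>bar_std_fixed\<close>). Going down along a descent \<open>j\<close> and using a braid relation, this follows from the same
  claim for a lower tuple, except if \<open>i = 0\<close> and the only descents exchange two middle weights. In that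
  case the image of \<open>M\<^sub>g\<close> is a combination of tuples whose first entry is a middle weight
  (\<open>bar_std_flat\<close>), and \<open>H\<^sub>0\<close> multiplies all of these by \<open>p\<close>.

  For the canonical basis, extend \<open>f\<close> to negative indices as in the definition of the action. The
  minimal length representatives are exactly the \<open>\<sigma>\<close> that are increasing on the fibres of the extended
  tuple composed with \<open>\<sigma>\<close> (\<open>min_reps_eq\<close>). Hence \<open>\<sigma>\<close> is determined by \<open>f \<cdot> \<sigma>\<close>, and since \<open>f\<close> is antidominant,
  the descents of the tuple \<open>f \<cdot> \<sigma>\<close> are the descents of \<open>\<sigma>\<close> (\<open>fibre_mono_descent_iff\<close>). By induction on the
  length, the bar involution is unitriangular for the Bruhat order (\<open>tensor_bar_triangular\<close>). Its
  coefficients lie in \<open>\<int>[q, q\<^sup>-\<^sup>1]\<close> because \<open>p\<close> is a power of \<open>q\<close>, and the argument of Kazhdan and Lusztig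
  (\<open>bar_correction\<close>) yields the canonical basis.
\<close>

section \<open>Inverse generators on the tensor space\<close>

text \<open>
  The inverse of the \<open>i\<close>-th generator, by the quadratic relation.
\<close>

definition inv_act :: "nat \<Rightarrow> nat \<Rightarrow> int \<Rightarrow> nat \<Rightarrow> tensor \<Rightarrow> tensor" where
  "inv_act r m k i x =
     gen_act r m k i x - smult (hecke_param k i - inverse (hecke_param k i)) x"

lemma free_act_gen_inv: "free_act r m k x (gen_inv k i) = inv_act r m k i x"
  by (simp add: gen_inv_def inv_act_def free_act_diff_right free_act_single)

lemma free_act_word_inv: "free_act r m k x (word_inv k ws) = fold (inv_act r m k) ws x"
  by (induction ws arbitrary: x) (simp_all add: word_inv_def free_act_mult free_act_gen_inv)

lemma inv_act_add: "inv_act r m k i (x + y) = inv_act r m k i x + inv_act r m k i y"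
  and inv_act_smult: "inv_act r m k i (smult c x) = smult c (inv_act r m k i x)"
  and inv_act_0 [simp]: "inv_act r m k i 0 = 0"
  by (simp_all add: inv_act_def gen_act_add gen_act_smult tensor.scale_right_distrib
        tensor.scale_right_diff_distrib tensor.scale_left_commute)

lemma inv_act_tensor_space:
  assumes "x \<in> tensor_space r m d" "i < d"
  shows "inv_act r m k i x \<in> tensor_space r m d"
  using free_act_tensor_space[OF assms(1) gen_inv_carrier[OF assms(2), of k], of k]
  by (simp add: free_act_gen_inv)

lemma gen_act_inv_act:
  assumes "x \<in> tensor_space r m d" "i < d"
  shows "gen_act r m k i (inv_act r m k i x) = x" "inv_act r m k i (gen_act r m k i x) = x"
  using hecke_ideal_act[OF gen_inv_cancel(1)[OF assms(2)] assms(1), of k]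
    hecke_ideal_act[OF gen_inv_cancel(2)[OF assms(2)] assms(1), of k]
  by (simp_all add: free_act_diff_right free_act_mult free_act_gen_inv free_act_single)

text \<open>
  The bar operator maps the defining ideal to itself, so the inverse generators satisfy the braid
  relations as well.
\<close>

lemma inv_act_braid:
  assumes "(u, v) \<in> braid_pairs d" "x \<in> tensor_space r m d"
  shows "fold (inv_act r m k) u x = fold (inv_act r m k) v x"
proof -
  have "free_bar k (fword u - fword v) \<in> hecke_ideal d k"
    by (intro free_bar_ideal braid_pairs_ideal assms(1))
  hence "free_act r m k x (word_inv k u - word_inv k v) = 0"
    using hecke_ideal_act[OF _ assms(2)] by (simp add: free_bar_diff free_bar_single)
  thus ?thesis by (simp add: free_act_diff_right free_act_word_inv)
qed

lemma inv_act_commute: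
  assumes "x \<in> tensor_space r m d" "i < d" "j < d" "i + 1 < j \<or> j + 1 < i"
  shows "inv_act r m k i (inv_act r m k j x) = inv_act r m k j (inv_act r m k i x)"
proof -
  have "([i, j], [j, i]) \<in> braid_pairs d \<or> ([j, i], [i, j]) \<in> braid_pairs d"
    using assms by (auto simp: braid_pairs_def)
  thus ?thesis using inv_act_braid[OF _ assms(1)] by fastforce
qed

lemma inv_act_braid3:
  assumes "x \<in> tensor_space r m d" "1 \<le> i" "Suc i < d"
  shows "inv_act r m k i (inv_act r m k (Suc i) (inv_act r m k i x)) =
         inv_act r m k (Suc i) (inv_act r m k i (inv_act r m k (Suc i) x))"
proof -
  have "([i, Suc i, i], [Suc i, i, Suc i]) \<in> braid_pairs d"
    using assms by (auto simp: braid_pairs_def)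
  thus ?thesis using inv_act_braid[OF _ assms(1)] by fastforce
qed

lemma inv_act_braid4:
  assumes "x \<in> tensor_space r m d" "1 < d"
  shows "inv_act r m k 0 (inv_act r m k 1 (inv_act r m k 0 (inv_act r m k 1 x))) =
         inv_act r m k 1 (inv_act r m k 0 (inv_act r m k 1 (inv_act r m k 0 x)))"
proof -
  have "([0, 1, 0, 1], [1, 0, 1, 0]) \<in> braid_pairs d"
    using assms by (auto simp: braid_pairs_def)
  thus ?thesis using inv_act_braid[OF _ assms(1)] by fastforce
qed

section \<open>Descents of tuples\<close>

text \<open>
  The indices \<open>i\<close> for which the basis vector of \<open>g\<close> is the image of that of \<open>g \<cdot> s\<^sub>i\<close> under the \<open>i\<close>-th
  generator, without a correction term.
\<close>

definition descent :: "nat \<Rightarrow> nat \<Rightarrow> nat \<Rightarrow> (nat \<Rightarrow> real) \<Rightarrow> nat \<Rightarrow> bool" where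
  "descent r m d g i \<longleftrightarrow> i < d \<and> (if i = 0 then g 1 \<in> wt_pos r m else g i < g (Suc i))"

lemma descent_less: "descent r m d g i \<Longrightarrow> i < d"
  by (simp add: descent_def)

lemma wt_pos_gt0: "x \<in> wt_pos r m \<Longrightarrow> 0 < x"
  using wt_pos_bounds[of x r m] by simp

lemma wt_pos_not_neg: "x \<in> wt_pos r m \<Longrightarrow> - x \<notin> wt_pos r m"
  using wt_pos_gt0[of x r m] wt_pos_gt0[of "- x" r m] by auto

lemma wt_pos_mono:
  assumes "a \<in> wt_pos r m" "b \<in> wt r m" "a \<le> b"
  shows "b \<in> wt_pos r m"
  using wt_cases[OF assms(2)] wt_pos_bounds[OF assms(1)] wt_mid_bounds[of b m]
    wt_pos_bounds[of "- b" r m] assms(3) by (auto simp: wt_neg_iff)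

lemma simple_act_pos: "i > 0 \<Longrightarrow> simple_act r m g i = g(i := g (Suc i), Suc i := g i)"
  by (simp add: simple_act_def)

lemma simple_act_0: "g 1 \<in> wt_pos r m \<Longrightarrow> simple_act r m g 0 = g(1 := - g 1)"
  by (rule simple_act_0_pos)

lemma simple_act_simple_act: "simple_act r m (simple_act r m g i) i = g"
  by (auto simp: simple_act_def)

lemma descent_commute:
  assumes "descent r m d g i" "descent r m d g j" "i + 1 < j"
  shows "descent r m d (simple_act r m g i) j" "descent r m d (simple_act r m g j) i"
    "simple_act r m (simple_act r m g i) j = simple_act r m (simple_act r m g j) i"
  using assms by (auto simp: descent_def simple_act_def fun_eq_iff split: if_splits)

text \<open>
  Two adjacent descents mean that the three entries increase strictly, so all six rearrangements are
  different and both ways of sorting them consist of descents.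
\<close>

lemma descent_braid3:
  assumes "descent r m d g i" "descent r m d g (Suc i)" "1 \<le> i"
  defines "s \<equiv> \<lambda>i g. simple_act r m g i"
  shows "descent r m d (s i g) (Suc i)" "descent r m d (s (Suc i) (s i g)) i"
    "descent r m d (s (Suc i) g) i" "descent r m d (s i (s (Suc i) g)) (Suc i)"
    "s i (s (Suc i) (s i g)) = s (Suc i) (s i (s (Suc i) g))"
  using assms by (auto simp: descent_def simple_act_def fun_eq_iff)

text \<open>
  Here both entries are positive weights, because these are closed upwards. All eight signed
  rearrangements are then different.
\<close>

lemma descent_braid4:
  assumes "descent r m d g 0" "descent r m d g 1" "g \<in> tuples r m d"
  defines "s \<equiv> \<lambda>i g. simple_act r m g i"
  shows "descent r m d (s 0 g) 1" "descent r m d (s 1 (s 0 g)) 0" "descent r m d (s 0 (s 1 (s 0 g))) 1"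
    "descent r m d (s 1 g) 0" "descent r m d (s 0 (s 1 g)) 1" "descent r m d (s 1 (s 0 (s 1 g))) 0"
    "s 1 (s 0 (s 1 (s 0 g))) = s 0 (s 1 (s 0 (s 1 g)))"
proof -
  have a: "g 1 \<in> wt_pos r m" "g 1 < g 2" "1 < d"
    using assms by (auto simp: descent_def numeral_2_eq_2)
  hence "g 2 \<in> wt r m" using assms(3) by (auto simp: tuples_def)
  hence b: "g 2 \<in> wt_pos r m" using wt_pos_mono[of "g 1"] a by simp
  have f: "flip r m (g (Suc 0)) = - g (Suc 0)" "flip r m (g (Suc (Suc 0))) = - g (Suc (Suc 0))"
    using a b by (auto simp: flip_def numeral_2_eq_2)
  show "descent r m d (s 0 g) 1" "descent r m d (s 1 (s 0 g)) 0" "descent r m d (s 0 (s 1 (s 0 g))) 1"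
    "descent r m d (s 1 g) 0" "descent r m d (s 0 (s 1 g)) 1" "descent r m d (s 1 (s 0 (s 1 g))) 0"
    "s 1 (s 0 (s 1 (s 0 g))) = s 0 (s 1 (s 0 (s 1 g)))"
    using a b f wt_pos_gt0[OF a(1)] wt_pos_gt0[OF b]
    by (auto simp: s_def descent_def simple_act_def numeral_2_eq_2 fun_eq_iff)
qed

text \<open>
  Exchanging two adjacent values changes the sum weighted by the positions by their difference. This
  makes descents decrease the height of a tuple, and sorting a signed permutation terminate.
\<close>

lemma weighted_sum_swap:
  fixes u :: "nat \<Rightarrow> 'a::comm_ring_1"
  assumes "0 < i" "i < d"
  shows "(\<Sum>j\<in>{1..d}. of_nat j * (u(i := u (Suc i), Suc i := u i)) j) =
         (\<Sum>j\<in>{1..d}. of_nat j * u j) + (u i - u (Suc i))"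
proof -
  have *: "(\<Sum>j\<in>{1..d}. of_nat j * v j) =
      of_nat i * v i + (of_nat (Suc i) * v (Suc i) + (\<Sum>j\<in>{1..d} - {i} - {Suc i}. of_nat j * v j))"
    for v :: "nat \<Rightarrow> 'a"
    using assms by (subst sum.remove[of _ i], simp, simp, subst sum.remove[of _ "Suc i"]) auto
  have "(\<Sum>j\<in>{1..d} - {i} - {Suc i}. of_nat j * (u(i := u (Suc i), Suc i := u i)) j) =
        (\<Sum>j\<in>{1..d} - {i} - {Suc i}. of_nat j * u j)"
    by (intro sum.cong) auto
  thus ?thesis unfolding * by (simp add: algebra_simps)
qed

text \<open>
  A natural number to induct on: the weighted sum decreases along descents, but is real-valued.
\<close>

definition height :: "nat \<Rightarrow> nat \<Rightarrow> nat \<Rightarrow> (nat \<Rightarrow> real) \<Rightarrow> nat" where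
  "height r m d g = card {h \<in> tuples r m d.
     (\<Sum>j\<in>{1..d}. real j * h j) < (\<Sum>j\<in>{1..d}. real j * g j)}"

lemma finite_tuples: "finite (tuples r m d)"
proof -
  have "finite (seg a b)" for a b
  proof (rule finite_subset)
    show "seg a b \<subseteq> (\<lambda>j. a + real j) ` {..nat \<lceil>b - a\<rceil>}"
    proof
      fix x assume "x \<in> seg a b"
      then obtain j where j: "x = a + real j" "a + real j \<le> b" by (auto simp: seg_def)
      hence "real j \<le> b - a" by simp
      hence "int j \<le> \<lceil>b - a\<rceil>" by linarith
      hence "j \<le> nat \<lceil>b - a\<rceil>" by linarith
      thus "x \<in> (\<lambda>j. a + real j) ` {..nat \<lceil>b - a\<rceil>}" using j by auto
    qed
  qed simp
  thus ?thesis unfolding tuples_def wt_def by (intro finite_PiE) auto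
qed

lemma descent_height:
  assumes "descent r m d g i" "g \<in> tuples r m d"
  shows "height r m d (simple_act r m g i) < height r m d g"
proof -
  let ?\<Phi> = "\<lambda>h::nat\<Rightarrow>real. \<Sum>j\<in>{1..d}. real j * h j"
  have "?\<Phi> (simple_act r m g i) < ?\<Phi> g"
  proof (cases "i = 0")
    case True
    have a: "g 1 \<in> wt_pos r m" "1 \<le> d" using assms True by (auto simp: descent_def)
    have "?\<Phi> h = h 1 + (\<Sum>j\<in>{1..d} - {1}. real j * h j)" for h
      using a by (subst sum.remove[of _ 1]) auto
    moreover have "(\<Sum>j\<in>{1..d} - {1}. real j * (g(1 := - g 1)) j) = (\<Sum>j\<in>{1..d} - {1}. real j * g j)"
      by (intro sum.cong) auto
    ultimately have "?\<Phi> (simple_act r m g 0) = ?\<Phi> g - 2 * g 1"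
      using simple_act_0[of g, OF a(1)] by simp
    thus ?thesis using wt_pos_gt0[OF a(1)] True by simp
  next
    case False
    thus ?thesis using assms weighted_sum_swap[of i d g] by (simp add: descent_def simple_act_pos)
  qed
  hence "{h \<in> tuples r m d. ?\<Phi> h < ?\<Phi> (simple_act r m g i)} \<subset> {h \<in> tuples r m d. ?\<Phi> h < ?\<Phi> g}"
    using simple_act_tuples[OF assms(2) descent_less[OF assms(1)]] by fastforce
  thus ?thesis unfolding height_def using finite_tuples by (intro psubset_card_mono) auto
qed

section \<open>The bar involution on the tensor space\<close>

text \<open>
  The values of the bar involution along a descending path from a tuple. That the value depends only
  on the tuple is \<open>bar_path_unique\<close>.
\<close>

inductive bar_path :: "nat \<Rightarrow> nat \<Rightarrow> nat \<Rightarrow> int \<Rightarrow> (nat \<Rightarrow> real) \<Rightarrow> tensor \<Rightarrow> bool" for r m d k where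
  bottom: "(\<And>i. \<not> descent r m d g i) \<Longrightarrow> bar_path r m d k g (std g)"
| step: "descent r m d g i \<Longrightarrow> bar_path r m d k (simple_act r m g i) x \<Longrightarrow>
         bar_path r m d k g (inv_act r m k i x)"

definition bar_std :: "nat \<Rightarrow> nat \<Rightarrow> nat \<Rightarrow> int \<Rightarrow> (nat \<Rightarrow> real) \<Rightarrow> tensor" where
  "bar_std r m d k g = (THE x. bar_path r m d k g x)"

lemma std_tensor_space: "g \<in> tuples r m d \<Longrightarrow> std g \<in> tensor_space r m d"
  by (simp add: tensor_space_def)

context
  fixes r m d :: nat and k :: int
begin

private abbreviation "T \<equiv> tensor_space r m d"
private abbreviation "s \<equiv> \<lambda>i g. simple_act r m g i"
private abbreviation "desc \<equiv> descent r m d"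
private abbreviation "path \<equiv> bar_path r m d k"
private abbreviation "B \<equiv> inv_act r m k"
private abbreviation "N \<equiv> bar_std r m d k"

text \<open>
  By induction on the height. Two paths that begin with different descents can be continued to the
  bottom of the rank two orbit, where they agree by induction, and the two ways to get there differ
  by a braid relation of the inverse generators.
\<close>

lemma bar_path_unique:
  assumes "g \<in> tuples r m d"
  shows "N g \<in> T \<and> (\<forall>x. path g x \<longleftrightarrow> x = N g)"
  using assms
proof (induction "height r m d g" arbitrary: g rule: less_induct)
  case less
  define Lo where "Lo = {h \<in> tuples r m d. height r m d h < height r m d g}"
  have low: "s i h \<in> tuples r m d \<and> height r m d (s i h) < height r m d h"
    if "desc h i" "h \<in> tuples r m d" for h i
    using that simple_act_tuples descent_height descent_less by blast
  have IH: "N h \<in> T" "path h x \<longleftrightarrow> x = N h" if "h \<in> Lo" for h x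
    using less.hyps[of h] that unfolding Lo_def by blast+
  have g_Lo: "s i g \<in> Lo" if "desc g i" for i
    using low[OF that less.prems] by (simp add: Lo_def)
  have Lo: "s i h \<in> Lo" if "desc h i" "h \<in> Lo" for h i
    using low[OF that(1)] that(2) by (auto simp: Lo_def)
  have Nlow: "N h = B i (N (s i h))" if "desc h i" "h \<in> Lo" for h i
  proof -
    have "path (s i h) (N (s i h))" using IH(2)[OF Lo[OF that]] by simp
    from step[OF that(1) this, unfolded IH(2)[OF that(2)]] show ?thesis by (rule sym)
  qed
  have confl: "B i (N (s i g)) = B j (N (s j g))" if ij: "desc g i" "desc g j" "i < j" for i j
  proof -
    have d: "i < d" "j < d" using ij descent_less by auto
    note Li = g_Lo[OF ij(1)] and Lj = g_Lo[OF ij(2)]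
    consider "i + 1 < j" | "j = Suc i" "1 \<le> i" | "i = 0" "j = 1" using ij(3) by linarith
    thus ?thesis
    proof cases
      case 1
      note D = descent_commute[OF ij(1,2) 1]
      have "N (s i g) = B j (N (s j (s i g)))" by (rule Nlow[OF D(1) Li])
      moreover have "N (s j g) = B i (N (s j (s i g)))" using Nlow[OF D(2) Lj] by (simp only: D(3))
      moreover have "N (s j (s i g)) \<in> T" by (rule IH(1)[OF Lo[OF D(1) Li]])
      ultimately show ?thesis using 1 d by (simp add: inv_act_commute)
    next
      case 2
      note D = descent_braid3[OF ij(1) ij(2)[unfolded 2] 2(2)]
      note L2 = Lo[OF D(1) Li] and M2 = Lo[OF D(3) Lj[unfolded 2]]
      define h where "h = s i (s (Suc i) (s i g))"
      have "N (s i g) = B (Suc i) (B i (N h))"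
        by (simp only: Nlow[OF D(1) Li] Nlow[OF D(2) L2] h_def)
      moreover have "N (s (Suc i) g) = B i (B (Suc i) (N h))"
        by (simp only: Nlow[OF D(3) Lj[unfolded 2]] Nlow[OF D(4) M2] h_def D(5))
      moreover have "N h \<in> T" unfolding h_def by (rule IH(1)[OF Lo[OF D(2) L2]])
      ultimately show ?thesis using 2 d inv_act_braid3[of "N h" r m d i k] by simp
    next
      case 3
      note D = descent_braid4[OF ij(1)[unfolded 3] ij(2)[unfolded 3] less.prems]
      note L1 = Li[unfolded 3] and M1 = Lj[unfolded 3]
      note L2 = Lo[OF D(1) L1] and M2 = Lo[OF D(4) M1]
      note L3 = Lo[OF D(2) L2] and M3 = Lo[OF D(5) M2]
      define h where "h = s 1 (s 0 (s 1 (s 0 g)))"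
      have "N (s 0 g) = B 1 (B 0 (B 1 (N h)))"
        by (simp only: Nlow[OF D(1) L1] Nlow[OF D(2) L2] Nlow[OF D(3) L3] h_def)
      moreover have "N (s 1 g) = B 0 (B 1 (B 0 (N h)))"
        by (simp only: Nlow[OF D(4) M1] Nlow[OF D(5) M2] Nlow[OF D(6) M3] h_def D(7))
      moreover have "N h \<in> T" unfolding h_def by (rule IH(1)[OF Lo[OF D(3) L3]])
      ultimately show ?thesis using 3 d inv_act_braid4[of "N h" r m d k] by simp
    qed
  qed
  have confl': "B i (N (s i g)) = B j (N (s j g))" if "desc g i" "desc g j" for i j
  proof (cases i j rule: linorder_cases)
    case less
    show ?thesis by (rule confl[OF that less])
  next
    case greater
    show ?thesis by (rule confl[OF that(2,1) greater, symmetric])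
  qed simp
  have ex: "\<exists>y\<in>T. \<forall>x. path g x \<longleftrightarrow> x = y"
  proof (cases "\<exists>i. desc g i")
    case False
    hence "path g x \<longleftrightarrow> x = std g" for x by (subst bar_path.simps) auto
    thus ?thesis using std_tensor_space[OF less.prems] by blast
  next
    case True
    then obtain i where i: "desc g i" by blast
    have p: "path (s j g) x \<longleftrightarrow> x = N (s j g)" if "desc g j" for j x
      by (rule IH(2)[OF g_Lo[OF that]])
    have "path g x \<longleftrightarrow> x = B i (N (s i g))" for x
    proof
      assume "path g x"
      thus "x = B i (N (s i g))"
      proof cases
        case (step j y)
        thus ?thesis using p[of j y] confl'[of j i] i by simp
      qed (use i in blast)
    next
      assume "x = B i (N (s i g))"
      thus "path g x" using step[OF i] p[OF i] by blast
    qed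
    moreover have "B i (N (s i g)) \<in> T"
      by (rule inv_act_tensor_space[OF IH(1)[OF g_Lo[OF i]] descent_less[OF i]])
    ultimately show ?thesis by blast
  qed
  then obtain y where y: "y \<in> T" "\<And>x. path g x \<longleftrightarrow> x = y" by blast
  have "N g = y" unfolding bar_std_def y(2) by simp
  with y show ?case by simp
qed

lemma bar_std_tensor_space: "g \<in> tuples r m d \<Longrightarrow> N g \<in> T"
  using bar_path_unique by blast

lemma bar_std_bottom: "g \<in> tuples r m d \<Longrightarrow> (\<And>i. \<not> desc g i) \<Longrightarrow> N g = std g"
  using bar_path_unique[of g] bottom[of r m d g k] by metis

lemma bar_std_descent:
  assumes "g \<in> tuples r m d" "desc g i"
  shows "N g = B i (N (s i g))"
proof -
  have "path (s i g) (N (s i g))"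
    using bar_path_unique[of "s i g"] simple_act_tuples[OF assms(1) descent_less[OF assms(2)]] by blast
  thus ?thesis using step[OF assms(2)] bar_path_unique[OF assms(1)] by metis
qed

definition fixed :: "(nat \<Rightarrow> real) \<Rightarrow> nat \<Rightarrow> bool" where
  "fixed g i \<longleftrightarrow> i < d \<and> (if i = 0 then g 1 \<notin> wt_pos r m \<and> - g 1 \<notin> wt_pos r m else g i = g (Suc i))"

lemma inv_act_fixed_std:
  assumes "fixed g i"
  shows "B i (std g) = smult (inverse (hecke_param k i)) (std g)"
proof -
  have "gen_act r m k i (std g) = smult (hecke_param k i) (std g)"
    using assms by (cases "i = 0") (auto simp: fixed_def gen_act_zero gen_act_pos hecke_param_def)
  thus ?thesis by (simp add: inv_act_def flip: tensor.scale_left_diff_distrib)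
qed

text \<open>
  Combinations of tuples with middle weights at the positions in \<open>S\<close>. If \<open>1 \<in> S\<close>, the generator with
  index 0 acts on them by a scalar.
\<close>

private definition span_mid :: "nat set \<Rightarrow> tensor set" where
  "span_mid S = {x. \<forall>h\<in>Poly_Mapping.keys x. \<forall>i\<in>S. h i \<in> wt_mid m}"

lemma mid_not_pos: "x \<in> wt_mid m \<Longrightarrow> x \<notin> wt_pos r m \<and> - x \<notin> wt_pos r m"
  using wt_mid_bounds[of x m] wt_pos_bounds[of x r m] wt_pos_bounds[of "- x" r m] by force

lemma span_mid_add: "x \<in> span_mid S \<Longrightarrow> y \<in> span_mid S \<Longrightarrow> x + y \<in> span_mid S"
  unfolding span_mid_def using Poly_Mapping.keys_add[of x y] by blast

lemma span_mid_smult: "x \<in> span_mid S \<Longrightarrow> smult c x \<in> span_mid S"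
  by (auto simp: span_mid_def in_keys_iff)

lemma inv_act_span_mid:
  assumes "x \<in> span_mid S" "i \<noteq> 0" "i \<in> S" "Suc i \<in> S"
  shows "B i x \<in> span_mid S"
proof -
  have "Poly_Mapping.keys x \<subseteq> {h. \<forall>i\<in>S. h i \<in> wt_mid m}" using assms by (auto simp: span_mid_def)
  thus ?thesis
  proof (induction rule: poly_mapping_induct)
    case (single h c)
    hence std: "std h \<in> span_mid S" "std (h(i := h (Suc i), Suc i := h i)) \<in> span_mid S"
      using assms by (auto simp: span_mid_def)
    have "gen_act r m k i (std h) \<in> span_mid S"
      using assms(2) std by (auto simp: gen_act_pos intro!: span_mid_add span_mid_smult)
    moreover have "Poly_Mapping.single h c = smult c (std h)" by (simp add: smult_single)
    moreover have "B i (std h) = gen_act r m k i (std h) +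
       smult (- (hecke_param k i - inverse (hecke_param k i))) (std h)"
      by (simp only: inv_act_def tensor.scale_minus_left) simp
    ultimately show ?case
      using std by (simp only: inv_act_smult) (intro span_mid_add span_mid_smult; simp)
  qed (auto simp: inv_act_add span_mid_add, simp add: span_mid_def)
qed

lemma inv_act_0_span_mid:
  assumes "x \<in> span_mid S" "1 \<in> S" "0 < d"
  shows "B 0 x = smult (inverse (hecke_param k 0)) x"
proof -
  have "Poly_Mapping.keys x \<subseteq> {h. h 1 \<in> wt_mid m}" using assms by (auto simp: span_mid_def)
  thus ?thesis
  proof (induction rule: poly_mapping_induct)
    case (single h c)
    hence "fixed h 0" using mid_not_pos assms(3) by (auto simp: fixed_def)
    moreover have "Poly_Mapping.single h c = smult c (std h)" by (simp add: smult_single)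
    ultimately show ?case by (simp only: inv_act_smult inv_act_fixed_std tensor.scale_left_commute)
  qed (simp_all add: inv_act_add tensor.scale_right_distrib)
qed

text \<open>
  The tuples whose descents all exchange two middle weights.
\<close>

private definition flat :: "(nat \<Rightarrow> real) \<Rightarrow> bool" where
  "flat g \<longleftrightarrow> (\<forall>i\<in>{1..d}. g i \<notin> wt_pos r m) \<and> (\<forall>i\<in>{1..<d}. - g i \<in> wt_pos r m \<longrightarrow> g (Suc i) \<le> g i)"

text \<open>
  Descending from such a tuple stays among tuples of this kind, with middle weights at the same
  positions, and the inverse generators used on the way only mix these positions.
\<close>

lemma bar_std_flat:
  assumes "g \<in> tuples r m d" "flat g"
  shows "N g \<in> span_mid {i\<in>{1..d}. g i \<in> wt_mid m}"
  using assms
proof (induction "height r m d g" arbitrary: g rule: less_induct)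
  case less
  show ?case
  proof (cases "\<exists>j. desc g j")
    case False
    hence "N g = std g" using bar_std_bottom less.prems by blast
    thus ?thesis by (simp add: span_mid_def)
  next
    case True
    then obtain j where j: "desc g j" by blast
    have "j \<noteq> 0" using j less.prems(2) by (auto simp: descent_def flat_def intro: ccontr)
    have wt: "g i \<in> wt r m" if "1 \<le> i" "i \<le> d" for i using that less.prems(1) by (auto simp: tuples_def)
    have jd: "j < d" "g j < g (Suc j)" using j \<open>j \<noteq> 0\<close> by (auto simp: descent_def)
    have np: "g i \<notin> wt_pos r m" if "1 \<le> i" "i \<le> d" for i using less.prems that by (auto simp: flat_def)
    have nn: "- g j \<notin> wt_pos r m" using less.prems(2) jd \<open>j \<noteq> 0\<close> by (fastforce simp: flat_def)
    have mj: "g j \<in> wt_mid m" using wt_cases[OF wt[of j]] np[of j] nn jd \<open>j \<noteq> 0\<close> by (auto simp: wt_neg_iff)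
    have "- g (Suc j) \<notin> wt_pos r m"
      using wt_pos_bounds[of "- g (Suc j)" r m] wt_mid_bounds[OF mj] jd by auto
    hence mj': "g (Suc j) \<in> wt_mid m" using wt_cases[OF wt[of "Suc j"]] np[of "Suc j"] jd by (auto simp: wt_neg_iff)
    have nprev: "- g i \<notin> wt_pos r m" if "1 \<le> i" "Suc i = j" for i
    proof
      assume a: "- g i \<in> wt_pos r m"
      hence "g j \<le> g i" using less.prems(2) that jd by (auto simp: flat_def)
      thus False using wt_pos_bounds[OF a] wt_mid_bounds[OF mj] by auto
    qed
    have sj: "s j g = g(j := g (Suc j), Suc j := g j)" using \<open>j \<noteq> 0\<close> by (simp add: simple_act_pos)
    have "flat (s j g)"
      using less.prems(2) nprev mid_not_pos[OF mj] mid_not_pos[OF mj'] unfolding sj flat_def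
      by (auto simp: fun_upd_def)
    moreover have "{i\<in>{1..d}. s j g i \<in> wt_mid m} = {i\<in>{1..d}. g i \<in> wt_mid m}"
      using mj mj' by (auto simp: sj)
    ultimately have "N (s j g) \<in> span_mid {i\<in>{1..d}. g i \<in> wt_mid m}"
      using less.hyps[of "s j g"] descent_height[OF j less.prems(1)]
        simple_act_tuples[OF less.prems(1) jd(1)] by simp
    thus ?thesis using bar_std_descent[OF less.prems(1) j] inv_act_span_mid \<open>j \<noteq> 0\<close> mj mj' jd by simp
  qed
qed

text \<open>
  By induction on the height. For a descent \<open>j\<close> that does not commute with \<open>i\<close>, the entries involved
  are \<open>(a, a, b)\<close>, \<open>(b, a, a)\<close>, \<open>(a, a)\<close> with \<open>a\<close> positive, or \<open>(a, b)\<close> with \<open>a\<close> a middle weight. In the first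
  three cases, and in the last if \<open>b\<close> is positive, going down to the bottom of the rank two orbit leads
  to a tuple fixed by one of the two generators, and the braid relation turns that generator into the
  \<open>i\<close>-th one. If \<open>b\<close> is a middle weight, either there is a descent further to the right, or the tuple is
  flat.
\<close>

lemma bar_std_fixed:
  assumes "g \<in> tuples r m d" "fixed g i"
  shows "B i (N g) = smult (inverse (hecke_param k i)) (N g)"
  using assms
proof (induction "height r m d g" arbitrary: g i rule: less_induct)
  case less
  note g = less.prems(1)
  have id: "i < d" using less.prems(2) by (simp add: fixed_def)
  have low: "s j h \<in> tuples r m d \<and> height r m d (s j h) < height r m d h \<and> N (s j h) \<in> T \<and> N h = B j (N (s j h))"
    if "desc h j" "h \<in> tuples r m d" for h j
    using that simple_act_tuples descent_height descent_less bar_std_tensor_space bar_std_descent by blast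
  have comm: ?case if j: "desc g j" "i + 1 < j \<or> j + 1 < i" for j
  proof -
    have "fixed (s j g) i" using less.prems(2) j by (auto simp: fixed_def simple_act_def)
    hence "B i (N (s j g)) = smult (inverse (hecke_param k i)) (N (s j g))"
      using less.hyps low[OF j(1) g] by blast
    moreover have "N g = B j (N (s j g))" "N (s j g) \<in> T" using low[OF j(1) g] by auto
    ultimately show ?thesis using inv_act_commute[OF _ id descent_less[OF j(1)] j(2)] by (simp add: inv_act_smult)
  qed
  show ?case
  proof (cases "i = 0")
    case True
    have d: "0 < d" using id True by simp
    have g1: "g 1 \<notin> wt_pos r m" "- g 1 \<notin> wt_pos r m" using less.prems(2) True by (auto simp: fixed_def)
    consider (far) j where "j \<ge> 2" "desc g j" | (adj) "\<And>j. j \<ge> 2 \<Longrightarrow> \<not> desc g j" "1 < d" "g 2 \<in> wt_pos r m"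
      | (flat) "\<And>j. j \<ge> 2 \<Longrightarrow> \<not> desc g j" "1 < d \<Longrightarrow> g 2 \<notin> wt_pos r m" by blast
    thus ?thesis
    proof cases
      case far
      thus ?thesis using comm[of j] True by simp
    next
      case adj
      \<comment> \<open>The entries are \<open>(a, b)\<close> with \<open>\<bar>a\<bar> < b\<close>, and the descent to \<open>(a, - b)\<close> moves \<open>b\<close> to the front and back.\<close>
      have w: "g 1 \<in> wt r m" using g d by (auto simp: tuples_def)
      have "\<not> g 2 \<le> g 1" "\<not> g 2 \<le> - g 1"
        using g1 wt_pos_mono[OF adj(3) w] wt_pos_mono[OF adj(3) wt_uminus[OF w]] by fast+
      hence "- g 2 < g 1" "g 1 < g 2" by linarith+
      hence D: "desc g 1" "desc (s 1 g) 0" "desc (s 0 (s 1 g)) 1" "fixed (s 1 (s 0 (s 1 g))) 0"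
        using adj g1 simple_act_0[of "s 1 g" r m] by (auto simp: descent_def fixed_def simple_act_pos numeral_2_eq_2)
      define h where "h = s 1 (s 0 (s 1 g))"
      note l1 = low[OF D(1) g] and l2 = low[OF D(2)] and l3 = low[OF D(3)]
      have N: "N g = B 1 (B 0 (B 1 (N h)))" and hT: "N h \<in> T" and
        "height r m d h < height r m d g" "h \<in> tuples r m d"
        using l1 l2 l3 unfolding h_def by auto
      hence "B 0 (N h) = smult (inverse (hecke_param k 0)) (N h)" using less.hyps D(4) h_def by blast
      thus ?thesis using inv_act_braid4[OF hT adj(2), of k] unfolding True N by (simp add: inv_act_smult)
    next
      case flat
      \<comment> \<open>Without descents beyond the first position, no entry after the second exceeds it.\<close>
      have le: "g j \<le> g 2" if "2 \<le> j" "j \<le> d" for j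
        using that
      proof (induction j rule: dec_induct)
        case (step n)
        hence "g (Suc n) \<le> g n" using flat(1)[of n] by (auto simp: descent_def)
        thus ?case using step by simp
      qed simp
      have wt: "g i \<in> wt r m" if "1 \<le> i" "i \<le> d" for i using that g by (auto simp: tuples_def)
      have "g j \<notin> wt_pos r m" if j: "j \<in> {1..d}" for j
      proof (cases "j = 1")
        case False
        thus ?thesis using j le[of j] wt_pos_mono[of "g j" r m "g 2"] wt[of 2] flat(2) by auto
      qed (use g1 in simp)
      moreover have "g (Suc j) \<le> g j" if "j \<in> {1..<d}" "- g j \<in> wt_pos r m" for j
      proof (cases "j = 1")
        case False
        thus ?thesis using that flat(1)[of j] by (auto simp: descent_def)
      qed (use g1 that in simp)
      ultimately have "flat g" by (auto simp: flat_def)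
      moreover have "g 1 \<in> wt_mid m" using wt_cases[OF wt[of 1]] g1 d by (auto simp: wt_neg_iff)
      ultimately show ?thesis
        using inv_act_0_span_mid[OF bar_std_flat[OF g]] d True by simp
    qed
  next
    case False
    have gi: "g i = g (Suc i)" using less.prems(2) False by (simp add: fixed_def)
    show ?thesis
    proof (cases "\<exists>j. desc g j")
      case none: False
      hence "N g = std g" using bar_std_bottom g by blast
      thus ?thesis using inv_act_fixed_std less.prems(2) by simp
    next
      case True
      then obtain j where j: "desc g j" by blast
      have "j \<noteq> i" using j gi False by (auto simp: descent_def)
      then consider "i + 1 < j \<or> j + 1 < i" | "j = Suc i" | "i = Suc j" "j \<noteq> 0" | "j = 0" "i = 1"
        using False by linarith
      thus ?thesis
      proof cases
        case 1
        thus ?thesis using comm j by blast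
      next
        case 2
        have D: "desc (s j g) i" "fixed (s i (s j g)) j"
          using j gi False unfolding 2 by (auto simp: descent_def fixed_def simple_act_pos)
        define h where "h = s i (s j g)"
        have N: "N g = B j (B i (N h))" and hT: "N h \<in> T" and
          "height r m d h < height r m d g" "h \<in> tuples r m d"
          using low[OF j g] low[OF D(1)] unfolding h_def by auto
        hence "B j (N h) = smult (inverse (hecke_param k j)) (N h)" using less.hyps D(2) h_def by blast
        thus ?thesis
          using inv_act_braid3[OF hT, of i k] descent_less[OF j] False unfolding N 2
          by (simp add: inv_act_smult hecke_param_def)
      next
        case 3
        have D: "desc (s j g) i" "fixed (s i (s j g)) j"
          using j gi id \<open>j \<noteq> 0\<close> unfolding 3 by (auto simp: descent_def fixed_def simple_act_pos)
        define h where "h = s i (s j g)"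
        have N: "N g = B j (B i (N h))" and hT: "N h \<in> T" and
          "height r m d h < height r m d g" "h \<in> tuples r m d"
          using low[OF j g] low[OF D(1)] unfolding h_def by auto
        hence "B j (N h) = smult (inverse (hecke_param k j)) (N h)" using less.hyps D(2) h_def by blast
        thus ?thesis
          using inv_act_braid3[OF hT, of j k] id 3(2) unfolding N 3(1)
          by (simp add: inv_act_smult hecke_param_def)
      next
        case 4
        have a: "g 1 \<in> wt_pos r m" using j 4 by (simp add: descent_def)
        have s0: "s 0 g = g(1 := - g 1)" by (rule simple_act_0[of g, OF a])
        have D: "desc (s 0 g) 1" "desc (s 1 (s 0 g)) 0" "fixed (s 0 (s 1 (s 0 g))) 1"
          using a gi id 4 wt_pos_gt0[OF a] simple_act_0[of "s 1 (s 0 g)" r m]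
          by (auto simp: descent_def fixed_def simple_act_pos s0)
        define h where "h = s 0 (s 1 (s 0 g))"
        have N: "N g = B 0 (B 1 (B 0 (N h)))" and hT: "N h \<in> T" and
          "height r m d h < height r m d g" "h \<in> tuples r m d"
          using low[OF j g] low[OF D(1)] low[OF D(2)] unfolding h_def 4 by auto
        hence "B 1 (N h) = smult (inverse (hecke_param k 1)) (N h)" using less.hyps D(3) h_def by blast
        moreover have "1 < d" using id 4 by simp
        ultimately show ?thesis using inv_act_braid4[OF hT, of k] unfolding 4(2) N by (simp add: inv_act_smult)
      qed
    qed
  qed
qed

end

definition tensor_bar :: "nat \<Rightarrow> nat \<Rightarrow> nat \<Rightarrow> int \<Rightarrow> tensor \<Rightarrow> tensor" where
  "tensor_bar r m d k x =
     (\<Sum>g\<in>Poly_Mapping.keys x. smult (bar (Poly_Mapping.lookup x g)) (bar_std r m d k g))"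

lemma tensor_bar_add: "tensor_bar r m d k (x + y) = tensor_bar r m d k x + tensor_bar r m d k y"
  unfolding tensor_bar_def
  by (rule setsum_keys_plus_distrib) (simp_all add: bar_add tensor.scale_left_distrib)

lemma tensor_bar_single:
  "tensor_bar r m d k (Poly_Mapping.single g c) = smult (bar c) (bar_std r m d k g)"
  by (simp add: tensor_bar_def)

lemma tensor_bar_0 [simp]: "tensor_bar r m d k 0 = 0"
  by (simp add: tensor_bar_def)

lemma tensor_bar_smult: "tensor_bar r m d k (smult c x) = smult (bar c) (tensor_bar r m d k x)"
proof -
  have "Poly_Mapping.keys x \<subseteq> UNIV" by simp
  thus ?thesis
    by (induction rule: poly_mapping_induct)
       (simp_all add: smult_single tensor_bar_single tensor_bar_add bar_mult tensor.scale_right_distrib)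
qed

lemma tensor_bar_diff: "tensor_bar r m d k (x - y) = tensor_bar r m d k x - tensor_bar r m d k y"
  using tensor_bar_add[of r m d k "x - y" y] by simp

lemma tensor_bar_tensor_space:
  assumes "x \<in> tensor_space r m d"
  shows "tensor_bar r m d k x \<in> tensor_space r m d"
proof -
  have "Poly_Mapping.keys x \<subseteq> tuples r m d" using assms by (simp add: tensor_space_def)
  thus ?thesis
    by (induction rule: poly_mapping_induct)
       (simp_all add: tensor_bar_single tensor_bar_add tensor_space_add tensor_space_smult
          bar_std_tensor_space)
qed

text \<open>
  The three cases of the action in terms of descents: \<open>g\<close> is the upper end, the lower end, or fixed.
\<close>

lemma gen_act_std_cases:
  assumes i: "i < d"
  obtains (desc) "descent r m d g i" "gen_act r m k i (std g) =
      std (simple_act r m g i) + smult (hecke_param k i - inverse (hecke_param k i)) (std g)"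
    | (asc) "descent r m d (simple_act r m g i) i" "gen_act r m k i (std g) = std (simple_act r m g i)"
    | (const) "fixed r m d g i" "gen_act r m k i (std g) = smult (hecke_param k i) (std g)"
proof (cases "i = 0")
  case True
  have "simple_act r m g 0 = g(1 := - g 1)" if "g 1 \<in> wt_pos r m \<or> - g 1 \<in> wt_pos r m"
    using that simple_act_0_pos[of g] simple_act_0_neg[of g] by (auto simp: wt_neg_iff)
  moreover have "g 1 \<notin> wt_pos r m" if "- g 1 \<in> wt_pos r m"
    using wt_pos_not_neg[OF that] by simp
  ultimately show ?thesis using that i True
    by (cases "g 1 \<in> wt_pos r m"; cases "- g 1 \<in> wt_pos r m")
       (simp_all add: gen_act_zero descent_def fixed_def hecke_param_def)
next
  case False
  thus ?thesis using that i
    by (cases "g i" "g (Suc i)" rule: linorder_cases)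
       (simp_all add: gen_act_pos descent_def simple_act_pos fixed_def hecke_param_def)
qed

text \<open>
  In the descending case this is the quadratic relation, in the ascending case the definition of the
  involution along a descent, and in the last case \<open>bar_std_fixed\<close>.
\<close>

lemma tensor_bar_std_act:
  assumes g: "g \<in> tuples r m d" and i: "i < d"
  shows "tensor_bar r m d k (gen_act r m k i (std g)) = inv_act r m k i (bar_std r m d k g)"
proof -
  define N where "N = bar_std r m d k"
  define p where "p = hecke_param k i"
  let ?s = "simple_act r m g i"
  have sg: "?s \<in> tuples r m d" by (rule simple_act_tuples[OF g i])
  have NT: "N g \<in> tensor_space r m d" "N ?s \<in> tensor_space r m d"
    using bar_std_tensor_space g sg by (auto simp: N_def)
  have bp: "bar (p - inverse p) = - (p - inverse p)"
    by (simp add: p_def bar_diff bar_inverse bar_hecke_param)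
  from i show ?thesis
  proof (cases rule: gen_act_std_cases[where r = r and m = m and g = g and k = k])
    case desc
    have N: "N g = inv_act r m k i (N ?s)" using bar_std_descent[OF g desc(1)] by (simp add: N_def)
    have "tensor_bar r m d k (gen_act r m k i (std g)) = N ?s - smult (p - inverse p) (N g)"
      by (simp add: desc(2)[folded p_def] tensor_bar_add tensor_bar_smult tensor_bar_single N_def)
         (simp only: bp tensor.scale_minus_left)
    also have "N ?s = gen_act r m k i (N g)" unfolding N by (simp add: gen_act_inv_act[OF NT(2) i])
    finally show ?thesis by (simp add: inv_act_def N_def p_def)
  next
    case asc
    have "N ?s = inv_act r m k i (N g)"
      using bar_std_descent[OF sg asc(1)] by (simp add: N_def simple_act_simple_act)
    thus ?thesis by (simp add: asc(2) tensor_bar_single N_def)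
  next
    case const
    thus ?thesis using bar_std_fixed[OF g, of i k]
      by (simp add: tensor_bar_smult tensor_bar_single bar_hecke_param)
  qed
qed

lemma tensor_bar_gen_act:
  assumes "x \<in> tensor_space r m d" "i < d"
  shows "tensor_bar r m d k (gen_act r m k i x) = inv_act r m k i (tensor_bar r m d k x)"
proof -
  have "Poly_Mapping.keys x \<subseteq> tuples r m d" using assms by (simp add: tensor_space_def)
  thus ?thesis
  proof (induction rule: poly_mapping_induct)
    case (single g c)
    have "Poly_Mapping.single g c = smult c (std g)" by (simp add: smult_single)
    thus ?case using tensor_bar_std_act[OF single assms(2)]
      by (simp only: gen_act_smult inv_act_smult tensor_bar_smult) (simp add: tensor_bar_single)
  qed (simp_all add: gen_act_add inv_act_add tensor_bar_add)
qed

lemma inv_word_smult: "fold (inv_act r m k) ws (smult c x) = smult c (fold (inv_act r m k) ws x)"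
  by (induction ws arbitrary: x) (simp_all add: inv_act_smult)

lemma tensor_bar_free_act:
  assumes "x \<in> tensor_space r m d" "a \<in> carrier (free_alg d)"
  shows "tensor_bar r m d k (free_act r m k x a) = free_act r m k (tensor_bar r m d k x) (free_bar k a)"
  using assms(2)
proof (induction rule: free_alg_induct)
  case (single ws c)
  have "tensor_bar r m d k (fold (gen_act r m k) ws x) = fold (inv_act r m k) ws (tensor_bar r m d k x)"
    using assms(1) single
    by (induction ws arbitrary: x) (simp_all add: tensor_bar_gen_act gen_act_tensor_space)
  thus ?case
    by (simp add: free_act_single tensor_bar_smult free_bar_single free_act_mult free_act_word_inv
          free_act_smult_left inv_word_smult)
qed (simp_all add: free_act_add_right tensor_bar_add free_bar_add)

lemma tensor_bar_hecke_act:
  assumes "x \<in> tensor_space r m d" "h \<in> carrier (hecke d k)"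
  shows "tensor_bar r m d k (hecke_act r m k x h) = hecke_act r m k (tensor_bar r m d k x) (hecke_bar d k h)"
proof -
  from assms(2) obtain a where a: "a \<in> carrier (free_alg d)" "h = hecke_ideal d k +>\<^bsub>free_alg d\<^esub> a"
    by (auto simp: hecke_carrier)
  show ?thesis
    using assms(1) a
    by (simp add: hecke_act_coset hecke_bar_unique_aux[OF hecke_bar] tensor_bar_tensor_space
          free_bar_carrier tensor_bar_free_act)
qed

lemma tensor_bar_antidominant:
  assumes "f \<in> tuples r m d" "antidominant m d f"
  shows "tensor_bar r m d k (std f) = std f"
proof -
  have "\<not> descent r m d f i" for i
  proof
    assume i: "descent r m d f i"
    show False
    proof (cases "i = 0")
      case True
      thus False using i assms(2) wt_pos_bounds[of "f 1" r m] by (auto simp: descent_def antidominant_def field_simps)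
    next
      case False
      hence "f i < f (Suc i)" "i \<in> {1..<d}" using i by (simp_all add: descent_def)
      moreover have "\<forall>i\<in>{1..<d}. f (Suc i) \<le> f i" using assms(2) by (simp add: antidominant_def)
      ultimately show False by fastforce
    qed
  qed
  thus ?thesis using bar_std_bottom[OF assms(1)] by (simp add: tensor_bar_single)
qed

section \<open>Permutation modules\<close>

lemma perm_module_eq:
  assumes "f \<in> tuples r m d"
  shows "perm_module r m d k f = free_act r m k (std f) ` carrier (free_alg d)"
  using hecke_act_coset[OF std_tensor_space[OF assms]]
  by (simp add: perm_module_def hecke_carrier image_image)

lemma perm_module_tensor_space:
  assumes "f \<in> tuples r m d"
  shows "perm_module r m d k f \<subseteq> tensor_space r m d"
  using free_act_tensor_space[OF std_tensor_space[OF assms]] by (auto simp: perm_module_eq[OF assms])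

text \<open>
  On the cyclic module generated by the fixed vector \<open>std f\<close>, applying the involution twice amounts to
  applying the bar operator of the Hecke algebra twice.
\<close>

lemma tensor_bar_perm_module:
  assumes "f \<in> tuples r m d" "antidominant m d f" "x \<in> perm_module r m d k f"
  shows "tensor_bar r m d k x \<in> perm_module r m d k f" "tensor_bar r m d k (tensor_bar r m d k x) = x"
proof -
  obtain a where a: "a \<in> carrier (free_alg d)" "x = free_act r m k (std f) a"
    using assms by (auto simp: perm_module_eq)
  have *: "tensor_bar r m d k (free_act r m k (std f) b) = free_act r m k (std f) (free_bar k b)"
    if "b \<in> carrier (free_alg d)" for b
    using tensor_bar_free_act[OF std_tensor_space that] tensor_bar_antidominant assms by simp
  show "tensor_bar r m d k x \<in> perm_module r m d k f"
    using * a by (simp add: perm_module_eq[OF assms(1)] free_bar_carrier)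
  show "tensor_bar r m d k (tensor_bar r m d k x) = x"
    using * a by (simp add: free_bar_carrier free_bar_bar)
qed

lemma perm_module_subspace:
  assumes "f \<in> tuples r m d"
  shows "tensor.subspace (perm_module r m d k f)"
proof (rule tensor.subspaceI)
  show "0 \<in> perm_module r m d k f"
    unfolding perm_module_eq[OF assms] by (rule image_eqI[of _ _ 0]) (simp_all add: free_alg_0)
  show "x + y \<in> perm_module r m d k f" if "x \<in> perm_module r m d k f" "y \<in> perm_module r m d k f" for x y
    using that free_alg_add unfolding perm_module_eq[OF assms] by (auto simp flip: free_act_add_right)
  show "smult c x \<in> perm_module r m d k f" if "x \<in> perm_module r m d k f" for c x
  proof -
    from that obtain a where a: "a \<in> carrier (free_alg d)" "x = free_act r m k (std f) a"
      by (auto simp: perm_module_eq[OF assms])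
    have "smult c x = free_act r m k (std f) (fconst c * a)"
      by (simp add: a(2) free_act_mult free_act_single free_act_smult_left)
    moreover have "fconst c * a \<in> carrier (free_alg d)" by (intro free_alg_mult free_alg_fconst a(1))
    ultimately show ?thesis by (simp add: perm_module_eq[OF assms])
  qed
qed

lemma perm_module_gen_act:
  assumes "f \<in> tuples r m d" "x \<in> perm_module r m d k f" "i < d"
  shows "gen_act r m k i x \<in> perm_module r m d k f"
proof -
  from assms(2) obtain a where a: "a \<in> carrier (free_alg d)" "x = free_act r m k (std f) a"
    by (auto simp: perm_module_eq[OF assms(1)])
  have "gen_act r m k i x = free_act r m k (std f) (a * fword [i])"
    by (simp add: a(2) free_act_mult free_act_single)
  moreover have "a * fword [i] \<in> carrier (free_alg d)"
    using assms(3) by (intro free_alg_mult free_alg_single a(1)) simp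
  ultimately show ?thesis by (simp add: perm_module_eq[OF assms(1)])
qed

lemma perm_module_std:
  assumes "f \<in> tuples r m d"
  shows "std f \<in> perm_module r m d k f"
  unfolding perm_module_eq[OF assms] by (rule image_eqI[of _ _ 1]) (simp_all add: free_alg_1)

section \<open>Laurent polynomials with integer coefficients\<close>

text \<open>
  The ring \<open>\<int>[q, q\<^sup>-\<^sup>1]\<close>, as finite signed sums of powers of \<open>q\<close>.
\<close>

inductive_set laurent :: "ratfun set" where
  zero: "0 \<in> laurent"
| add: "x \<in> laurent \<Longrightarrow> x + q powi j \<in> laurent"
| sub: "x \<in> laurent \<Longrightarrow> x - q powi j \<in> laurent"

lemma laurent_add:
  assumes "x \<in> laurent" "y \<in> laurent"
  shows "x + y \<in> laurent"
  using assms(2)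
proof induction
  case (add y j)
  thus ?case using laurent.add[of "x + y" j] by (simp add: add.assoc)
next
  case (sub y j)
  thus ?case using laurent.sub[of "x + y" j] by (simp add: add_diff_eq)
qed (use assms(1) in simp)

lemma laurent_uminus: "x \<in> laurent \<Longrightarrow> - x \<in> laurent"
proof (induction rule: laurent.induct)
  case (add x j)
  thus ?case using laurent.sub[of "- x" j] by simp
next
  case (sub x j)
  thus ?case using laurent.add[of "- x" j] by simp
qed (simp add: laurent.zero)

lemma laurent_diff: "x \<in> laurent \<Longrightarrow> y \<in> laurent \<Longrightarrow> x - y \<in> laurent"
  using laurent_add[of x "- y"] laurent_uminus by simp

lemma laurent_power: "q powi j \<in> laurent"
  using laurent.add[OF laurent.zero, of j] by simp

lemma laurent_mult:
  assumes "x \<in> laurent" "y \<in> laurent"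
  shows "x * y \<in> laurent"
proof -
  have *: "y * q powi j \<in> laurent" if "y \<in> laurent" for y j
    using that
  proof induction
    case (add y i)
    thus ?case using laurent.add[of "y * q powi j" "i + j"] by (simp add: distrib_right power_int_add)
  next
    case (sub y i)
    thus ?case using laurent.sub[of "y * q powi j" "i + j"] by (simp add: left_diff_distrib power_int_add)
  qed (simp add: laurent.zero)
  show ?thesis
    using assms(2)
  proof induction
    case (add y j)
    thus ?case using laurent_add *[OF assms(1)] by (simp add: distrib_left)
  next
    case (sub y j)
    thus ?case using laurent_diff *[OF assms(1)] by (simp add: right_diff_distrib)
  qed (simp add: laurent.zero)
qed

lemma bar_q_powi: "bar (q powi j) = q powi (- j)"
  by (simp add: power_int_def bar_power bar_inverse bar_q power_inverse)

lemma laurent_bar: "x \<in> laurent \<Longrightarrow> bar x \<in> laurent"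
  by (induction rule: laurent.induct)
     (simp_all add: laurent.zero bar_add bar_diff bar_q_powi laurent_add laurent_diff laurent_power)

lemma laurent_hecke_param: "hecke_param k i \<in> laurent" "inverse (hecke_param k i) \<in> laurent"
proof -
  have "hecke_param k i = q powi (if i = 0 then k else 1)" by (simp add: hecke_param_def)
  thus "hecke_param k i \<in> laurent" "inverse (hecke_param k i) \<in> laurent"
    using laurent_power by (simp_all flip: power_int_minus)
qed

lemma qinv_int_polysI: "inverse q * poly (map_poly of_int a) (inverse q) \<in> qinv_int_polys"
  unfolding qinv_int_polys_def by blast

lemma qinv_0: "0 \<in> qinv_int_polys"
  using qinv_int_polysI[of 0] by simp

lemma map_poly_of_int_add: "map_poly of_int (a + b) = (map_poly of_int a + map_poly of_int b :: ratfun poly)"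
  by (rule poly_eqI) (simp add: coeff_map_poly)

lemma map_poly_of_int_uminus: "map_poly of_int (- a) = (- map_poly of_int a :: ratfun poly)"
  by (rule poly_eqI) (simp add: coeff_map_poly)

lemma qinv_add: "x \<in> qinv_int_polys \<Longrightarrow> y \<in> qinv_int_polys \<Longrightarrow> x + y \<in> qinv_int_polys"
  unfolding qinv_int_polys_def by (auto simp flip: distrib_left poly_add map_poly_of_int_add)

lemma qinv_uminus: "x \<in> qinv_int_polys \<Longrightarrow> - x \<in> qinv_int_polys"
  unfolding qinv_int_polys_def by (auto simp flip: mult_minus_right poly_minus map_poly_of_int_uminus)

lemma qinv_power: 
  assumes "j < 0"
  shows "q powi j \<in> qinv_int_polys"
proof -
  have "map_poly of_int (monom 1 n :: int poly) = (monom 1 n :: ratfun poly)" for n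
    by (rule poly_eqI) (simp add: coeff_map_poly)
  hence "inverse q * inverse q ^ n \<in> qinv_int_polys" for n
    using qinv_int_polysI[of "monom 1 n"] by (simp add: poly_monom)
  moreover have "q powi j = inverse q * inverse q ^ (nat (- j) - 1)"
    using assms by (simp add: power_int_def flip: power_Suc)
  ultimately show ?thesis by simp
qed

lemma qinv_laurent: "qinv_int_polys \<subseteq> laurent"
proof -
  have "of_int n \<in> laurent" for n
    using laurent_power[of 0]
    by (induction n rule: int_induct[of _ 0]) (simp_all add: laurent.zero laurent_add laurent_diff)
  moreover have q: "inverse q \<in> laurent" using laurent_power[of "- 1"] by simp
  ultimately have "poly (map_poly of_int a) (inverse q) \<in> laurent" for a
    by (induction a) (simp_all add: laurent.zero map_poly_pCons laurent_add laurent_mult)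
  thus ?thesis using q by (auto simp: qinv_int_polys_def laurent_mult)
qed

text \<open>
  The parts with negative, zero and positive exponents.
\<close>

lemma laurent_decompose:
  assumes "x \<in> laurent"
  obtains y z n where "y \<in> qinv_int_polys" "z \<in> qinv_int_polys" "x = y + of_int n + bar z"
proof -
  have "\<exists>y z n. y \<in> qinv_int_polys \<and> z \<in> qinv_int_polys \<and> x = y + of_int n + bar z"
    using assms
  proof induction
    case zero
    show ?case using qinv_0 by (intro exI[of _ 0]) simp
  next
    case (add x j)
    then obtain y z n where x: "y \<in> qinv_int_polys" "z \<in> qinv_int_polys" "x = y + of_int n + bar z" by blast
    consider "j < 0" | "j = 0" | "j > 0" by linarith
    thus ?case
    proof cases
      case 1
      thus ?thesis using x qinv_add qinv_power by (intro exI[of _ "y + q powi j"] exI[of _ z] exI[of _ n]) simp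
    next
      case 2
      thus ?thesis using x by (intro exI[of _ y] exI[of _ z] exI[of _ "n + 1"]) simp
    next
      case 3
      thus ?thesis using x qinv_add qinv_power[of "- j"]
        by (intro exI[of _ y] exI[of _ "z + q powi (- j)"] exI[of _ n]) (simp add: bar_add bar_q_powi del: power_int_minus)
    qed
  next
    case (sub x j)
    then obtain y z n where x: "y \<in> qinv_int_polys" "z \<in> qinv_int_polys" "x = y + of_int n + bar z" by blast
    consider "j < 0" | "j = 0" | "j > 0" by linarith
    thus ?case
    proof cases
      case 1
      thus ?thesis using x qinv_add[OF x(1) qinv_uminus[OF qinv_power[OF 1]]]
        by (intro exI[of _ "y - q powi j"] exI[of _ z] exI[of _ n]) simp
    next
      case 2
      thus ?thesis using x by (intro exI[of _ y] exI[of _ z] exI[of _ "n - 1"]) simp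
    next
      case 3
      hence "- j < 0" by simp
      thus ?thesis using x qinv_add[OF x(2) qinv_uminus[OF qinv_power[of "- j"]]]
        by (intro exI[of _ y] exI[of _ "z - q powi (- j)"] exI[of _ n]) (simp add: bar_diff bar_q_powi del: power_int_minus)
    qed
  qed
  thus ?thesis using that by blast
qed

text \<open>
  The element \<open>q\<close> is transcendental: multiplied by a suitable power of \<open>q\<close>, the left-hand side becomes a
  polynomial in \<open>q\<close> with the same leading coefficient as \<open>R\<close>.
\<close>

lemma poly_relation_trivial:
  fixes R :: "rat poly"
  assumes "inverse q * ev_inv R + to_fract [:c:] + q * to_fract R = 0"
  shows "R = 0"
proof (rule ccontr)
  assume "R \<noteq> 0"
  define N where "N = degree R"
  have "reflect_poly (map_poly of_rat R) = (map_poly of_rat (reflect_poly R) :: ratfun poly)"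
    by (rule poly_eqI) (simp add: coeff_reflect_poly coeff_map_poly degree_map_poly)
  hence refl: "to_fract (reflect_poly R) = q ^ N * ev_inv R"
    by (simp add: to_fract_eq_poly ev_inv_def degree_map_poly poly_reflect_poly_nz N_def
             flip: \<open>reflect_poly _ = _\<close>)
  have monom: "to_fract (monom c n) = to_fract [:c:] * q ^ n" for c n
  proof -
    have "to_fract ([:0, 1:] ^ n :: rat poly) = q ^ n" by (induction n) (simp_all only: q_def power_0 power_Suc to_fract_mult to_fract_1)
    moreover have "monom c n = [:c:] * [:0, 1:] ^ n" by (simp add: monom_altdef)
    ultimately show ?thesis by (simp only: to_fract_mult)
  qed
  have "to_fract (reflect_poly R + monom c (Suc N) + monom 1 (Suc (Suc N)) * R) =
      q ^ N * ev_inv R + to_fract [:c:] * q ^ Suc N + q ^ Suc (Suc N) * to_fract R"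
    by (simp only: to_fract_add to_fract_mult refl monom) (simp flip: one_pCons)
  also have "\<dots> = q ^ Suc N * (inverse q * ev_inv R + to_fract [:c:] + q * to_fract R)"
    by (simp add: algebra_simps)
  also have "\<dots> = 0" using assms by simp
  finally have "reflect_poly R + monom c (Suc N) + monom 1 (Suc (Suc N)) * R = 0"
    by (simp only: to_fract_eq_0_iff)
  hence "coeff (reflect_poly R + monom c (Suc N) + monom 1 (Suc (Suc N)) * R) (Suc (Suc N) + N) = 0"
    by simp
  \<comment> \<open>The first summand has degree at most \<open>N\<close> and the second \<open>Suc N\<close>, both below \<open>2 N + 2\<close>.\<close>
  hence "coeff R N = 0"
    by (simp add: coeff_reflect_poly coeff_monom_mult N_def)
  thus False using \<open>R \<noteq> 0\<close> by (simp add: N_def)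
qed

text \<open>
  The positive part of \<open>x\<close> is minus the bar of its negative part, and the constant term equals its
  own negative.
\<close>

lemma laurent_antisymmetric:
  assumes "x \<in> laurent" "bar x = - x"
  obtains y where "y \<in> qinv_int_polys" "x = y - bar y"
proof -
  obtain y z n where x: "y \<in> qinv_int_polys" "z \<in> qinv_int_polys" "x = y + of_int n + bar z"
    by (rule laurent_decompose[OF assms(1)])
  obtain a where a: "y + z = inverse q * poly (map_poly of_int a) (inverse q)"
    using qinv_add[OF x(1,2)] by (auto simp: qinv_int_polys_def)
  define R where "R = (map_poly of_int a :: rat poly)"
  have "map_poly of_rat R = (map_poly of_int a :: ratfun poly)"
    by (rule poly_eqI) (simp add: R_def coeff_map_poly)
  hence ev: "y + z = inverse q * ev_inv R" by (simp add: a ev_inv_def)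
  have int: "(of_int i :: ratfun) = to_fract [:of_int i:]" for i
    using of_rat_ratfun[of "of_int i"] by simp
  have bint: "bar (of_int i) = of_int i" for i
    using bar_of_rat[of "of_int i"] by simp
  have "bar (ev_inv R) = to_fract R" using bar_bar[of "to_fract R"] by (simp add: bar_to_fract)
  hence bev: "bar (y + z) = q * to_fract R" by (simp add: ev bar_mult bar_inverse bar_q)
  have "(y + z) + of_int (2 * n) + bar (y + z) = x + bar x"
    by (simp add: x(3) bar_add bint algebra_simps)
  hence sum: "(y + z) + of_int (2 * n) + bar (y + z) = 0" using assms(2) by simp
  hence "R = 0" unfolding bev unfolding ev int by (rule poly_relation_trivial)
  hence yz: "y + z = 0" by (simp add: ev)
  hence "n = 0" using sum by simp
  moreover have "z = - y" using yz by (simp add: eq_neg_iff_add_eq_0 add.commute)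
  ultimately have "x = y - bar y" by (simp add: x(3) bar_minus)
  thus ?thesis using that x(1) by blast
qed

section \<open>Unitriangular bar involutions\<close>

text \<open>
  The set \<open>S\<close> of coefficients will be \<open>\<int>[q, q\<^sup>-\<^sup>1]\<close> for matrix entries of the bar involution and
  \<open>q\<^sup>-\<^sup>1\<int>[q\<^sup>-\<^sup>1]\<close> for canonical basis elements.
\<close>

definition coeff_span :: "ratfun set \<Rightarrow> ('w \<Rightarrow> nat \<Rightarrow> real) \<Rightarrow> 'w set \<Rightarrow> tensor set" where
  "coeff_span S g D = {\<Sum>w\<in>D. smult (c w) (std (g w)) | c. \<forall>w. c w \<in> S}"

lemma coeff_span_0: "0 \<in> S \<Longrightarrow> 0 \<in> coeff_span S g D"
  unfolding coeff_span_def by (auto intro!: exI[of _ "\<lambda>_. 0"])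

lemma coeff_span_add:
  assumes "\<And>a b. a \<in> S \<Longrightarrow> b \<in> S \<Longrightarrow> a + b \<in> S" "x \<in> coeff_span S g D" "y \<in> coeff_span S g D"
  shows "x + y \<in> coeff_span S g D"
proof -
  from assms obtain a b where "\<forall>w. a w \<in> S" "\<forall>w. b w \<in> S"
    "x = (\<Sum>w\<in>D. smult (a w) (std (g w)))" "y = (\<Sum>w\<in>D. smult (b w) (std (g w)))"
    unfolding coeff_span_def by blast
  thus ?thesis using assms(1) unfolding coeff_span_def
    by (auto intro!: exI[of _ "\<lambda>w. a w + b w"] simp: tensor.scale_left_distrib sum.distrib)
qed

lemma coeff_span_smult:
  assumes "\<And>a. a \<in> S \<Longrightarrow> e * a \<in> S" "x \<in> coeff_span S g D"
  shows "smult e x \<in> coeff_span S g D"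
proof -
  from assms obtain a where "\<forall>w. a w \<in> S" "x = (\<Sum>w\<in>D. smult (a w) (std (g w)))"
    unfolding coeff_span_def by blast
  thus ?thesis using assms(1) unfolding coeff_span_def
    by (auto intro!: exI[of _ "\<lambda>w. e * a w"] simp: tensor.scale_sum_right)
qed

lemma coeff_span_std:
  assumes "0 \<in> S" "e \<in> S" "w \<in> D" "finite D"
  shows "smult e (std (g w)) \<in> coeff_span S g D"
proof -
  have "(\<Sum>v\<in>D. smult (if v = w then e else 0) (std (g v))) = smult e (std (g w))"
    using assms by (subst sum.remove[OF assms(4,3)]) simp
  thus ?thesis using assms unfolding coeff_span_def
    by (intro CollectI exI[of _ "\<lambda>v. if v = w then e else 0"]) simp
qed

lemma coeff_span_mono:
  assumes "0 \<in> S" "D \<subseteq> E" "finite E" "x \<in> coeff_span S g D"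
  shows "x \<in> coeff_span S g E"
proof -
  from assms obtain a where a: "\<forall>w. a w \<in> S" "x = (\<Sum>w\<in>D. smult (a w) (std (g w)))"
    unfolding coeff_span_def by blast
  have "x = (\<Sum>w\<in>E. smult (if w \<in> D then a w else 0) (std (g w)))"
    unfolding a(2) by (rule sum.mono_neutral_cong_left) (use assms in auto)
  thus ?thesis using assms(1) a(1) unfolding coeff_span_def
    by (intro CollectI exI[of _ "\<lambda>w. if w \<in> D then a w else 0"]) simp
qed

lemma coeff_span_lookup:
  assumes "x \<in> coeff_span S g D" "\<And>w. w \<in> D \<Longrightarrow> g w \<noteq> h"
  shows "Poly_Mapping.lookup x h = 0"
  using assms unfolding coeff_span_def
  by (auto simp: lookup_sum lookup_single when_def intro!: sum.neutral)

abbreviation "laurent_span \<equiv> coeff_span laurent"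

lemma laurent_span_semilinear:
  assumes add: "\<And>x y. \<phi> (x + y) = \<phi> x + \<phi> y" and "\<phi> 0 = 0"
    and "\<And>c x. \<phi> (smult c x) = smult (\<beta> c) (\<phi> x)" and "\<And>c. c \<in> laurent \<Longrightarrow> \<beta> c \<in> laurent"
    and "\<And>w. w \<in> D \<Longrightarrow> \<phi> (std (g w)) \<in> laurent_span g E" and x: "x \<in> laurent_span g D" and "finite D"
  shows "\<phi> x \<in> laurent_span g E"
proof -
  from x obtain a where a: "\<forall>w. a w \<in> laurent" "x = (\<Sum>w\<in>D. smult (a w) (std (g w)))"
    unfolding coeff_span_def by blast
  have "\<phi> (\<Sum>w\<in>D'. smult (a w) (std (g w))) \<in> laurent_span g E" if "D' \<subseteq> D" for D'
    using finite_subset[OF that assms(7)] that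
  proof induction
    case (insert w D')
    have "smult (\<beta> (a w)) (\<phi> (std (g w))) \<in> laurent_span g E"
      by (rule coeff_span_smult) (use insert assms a laurent_mult in auto)
    thus ?case using insert by (simp add: add assms(3) coeff_span_add laurent_add)
  qed (simp add: assms(2) coeff_span_0 laurent.zero)
  thus ?thesis using a by blast
qed

text \<open>
  If \<open>x = \<psi> v - v\<close> is the failure of a vector \<open>v\<close> to be invariant under the involution \<open>\<psi>\<close>, then
  \<open>\<psi> x = - x\<close>, and the \<open>y\<close> found here makes \<open>v + y\<close> invariant. Let \<open>w\<close> be of maximal rank in \<open>D\<close>. By
  triangularity only \<open>w\<close> itself contributes to the coefficient at \<open>w\<close>, so this coefficient \<open>c\<close> satisfies
  \<open>bar c = - c\<close> and has the form \<open>z - bar z\<close>. If \<open>u\<close> is \<open>z\<close> times the basis vector of \<open>w\<close>, subtracting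
  \<open>u - \<psi> u\<close> removes \<open>w\<close> from the support of \<open>x\<close>, and induction applies.
\<close>

lemma bar_correction:
  fixes \<psi> :: "tensor \<Rightarrow> tensor" and \<rho> :: "'w \<Rightarrow> nat"
  assumes "\<And>x y. \<psi> (x + y) = \<psi> x + \<psi> y" and "\<And>c x. \<psi> (smult c x) = smult (bar c) (\<psi> x)"
    and "finite D" and "inj_on g D"
    and "\<And>w. w \<in> D \<Longrightarrow> \<psi> (\<psi> (std (g w))) = std (g w)"
    and "\<And>w. w \<in> D \<Longrightarrow> \<psi> (std (g w)) - std (g w) \<in> laurent_span g {v \<in> D. \<rho> v < \<rho> w}"
    and "x \<in> laurent_span g D" and "\<psi> x = - x"
  shows "\<exists>y \<in> coeff_span qinv_int_polys g D. x = y - \<psi> y"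
  using assms(3-8)
proof (induction "card D" arbitrary: D x)
  case 0
  hence "D = {}" by simp
  hence "x = 0" using 0 by (auto simp: coeff_span_def)
  moreover have "\<psi> 0 = 0" using assms(1)[of 0 0] by simp
  ultimately show ?case using coeff_span_0[OF qinv_0, of g D] by (intro bexI[of _ 0]) auto
next
  case (Suc n)
  have psi0: "\<psi> 0 = 0" using assms(1)[of 0 0] by simp
  have psi_minus: "\<psi> (a - b) = \<psi> a - \<psi> b" for a b using assms(1)[of "a - b" b] by simp
  have "D \<noteq> {}" using Suc.hyps(2) by auto
  then obtain w where w: "w \<in> D" and max: "\<And>v. v \<in> D \<Longrightarrow> \<rho> v \<le> \<rho> w"
    using Max_in[of "\<rho> ` D"] Max_ge[of "\<rho> ` D"] Suc.prems(1) by fastforce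
  define D' where "D' = D - {w}"
  have D': "finite D'" "inj_on g D'" "card D' = n" "D' \<subseteq> D"
    using Suc.prems(1,2) Suc.hyps(2) w by (auto simp: D'_def inj_on_diff)
  have low: "{v \<in> D. \<rho> v < \<rho> u} = {v \<in> D'. \<rho> v < \<rho> u}" if "u \<in> D" for u
    using max[OF that] by (auto simp: D'_def)
  have gw: "g v \<noteq> g w" if "v \<in> D'" for v using that w Suc.prems(2) by (auto simp: D'_def inj_on_def)
  let ?M = "\<lambda>v. std (g v)"
  have tri: "\<psi> (?M u) - ?M u \<in> laurent_span g {v \<in> D'. \<rho> v < \<rho> u}" if "u \<in> D" for u
    using Suc.prems(4)[OF that] low[OF that] by simp
  have tri': "\<psi> (?M u) - ?M u \<in> laurent_span g D'" if "u \<in> D" for u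
    by (rule coeff_span_mono[OF laurent.zero _ D'(1) tri[OF that]]) auto
  obtain c where c: "\<forall>v. c v \<in> laurent" "x = (\<Sum>v\<in>D. smult (c v) (?M v))"
    using Suc.prems(5) unfolding coeff_span_def by blast
  define x' where "x' = (\<Sum>v\<in>D'. smult (c v) (?M v))"
  have x': "x' \<in> laurent_span g D'" unfolding coeff_span_def x'_def using c(1) by blast
  have x: "x = smult (c w) (?M w) + x'"
    unfolding c(2) x'_def D'_def by (rule sum.remove[OF Suc.prems(1) w])
  have psi_M: "\<psi> (?M u) \<in> laurent_span g D'" if "u \<in> D'" for u
  proof -
    have "?M u \<in> laurent_span g D'"
      using coeff_span_std[OF laurent.zero laurent_power[of 0] that D'(1), of g] by simp
    from coeff_span_add[OF laurent_add tri'[of u] this] that show ?thesis by (simp add: D'_def)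
  qed
  have psi_x': "\<psi> x' \<in> laurent_span g D'"
    by (rule laurent_span_semilinear[where \<beta> = bar, OF assms(1) psi0 assms(2) laurent_bar psi_M x' D'(1)])
  define e where "e = \<psi> (?M w) - ?M w"
  have e: "e \<in> laurent_span g D'" unfolding e_def by (rule tri'[OF w])
  have look: "Poly_Mapping.lookup y (g w) = 0" if "y \<in> laurent_span g D'" for y
    by (rule coeff_span_lookup[OF that]) (use gw in auto)
  have psi_x: "\<psi> x = smult (bar (c w)) (?M w + e) + \<psi> x'" by (simp add: x assms(1,2) e_def)
  have "Poly_Mapping.lookup (\<psi> x) (g w) = - Poly_Mapping.lookup x (g w)" by (simp add: Suc.prems(6))
  hence "bar (c w) = - c w"
    unfolding psi_x unfolding x by (simp add: lookup_add look x' psi_x' e)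
  then obtain z where z: "z \<in> qinv_int_polys" "c w = z - bar z"
    using laurent_antisymmetric[of "c w"] c(1) by blast
  \<comment> \<open>This removes \<open>w\<close> from the support of \<open>x\<close>.\<close>
  define x2 where "x2 = x - (smult z (?M w) - \<psi> (smult z (?M w)))"
  have "x2 = x' + smult (bar z) e"
    by (simp add: x2_def x assms(2) z(2) e_def tensor.scale_left_diff_distrib tensor.scale_right_diff_distrib)
  moreover have "smult (bar z) e \<in> laurent_span g D'"
    by (rule coeff_span_smult[OF laurent_mult e]) (use z(1) qinv_laurent laurent_bar in auto)
  ultimately have x2: "x2 \<in> laurent_span g D'" using coeff_span_add[OF laurent_add x'] by simp
  have "\<psi> x2 = - x2"
    using Suc.prems(3)[OF w] by (simp add: x2_def psi_minus Suc.prems(6) assms(2))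
  from Suc.hyps(1)[OF D'(3)[symmetric] D'(1,2) _ _ x2 this] obtain y
    where y: "y \<in> coeff_span qinv_int_polys g D'" "x2 = y - \<psi> y"
    using Suc.prems(3) tri D'(4) by blast
  show ?case
  proof (rule bexI)
    show "x = (y + smult z (?M w)) - \<psi> (y + smult z (?M w))"
      using y(2) by (simp add: x2_def assms(1) algebra_simps)
    show "y + smult z (?M w) \<in> coeff_span qinv_int_polys g D"
      by (rule coeff_span_add[OF qinv_add coeff_span_mono[OF qinv_0 D'(4) Suc.prems(1) y(1)]
            coeff_span_std[OF qinv_0 z(1) w Suc.prems(1)]])
  qed
qed

text \<open>
  The coefficient at a vector of maximal rank detects linear dependence, and by induction on the rank
  the given vectors are combinations of the new ones.
\<close>

lemma unitriangular_basis:
  fixes C :: "'w \<Rightarrow> tensor" and \<rho> :: "'w \<Rightarrow> nat"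
  assumes fin: "finite P" and inj: "inj_on g P"
    and tri: "\<And>w. w \<in> P \<Longrightarrow> C w - std (g w) \<in> coeff_span S g {v \<in> P. \<rho> v < \<rho> w}"
  shows "inj_on C P" "\<not> tensor.dependent (C ` P)" "tensor.span (C ` P) = tensor.span ((\<lambda>w. std (g w)) ` P)"
proof -
  have look: "Poly_Mapping.lookup (C w) (g v) = (if v = w then 1 else 0)"
    if "w \<in> P" "v \<in> P" "\<rho> w \<le> \<rho> v" for v w
  proof -
    have "Poly_Mapping.lookup (C w - std (g w)) (g v) = 0"
      by (rule coeff_span_lookup[OF tri[OF that(1)]]) (use that inj in \<open>auto simp: inj_on_def\<close>)
    moreover have "g w = g v \<longleftrightarrow> w = v" using inj that by (auto simp: inj_on_def)
    ultimately show ?thesis by (auto simp: lookup_minus lookup_single when_def)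
  qed
  show injC: "inj_on C P"
  proof (rule inj_onI, rule ccontr)
    fix v w assume vw: "v \<in> P" "w \<in> P" "C v = C w" "v \<noteq> w"
    show False
    proof (cases "\<rho> v \<le> \<rho> w")
      case True
      thus False using look[of v w] look[of w w] vw by simp
    next
      case False
      thus False using look[of w v] look[of v v] vw by simp
    qed
  qed
  show "\<not> tensor.dependent (C ` P)"
  proof
    assume "tensor.dependent (C ` P)"
    then obtain u where u: "\<exists>x\<in>C ` P. u x \<noteq> 0" "(\<Sum>x\<in>C ` P. smult (u x) x) = 0"
      unfolding tensor.dependent_finite[OF finite_imageI[OF fin]] by blast
    define A where "A = {w \<in> P. u (C w) \<noteq> 0}"
    have "finite (\<rho> ` A)" "\<rho> ` A \<noteq> {}" using fin u(1) by (auto simp: A_def)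
    hence "Max (\<rho> ` A) \<in> \<rho> ` A" by (rule Max_in)
    then obtain w where w: "w \<in> A" "\<rho> w = Max (\<rho> ` A)" by auto
    have max: "\<rho> v \<le> \<rho> w" if "v \<in> P" "u (C v) \<noteq> 0" for v
      using that \<open>finite (\<rho> ` A)\<close> w(2) by (auto simp: A_def)
    have wP: "w \<in> P" "u (C w) \<noteq> 0" using w by (auto simp: A_def)
    have "0 = Poly_Mapping.lookup (\<Sum>v\<in>P. smult (u (C v)) (C v)) (g w)"
      using u(2) by (simp add: sum.reindex[OF injC])
    also have "\<dots> = (\<Sum>v\<in>P. u (C v) * Poly_Mapping.lookup (C v) (g w))" by (simp add: lookup_sum)
    also have "\<dots> = (\<Sum>v\<in>P. if v = w then u (C w) else 0)"
    proof (rule sum.cong)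
      show "u (C v) * Poly_Mapping.lookup (C v) (g w) = (if v = w then u (C w) else 0)" if "v \<in> P" for v
        using look[OF that wP(1)] max[OF that] by (cases "u (C v) = 0") auto
    qed simp
    also have "\<dots> = u (C w)" using fin wP by simp
    finally show False using wP by simp
  qed
  have span: "x \<in> tensor.span ((\<lambda>w. std (g w)) ` D)" if "x \<in> coeff_span S g D" for x D
    using that unfolding coeff_span_def
    by (auto intro!: tensor.span_sum tensor.span_scale intro: tensor.span_base)
  show "tensor.span (C ` P) = tensor.span ((\<lambda>w. std (g w)) ` P)"
  proof (rule tensor.span_eq[THEN iffD2], intro conjI subsetI)
    fix x assume "x \<in> C ` P"
    then obtain w where w: "w \<in> P" "x = C w" by blast
    have "C w - std (g w) \<in> tensor.span ((\<lambda>w. std (g w)) ` P)"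
      by (rule tensor.span_mono[THEN subsetD, OF _ span[OF tri[OF w(1)]]]) auto
    from tensor.span_add[OF this tensor.span_base[of "std (g w)"]] w
    show "x \<in> tensor.span ((\<lambda>w. std (g w)) ` P)" by simp
  next
    have "std (g w) \<in> tensor.span (C ` P)" if "w \<in> P" for w
      using that
    proof (induction "\<rho> w" arbitrary: w rule: less_induct)
      case less
      have "(\<lambda>w. std (g w)) ` {v \<in> P. \<rho> v < \<rho> w} \<subseteq> tensor.span (C ` P)" using less.hyps by auto
      hence "tensor.span ((\<lambda>w. std (g w)) ` {v \<in> P. \<rho> v < \<rho> w}) \<subseteq> tensor.span (C ` P)"
        by (rule tensor.span_minimal) (rule tensor.subspace_span)
      hence "C w - std (g w) \<in> tensor.span (C ` P)" using span[OF tri[OF less.prems]] by blast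
      from tensor.span_diff[OF tensor.span_base[of "C w"] this] less.prems show ?case by simp
    qed
    thus "x \<in> tensor.span (C ` P)" if "x \<in> (\<lambda>w. std (g w)) ` P" for x using that by auto
  qed
qed

section \<open>Length and Bruhat order on the Weyl group\<close>

lemma weyl_simps [simp]: "x \<otimes>\<^bsub>weyl d\<^esub> y = x \<circ> y" "\<one>\<^bsub>weyl d\<^esub> = id"
  by (simp_all add: weyl_def)

lemma weylD:
  assumes "x \<in> carrier (weyl d)"
  shows "inj x" "x (- z) = - x z" "x z = 0 \<longleftrightarrow> z = 0" "z \<noteq> 0 \<and> \<bar>z\<bar> \<le> int d \<longleftrightarrow> x z \<noteq> 0 \<and> \<bar>x z\<bar> \<le> int d"
proof -
  have p: "x permutes ({- int d..int d} - {0})" and n: "\<And>z. x (- z) = - x z" using assms by (auto simp: weyl_def)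
  show i: "inj x" using permutes_inj[OF p] .
  show "x (- z) = - x z" by (rule n)
  have "x 0 = 0" using n[of 0] by simp
  thus "x z = 0 \<longleftrightarrow> z = 0" using i by (metis injD)
  show "z \<noteq> 0 \<and> \<bar>z\<bar> \<le> int d \<longleftrightarrow> x z \<noteq> 0 \<and> \<bar>x z\<bar> \<le> int d"
    using permutes_in_image[OF p, of z] by auto
qed

lemma weyl_comp: "x \<in> carrier (weyl d) \<Longrightarrow> y \<in> carrier (weyl d) \<Longrightarrow> x \<circ> y \<in> carrier (weyl d)"
  using monoid.m_closed[OF group.is_monoid[OF weyl_group]] by simp

lemma weyl_id: "id \<in> carrier (weyl d)"
  using monoid.one_closed[OF group.is_monoid[OF weyl_group]] by simp

text \<open>
  The reflections of the Weyl group. Those with \<open>b = - a\<close> change a single sign.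
\<close>

definition signed_swap :: "int \<Rightarrow> int \<Rightarrow> int \<Rightarrow> int" where
  "signed_swap a b z =
     (if z = a then b else if z = b then a else if z = - a then - b else if z = - b then - a else z)"

lemma signed_swap_invol:
  assumes "a \<noteq> b" "a \<noteq> 0" "b \<noteq> 0"
  shows "signed_swap a b \<circ> signed_swap a b = id"
  using assms by (auto simp: fun_eq_iff signed_swap_def)

lemma signed_swap_comm:
  assumes "a \<noteq> b" "a \<noteq> 0" "b \<noteq> 0"
  shows "signed_swap a b = signed_swap b a"
  using assms by (auto simp: fun_eq_iff signed_swap_def)

lemma signed_swap_uminus: "a \<noteq> 0 \<Longrightarrow> b \<noteq> 0 \<Longrightarrow> signed_swap (- a) (- b) = signed_swap a b"
  by (auto simp: fun_eq_iff signed_swap_def)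

lemma signed_swap_weyl:
  assumes "a \<noteq> b" "a \<noteq> 0" "b \<noteq> 0" "\<bar>a\<bar> \<le> int d" "\<bar>b\<bar> \<le> int d"
  shows "signed_swap a b \<in> carrier (weyl d)"
proof -
  have "signed_swap a b permutes ({- int d..int d} - {0})"
  proof (rule bij_imp_permutes)
    show "bij_betw (signed_swap a b) ({- int d..int d} - {0}) ({- int d..int d} - {0})"
      by (rule bij_betw_byWitness[where f' = "signed_swap a b"])
         (use assms signed_swap_invol[OF assms(1-3)] in \<open>auto simp: signed_swap_def fun_eq_iff\<close>)
  qed (use assms in \<open>auto simp: signed_swap_def\<close>)
  moreover have "signed_swap a b (- z) = - signed_swap a b z" for z
    using assms by (auto simp: signed_swap_def)
  ultimately show ?thesis by (simp add: weyl_def)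
qed

lemma weyl_signed_swap:
  assumes "x \<in> carrier (weyl d)"
  shows "x \<circ> signed_swap a b = signed_swap (x a) (x b) \<circ> x"
proof -
  have "x z = x c \<longleftrightarrow> z = c" "x z = - x c \<longleftrightarrow> z = - c" for z c
    using weylD(1,2)[OF assms] by (metis injD)+
  thus ?thesis using weylD(2)[OF assms] by (auto simp: fun_eq_iff signed_swap_def)
qed

lemma simple_refl_signed_swap:
  "simple_refl i = (if i = 0 then signed_swap (- 1) 1 else signed_swap (int i) (int i + 1))"
  by (auto simp: simple_refl_def signed_swap_def transpose_def fun_eq_iff)

lemma simple_refl_invol: "simple_refl i \<circ> simple_refl i = id"
  by (auto simp: simple_refl_signed_swap intro!: signed_swap_invol)

text \<open>
  A simple reflection makes only its own root negative.
\<close>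

lemma simple_refl_order:
  assumes "a < b" "a \<noteq> 0" "b \<noteq> 0" "\<not> simple_refl i a < simple_refl i b"
  shows "signed_swap a b = simple_refl i"
proof (cases "i = 0")
  case True
  hence "a = - 1 \<and> b = 1"
    using assms by (auto simp: simple_refl_signed_swap signed_swap_def split: if_splits)
  thus ?thesis using True by (simp add: simple_refl_signed_swap)
next
  case False
  hence "a = int i \<and> b = int i + 1 \<or> a = - (int i + 1) \<and> b = - int i"
    using assms by (auto simp: simple_refl_signed_swap signed_swap_def split: if_splits)
  thus ?thesis using False signed_swap_uminus[of "int i + 1" "int i"] signed_swap_comm[of "int i" "int i + 1"]
    by (auto simp: simple_refl_signed_swap)
qed

lemma weyl_word_Nil [simp]: "weyl_word [] = id"
  and weyl_word_Cons [simp]: "weyl_word (i # ws) = simple_refl i \<circ> weyl_word ws"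
  by (simp_all add: weyl_word_def)

lemma weyl_word_append: "weyl_word (us @ ws) = weyl_word us \<circ> weyl_word ws"
  by (induction us) (simp_all add: o_assoc)

lemma weyl_word_weyl: "set ws \<subseteq> {..<d} \<Longrightarrow> weyl_word ws \<in> carrier (weyl d)"
  by (induction ws) (simp_all add: weyl_id weyl_comp simple_refl_weyl)

text \<open>
  Apply the letters of the word from right to left to the pair \<open>(a, b)\<close>. The pair is reversed in the end,
  so some letter reverses its current images. That letter is the reflection exchanging these images,
  and deleting it has the same effect as exchanging \<open>a\<close> and \<open>b\<close> first.
\<close>

lemma strong_exchange:
  assumes "set ws \<subseteq> {..<d}" "a < b" "a \<noteq> 0" "b \<noteq> 0" "weyl_word ws b < weyl_word ws a"
  obtains ws' where "set ws' \<subseteq> {..<d}" "Suc (length ws') = length ws"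
    "weyl_word ws' = weyl_word ws \<circ> signed_swap a b"
proof -
  have "\<exists>ws'. set ws' \<subseteq> {..<d} \<and> Suc (length ws') = length ws \<and>
      weyl_word ws' = weyl_word ws \<circ> signed_swap a b"
    using assms(1,5)
  proof (induction ws)
    case Nil
    thus ?case using assms(2) by simp
  next
    case (Cons i us)
    define y where "y = weyl_word us"
    have y: "y \<in> carrier (weyl d)" using Cons.prems(1) weyl_word_weyl by (simp add: y_def)
    consider "y b < y a" | "y a < y b" using weylD(1)[OF y] assms(2) by (metis injD linorder_cases less_irrefl)
    thus ?case
    proof cases
      case 1
      have "set us \<subseteq> {..<d}" using Cons.prems(1) by simp
      from Cons.IH[OF this 1[unfolded y_def]] obtain us' where "set us' \<subseteq> {..<d}"
        "Suc (length us') = length us" "weyl_word us' = weyl_word us \<circ> signed_swap a b" by blast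
      thus ?thesis using Cons.prems(1) by (intro exI[of _ "i # us'"]) (simp add: o_assoc)
    next
      case 2
      have "signed_swap (y a) (y b) = simple_refl i"
        using 2 Cons.prems(2) weylD(3)[OF y] assms by (intro simple_refl_order) (simp_all add: y_def)
      hence "weyl_word (i # us) \<circ> signed_swap a b = (simple_refl i \<circ> simple_refl i) \<circ> y"
        using weyl_signed_swap[OF y, of a b] by (simp add: y_def comp_assoc)
      hence "weyl_word us = weyl_word (i # us) \<circ> signed_swap a b"
        by (simp only: simple_refl_invol y_def id_comp)
      moreover have "set us \<subseteq> {..<d}" "Suc (length us) = length (i # us)" using Cons.prems(1) by simp_all
      ultimately show ?thesis by blast
    qed
  qed
  thus ?thesis using that by blast
qed

lemma weyl_eq_id:
  assumes "x \<in> carrier (weyl d)" "0 < d" "0 < x 1" "\<And>i. 1 \<le> i \<Longrightarrow> i < d \<Longrightarrow> x (int i) < x (int i + 1)"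
  shows "x = id"
proof -
  have lower: "int n \<le> x (int n)" if "1 \<le> n" "n \<le> d" for n
    using that
  proof (induction n rule: dec_induct)
    case (step n)
    thus ?case using assms(4)[of n] by (simp add: add.commute)
  qed (use assms(3) in simp)
  have upper: "x (int n) \<le> int n" if "1 \<le> n" "n \<le> d" for n
    using that(2,1)
  proof (induction n rule: inc_induct)
    case base
    thus ?case using weylD(4)[OF assms(1), of "int d"] by auto
  next
    case (step n)
    thus ?case using assms(4)[of n] by (simp add: add.commute)
  qed
  have pos: "x (int n) = int n" if "1 \<le> n" "n \<le> d" for n using lower[OF that] upper[OF that] by simp
  show ?thesis
  proof
    fix z :: int
    consider "\<bar>z\<bar> \<le> int d" "z > 0" | "\<bar>z\<bar> \<le> int d" "z < 0" | "z = 0" | "\<bar>z\<bar> > int d" by linarith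
    thus "x z = id z"
    proof cases
      case 1
      thus ?thesis using pos[of "nat z"] by simp
    next
      case 2
      thus ?thesis using pos[of "nat (- z)"] weylD(2)[OF assms(1), of z] by simp
    next
      case 3
      thus ?thesis using weylD(3)[OF assms(1)] by simp
    next
      case 4
      have "x permutes ({- int d..int d} - {0})" using assms(1) by (simp add: weyl_def)
      moreover have "z \<notin> {- int d..int d} - {0}" using 4 by auto
      ultimately show ?thesis by (simp add: permutes_not_in)
    qed
  qed
qed

definition word_descent :: "nat \<Rightarrow> (int \<Rightarrow> int) \<Rightarrow> nat \<Rightarrow> bool" where
  "word_descent d x i \<longleftrightarrow> i < d \<and> (if i = 0 then x 1 < 0 else x (int i + 1) < x (int i))"

lemma word_descent_ex:
  assumes "x \<in> carrier (weyl d)" "x \<noteq> id" "0 < d"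
  obtains i where "word_descent d x i"
proof (rule ccontr)
  assume "\<not> thesis"
  hence n: "\<not> word_descent d x i" for i using that by blast
  have "x (int i + 1) \<noteq> x (int i)" for i using weylD(1)[OF assms(1)] by (metis injD add_cancel_left_right zero_neq_one)
  moreover have "x 1 \<noteq> 0" using weylD(3)[OF assms(1)] by simp
  ultimately have "x = id"
    using n assms by (intro weyl_eq_id[of x d]) (force simp: word_descent_def)+
  thus False using assms(2) by simp
qed

text \<open>
  Sorting the values terminates because each step increases their sum weighted by the positions, which
  is bounded.
\<close>

lemma weyl_word_ex:
  assumes "x \<in> carrier (weyl d)" "0 < d"
  obtains ws where "set ws \<subseteq> {..<d}" "weyl_word ws = x"
proof -
  define \<Psi> where "\<Psi> y = (\<Sum>j\<in>{1..d}. of_nat j * y (int j))" for y :: "int \<Rightarrow> int"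
  have bound: "\<Psi> y \<le> (\<Sum>j\<in>{1..d}. of_nat j * int d)" if "y \<in> carrier (weyl d)" for y
    unfolding \<Psi>_def
  proof (intro sum_mono mult_left_mono)
    show "y (int j) \<le> int d" if "j \<in> {1..d}" for j using weylD(4)[OF \<open>y \<in> _\<close>, of "int j"] that by auto
  qed simp
  have "\<exists>ws. set ws \<subseteq> {..<d} \<and> weyl_word ws = x"
    using assms(1)
  proof (induction "nat ((\<Sum>j\<in>{1..d}. of_nat j * int d) - \<Psi> x)" arbitrary: x rule: less_induct)
    case less
    show ?case
    proof (cases "x = id")
      case True
      thus ?thesis by (intro exI[of _ "[]"]) simp
    next
      case False
      then obtain i where i: "word_descent d x i" using word_descent_ex less.prems assms(2) by blast
      define y where "y = x \<circ> simple_refl i"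
      have id: "i < d" using i by (simp add: word_descent_def)
      have y: "y \<in> carrier (weyl d)" unfolding y_def by (intro weyl_comp less.prems simple_refl_weyl id)
      have "\<Psi> x < \<Psi> y"
      proof (cases "i = 0")
        case True
        have "\<Psi> z = z 1 + (\<Sum>j\<in>{1..d} - {1}. of_nat j * z (int j))" for z
          unfolding \<Psi>_def using assms(2) by (subst sum.remove[of _ 1]) auto
        moreover have "(\<Sum>j\<in>{1..d} - {1}. of_nat j * y (int j)) = (\<Sum>j\<in>{1..d} - {1}. of_nat j * x (int j))"
          by (intro sum.cong) (auto simp: y_def True simple_refl_signed_swap signed_swap_def)
        moreover have "y 1 = - x 1"
          using weylD(2)[OF less.prems, of 1] by (simp add: y_def True simple_refl_signed_swap signed_swap_def)
        ultimately show ?thesis using i True by (simp add: word_descent_def)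
      next
        case False
        have "(\<lambda>j. y (int j)) j = ((\<lambda>j. x (int j))(i := x (int (Suc i)), Suc i := x (int i))) j" for j
          using False by (auto simp: y_def simple_refl_signed_swap signed_swap_def add.commute)
        hence "\<Psi> y = \<Psi> x + (x (int i) - x (int (Suc i)))"
          unfolding \<Psi>_def using weighted_sum_swap[of i d "\<lambda>j. x (int j)"] False id by simp
        thus ?thesis using i False by (simp add: word_descent_def add.commute)
      qed
      then obtain ws where "set ws \<subseteq> {..<d}" "weyl_word ws = y"
        using less.hyps[of y] y bound[OF y] by auto
      thus ?thesis
        using id by (intro exI[of _ "ws @ [i]"])
          (simp add: weyl_word_append y_def comp_assoc simple_refl_invol)
    qed
  qed
  thus ?thesis using that by blast
qed

lemma weyl_length_le: "set ws \<subseteq> {..<d} \<Longrightarrow> weyl_length d (weyl_word ws) \<le> length ws"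
  unfolding weyl_length_def by (rule Least_le) blast

lemma reduced_word_ex:
  assumes "x \<in> carrier (weyl d)" "0 < d"
  obtains ws where "set ws \<subseteq> {..<d}" "weyl_word ws = x" "length ws = weyl_length d x"
proof -
  have "\<exists>n ws. length ws = n \<and> set ws \<subseteq> {..<d} \<and> weyl_word ws = x"
    using weyl_word_ex[OF assms] by metis
  from LeastI_ex[OF this] show ?thesis using that by (auto simp: weyl_length_def)
qed

lemma weyl_length_swap_less:
  assumes "x \<in> carrier (weyl d)" "0 < d" "a < b" "a \<noteq> 0" "b \<noteq> 0" "x b < x a"
  shows "weyl_length d (x \<circ> signed_swap a b) < weyl_length d x"
proof -
  obtain ws where ws: "set ws \<subseteq> {..<d}" "weyl_word ws = x" "length ws = weyl_length d x"
    by (rule reduced_word_ex[OF assms(1,2)])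
  obtain ws' where "set ws' \<subseteq> {..<d}" "Suc (length ws') = length ws" "weyl_word ws' = x \<circ> signed_swap a b"
    using strong_exchange[OF ws(1) assms(3-5)] assms(6) ws(2) by metis
  thus ?thesis using weyl_length_le[of ws' d] ws(3) by simp
qed

text \<open>
  Multiplication by the reflection reverses the pair, so this is \<open>weyl_length_swap_less\<close> with the two
  elements interchanged.
\<close>

lemma weyl_length_swap_greater:
  assumes "x \<in> carrier (weyl d)" "a < b" "a \<noteq> 0" "b \<noteq> 0" "\<bar>a\<bar> \<le> int d" "\<bar>b\<bar> \<le> int d" "x a < x b"
  shows "weyl_length d x < weyl_length d (x \<circ> signed_swap a b)"
proof -
  have t: "signed_swap a b \<in> carrier (weyl d)" using assms by (intro signed_swap_weyl) auto
  have "weyl_length d (x \<circ> signed_swap a b \<circ> signed_swap a b) < weyl_length d (x \<circ> signed_swap a b)"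
    using assms by (intro weyl_length_swap_less weyl_comp t) (auto simp: signed_swap_def)
  thus ?thesis using signed_swap_invol[of a b] assms by (simp add: comp_assoc)
qed

text \<open>
  A uniform way to treat the sign change and the adjacent exchanges.
\<close>

lemma simple_refl_pair:
  assumes "i < d"
  obtains a b where "a < b" "a \<noteq> 0" "b \<noteq> 0" "\<bar>a\<bar> \<le> int d" "\<bar>b\<bar> \<le> int d" "simple_refl i = signed_swap a b"
    "\<And>x. x \<in> carrier (weyl d) \<Longrightarrow> word_descent d x i \<longleftrightarrow> x b < x a"
proof (cases "i = 0")
  case True
  show ?thesis
  proof (rule that[of "- 1" 1])
    show "word_descent d x i \<longleftrightarrow> x 1 < x (- 1)" if "x \<in> carrier (weyl d)" for x
      using weylD(2)[OF that, of 1] assms True by (auto simp: word_descent_def)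
  qed (use assms True in \<open>auto simp: simple_refl_signed_swap\<close>)
next
  case False
  show ?thesis
    by (rule that[of "int i" "int i + 1"])
       (use assms False in \<open>auto simp: simple_refl_signed_swap word_descent_def\<close>)
qed

lemma word_descent_length:
  assumes "x \<in> carrier (weyl d)" "i < d"
  shows "word_descent d x i \<Longrightarrow> weyl_length d (x \<circ> simple_refl i) < weyl_length d x"
    and "\<not> word_descent d x i \<Longrightarrow> weyl_length d x < weyl_length d (x \<circ> simple_refl i)"
proof -
  obtain a b where ab: "a < b" "a \<noteq> 0" "b \<noteq> 0" "\<bar>a\<bar> \<le> int d" "\<bar>b\<bar> \<le> int d" "simple_refl i = signed_swap a b"
    and iff: "word_descent d x i \<longleftrightarrow> x b < x a" using simple_refl_pair[OF assms(2)] assms(1) by metis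
  have "x a \<noteq> x b" using weylD(1)[OF assms(1)] ab(1) by (metis injD less_irrefl)
  thus "word_descent d x i \<Longrightarrow> weyl_length d (x \<circ> simple_refl i) < weyl_length d x"
    "\<not> word_descent d x i \<Longrightarrow> weyl_length d x < weyl_length d (x \<circ> simple_refl i)"
    using weyl_length_swap_less[OF assms(1) _ ab(1-3)] weyl_length_swap_greater[OF assms(1) ab(1-5)] iff assms(2) ab(6)
    by auto
qed

lemma reflections_conj:
  assumes "t \<in> reflections d" "i < d"
  shows "simple_refl i \<circ> t \<circ> simple_refl i \<in> reflections d"
proof -
  interpret group "weyl d" by (rule weyl_group)
  from assms(1) obtain u j where u: "u \<in> carrier (weyl d)" "j < d"
    and t: "t = u \<circ> simple_refl j \<circ> inv\<^bsub>weyl d\<^esub> u" by (auto simp: reflections_def)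
  have s: "simple_refl i \<in> carrier (weyl d)" by (rule simple_refl_weyl[OF assms(2)])
  have "inv\<^bsub>weyl d\<^esub> simple_refl i = simple_refl i"
    by (rule inv_char) (simp_all add: s simple_refl_invol)
  hence "inv\<^bsub>weyl d\<^esub> (simple_refl i \<circ> u) = inv\<^bsub>weyl d\<^esub> u \<circ> simple_refl i"
    using inv_mult_group[OF s u(1)] by simp
  hence "simple_refl i \<circ> t \<circ> simple_refl i =
      (simple_refl i \<circ> u) \<otimes>\<^bsub>weyl d\<^esub> simple_refl j \<otimes>\<^bsub>weyl d\<^esub> inv\<^bsub>weyl d\<^esub> (simple_refl i \<circ> u)"
    by (simp add: t comp_assoc)
  moreover have "simple_refl i \<circ> u \<in> carrier (weyl d)" by (intro weyl_comp s u(1))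
  ultimately show ?thesis unfolding reflections_def using u(2) by blast
qed

lemma reflections_signed_swap:
  assumes "t \<in> reflections d"
  obtains a b where "a < b" "a \<noteq> 0" "b \<noteq> 0" "\<bar>a\<bar> \<le> int d" "\<bar>b\<bar> \<le> int d" "t = signed_swap a b"
proof -
  interpret group "weyl d" by (rule weyl_group)
  from assms obtain u j where u: "u \<in> carrier (weyl d)" "j < d"
    and t: "t = u \<circ> simple_refl j \<circ> inv\<^bsub>weyl d\<^esub> u" by (auto simp: reflections_def)
  obtain a b where ab: "a < b" "a \<noteq> 0" "b \<noteq> 0" "\<bar>a\<bar> \<le> int d" "\<bar>b\<bar> \<le> int d" "simple_refl j = signed_swap a b"
    using simple_refl_pair[OF u(2)] by metis
  have "u \<circ> inv\<^bsub>weyl d\<^esub> u = id" using r_inv[OF u(1)] by simp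
  hence "t = signed_swap (u a) (u b)"
    unfolding t ab(6) weyl_signed_swap[OF u(1)] by (simp add: comp_assoc)
  moreover have "u a \<noteq> u b" using weylD(1)[OF u(1)] ab(1) by (metis injD less_irrefl)
  moreover have "u a \<noteq> 0 \<and> \<bar>u a\<bar> \<le> int d" "u b \<noteq> 0 \<and> \<bar>u b\<bar> \<le> int d"
    using weylD(4)[OF u(1)] ab by blast+
  ultimately show ?thesis
    using that[of "u a" "u b"] that[of "u b" "u a"] signed_swap_comm[of "u a" "u b"]
    by (cases "u a" "u b" rule: linorder_cases) auto
qed

lemma simple_refl_reflection:
  assumes "i < d"
  shows "simple_refl i \<in> reflections d"
proof -
  interpret group "weyl d" by (rule weyl_group)
  have "simple_refl i = id \<otimes>\<^bsub>weyl d\<^esub> simple_refl i \<otimes>\<^bsub>weyl d\<^esub> inv\<^bsub>weyl d\<^esub> id"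
    using inv_one by simp
  thus ?thesis unfolding reflections_def using weyl_id assms by blast
qed

lemma bruhat_step_simple:
  assumes "x \<in> carrier (weyl d)" "i < d" "\<not> word_descent d x i"
  shows "bruhat_step d x (x \<circ> simple_refl i)"
  unfolding bruhat_step_def
  using assms word_descent_length(2) simple_refl_reflection[OF assms(2)] by auto

text \<open>
  Conjugating a reflection by a simple reflection \<open>s\<close> keeps its root positive unless the reflection is \<open>s\<close>
  itself, and whether multiplication by a reflection increases the length is decided by its root.
\<close>

lemma bruhat_step_mult_simple:
  assumes "bruhat_step d x y" "i < d"
  shows "x \<circ> simple_refl i = y \<or> bruhat_step d (x \<circ> simple_refl i) (y \<circ> simple_refl i)"
proof -
  define s where "s = simple_refl i"
  have ss: "s \<circ> s = id" by (simp add: s_def simple_refl_invol)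
  from assms(1) obtain t where x: "x \<in> carrier (weyl d)" and l: "weyl_length d x < weyl_length d y"
    and t: "t \<in> reflections d" and y: "y = x \<circ> t" by (auto simp: bruhat_step_def)
  have s: "s \<in> carrier (weyl d)" unfolding s_def by (rule simple_refl_weyl[OF assms(2)])
  obtain a b where ab: "a < b" "a \<noteq> 0" "b \<noteq> 0" "\<bar>a\<bar> \<le> int d" "\<bar>b\<bar> \<le> int d" "t = signed_swap a b"
    by (rule reflections_signed_swap[OF t])
  have xab: "x a < x b"
  proof (rule ccontr)
    assume "\<not> x a < x b"
    moreover have "x a \<noteq> x b" using weylD(1)[OF x] ab(1) by (metis injD less_irrefl)
    ultimately have "weyl_length d y < weyl_length d x"
      unfolding y ab(6) using assms(2) ab by (intro weyl_length_swap_less[OF x]) auto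
    thus False using l by simp
  qed
  show ?thesis
  proof (cases "s a < s b")
    case False
    hence "t = s" using simple_refl_order[OF ab(1-3)] ab(6) by (simp add: s_def)
    thus ?thesis by (simp add: y s_def)
  next
    case True
    have sz: "s (s z) = z" for z using ss by (simp add: fun_eq_iff)
    have sts: "s \<circ> t \<circ> s = signed_swap (s a) (s b)"
      unfolding ab(6) weyl_signed_swap[OF s] by (simp add: comp_assoc ss)
    have ys: "y \<circ> s = (x \<circ> s) \<circ> (s \<circ> t \<circ> s)" using ss by (simp add: y fun_eq_iff)
    have "weyl_length d (x \<circ> s) < weyl_length d (y \<circ> s)"
      unfolding ys sts
      using True ab xab weylD(4)[OF s, of a] weylD(4)[OF s, of b]
      by (intro weyl_length_swap_greater weyl_comp x s) (auto simp: sz)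
    moreover have "s \<circ> t \<circ> s \<in> reflections d" unfolding s_def by (rule reflections_conj[OF t assms(2)])
    moreover have "x \<circ> s \<in> carrier (weyl d)" by (intro weyl_comp x s)
    ultimately show ?thesis using ys by (auto simp: bruhat_step_def s_def)
  qed
qed

lemma bruhat_less_length: "bruhat_less d x y \<Longrightarrow> weyl_length d x < weyl_length d y"
  unfolding bruhat_less_def by (induction rule: tranclp_induct) (auto simp: bruhat_step_def)

lemma bruhat_less_trans: "bruhat_less d x y \<Longrightarrow> bruhat_less d y z \<Longrightarrow> bruhat_less d x z"
  unfolding bruhat_less_def by (rule tranclp_trans)

text \<open>
  Along a chain from \<open>x\<close> to \<open>y\<close>, each step is either preserved or collapses by \<open>bruhat_step_mult_simple\<close>.
  Where it collapses, the chain continues from the original element and ends with the ascent from \<open>y\<close>.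
\<close>

lemma bruhat_less_mult_simple:
  assumes "bruhat_less d x y" "i < d" "y \<in> carrier (weyl d)" "\<not> word_descent d y i"
  shows "bruhat_less d (x \<circ> simple_refl i) (y \<circ> simple_refl i)"
  using assms(1)[unfolded bruhat_less_def]
proof (induction rule: converse_tranclp_induct)
  case (base x)
  have "weyl_length d y < weyl_length d (y \<circ> simple_refl i)" by (rule word_descent_length(2)[OF assms(3,2,4)])
  moreover have "weyl_length d x < weyl_length d y" using base by (simp add: bruhat_step_def)
  moreover have "y \<circ> simple_refl i = x" if "x \<circ> simple_refl i = y"
    using that simple_refl_invol[of i] by (auto simp: comp_assoc)
  ultimately show ?case
    using bruhat_step_mult_simple[OF base assms(2)] unfolding bruhat_less_def by fastforce
next
  case (step x z)
  have "bruhat_less d z (y \<circ> simple_refl i)"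
    unfolding bruhat_less_def
    by (rule tranclp_trans[OF step(2) tranclp.r_into_trancl[of "bruhat_step d", OF bruhat_step_simple[OF assms(3,2,4)]]])
  moreover have "bruhat_less d (z \<circ> simple_refl i) (y \<circ> simple_refl i)"
    using step(3) by (simp only: bruhat_less_def)
  ultimately show ?case
    using bruhat_step_mult_simple[OF step(1) assms(2)] unfolding bruhat_less_def
    by (metis tranclp_into_tranclp2)
qed

section \<open>Minimal length coset representatives\<close>

definition ext_tuple :: "nat \<Rightarrow> nat \<Rightarrow> (nat \<Rightarrow> real) \<Rightarrow> int \<Rightarrow> real" where
  "ext_tuple r m f z = (if z > 0 then f (nat z) else flip r m (f (nat (- z))))"

lemma ext_tuple_uminus: "z \<noteq> 0 \<Longrightarrow> ext_tuple r m f (- z) = flip r m (ext_tuple r m f z)"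
  by (auto simp: ext_tuple_def)

lemma weyl_act_ext_tuple: "i \<in> {1..d} \<Longrightarrow> weyl_act r m d f \<sigma> i = ext_tuple r m f (\<sigma> (int i))"
  by (simp add: weyl_act_def ext_tuple_def)

lemma weyl_act_eq_iff:
  assumes "\<sigma> \<in> carrier (weyl d)" "\<tau> \<in> carrier (weyl d)"
  shows "weyl_act r m d f \<sigma> = weyl_act r m d f \<tau> \<longleftrightarrow>
    (\<forall>z. z \<noteq> 0 \<and> \<bar>z\<bar> \<le> int d \<longrightarrow> ext_tuple r m f (\<sigma> z) = ext_tuple r m f (\<tau> z))"
proof
  assume eq: "weyl_act r m d f \<sigma> = weyl_act r m d f \<tau>"
  have pos: "ext_tuple r m f (\<sigma> y) = ext_tuple r m f (\<tau> y)" if "0 < y" "y \<le> int d" for y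
  proof -
    have "nat y \<in> {1..d}" "int (nat y) = y" using that by auto
    thus ?thesis using eq weyl_act_ext_tuple by metis
  qed
  show "\<forall>z. z \<noteq> 0 \<and> \<bar>z\<bar> \<le> int d \<longrightarrow> ext_tuple r m f (\<sigma> z) = ext_tuple r m f (\<tau> z)"
  proof (intro allI impI)
    fix z :: int assume z: "z \<noteq> 0 \<and> \<bar>z\<bar> \<le> int d"
    show "ext_tuple r m f (\<sigma> z) = ext_tuple r m f (\<tau> z)"
    proof (cases "z > 0")
      case True
      thus ?thesis using pos[of z] z by simp
    next
      case False
      hence "ext_tuple r m f (\<sigma> (- z)) = ext_tuple r m f (\<tau> (- z))" using pos[of "- z"] z by simp
      hence "ext_tuple r m f (- \<sigma> z) = ext_tuple r m f (- \<tau> z)" using weylD(2)[OF assms(1)] weylD(2)[OF assms(2)] by simp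
      moreover have "\<sigma> z \<noteq> 0" "\<tau> z \<noteq> 0" using weylD(3)[OF assms(1)] weylD(3)[OF assms(2)] z by auto
      ultimately show ?thesis by (metis ext_tuple_uminus flip_flip)
    qed
  qed
next
  assume "\<forall>z. z \<noteq> 0 \<and> \<bar>z\<bar> \<le> int d \<longrightarrow> ext_tuple r m f (\<sigma> z) = ext_tuple r m f (\<tau> z)"
  hence *: "ext_tuple r m f (\<sigma> (int i)) = ext_tuple r m f (\<tau> (int i))" if "i \<in> {1..d}" for i using that by auto
  show "weyl_act r m d f \<sigma> = weyl_act r m d f \<tau>"
  proof
    fix i
    show "weyl_act r m d f \<sigma> i = weyl_act r m d f \<tau> i"
    proof (cases "i \<in> {1..d}")
      case True
      thus ?thesis using * by (simp only: weyl_act_ext_tuple)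
    next
      case False
      thus ?thesis by (simp only: weyl_act_def restrict_def if_False)
    qed
  qed
qed

text \<open>
  Being increasing on the fibres of \<open>f \<cdot> \<sigma>\<close>, including negative indices. These are the shortest elements
  of their cosets, see \<open>min_reps_eq\<close>.
\<close>

definition fibre_mono :: "nat \<Rightarrow> nat \<Rightarrow> nat \<Rightarrow> (nat \<Rightarrow> real) \<Rightarrow> (int \<Rightarrow> int) \<Rightarrow> bool" where
  "fibre_mono r m d f \<sigma> \<longleftrightarrow> \<sigma> \<in> carrier (weyl d) \<and>
     (\<forall>a b. a \<noteq> 0 \<longrightarrow> b \<noteq> 0 \<longrightarrow> \<bar>a\<bar> \<le> int d \<longrightarrow> \<bar>b\<bar> \<le> int d \<longrightarrow> a < b \<longrightarrow>
        ext_tuple r m f (\<sigma> a) = ext_tuple r m f (\<sigma> b) \<longrightarrow> \<sigma> a < \<sigma> b)"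

lemma fibre_mono_weyl: "fibre_mono r m d f \<sigma> \<Longrightarrow> \<sigma> \<in> carrier (weyl d)"
  by (simp add: fibre_mono_def)

lemma fibre_monoD:
  "fibre_mono r m d f \<sigma> \<Longrightarrow> a \<noteq> 0 \<Longrightarrow> b \<noteq> 0 \<Longrightarrow> \<bar>a\<bar> \<le> int d \<Longrightarrow> \<bar>b\<bar> \<le> int d \<Longrightarrow> a < b \<Longrightarrow>
   ext_tuple r m f (\<sigma> a) = ext_tuple r m f (\<sigma> b) \<Longrightarrow> \<sigma> a < \<sigma> b"
  by (simp add: fibre_mono_def)

text \<open>
  Where the two first differ, the smaller of the two values is attained by the other map at a later
  point of the same fibre, which contradicts monotonicity.
\<close>

lemma fibre_mono_unique:
  assumes "fibre_mono r m d f \<sigma>" "fibre_mono r m d f \<tau>" "weyl_act r m d f \<sigma> = weyl_act r m d f \<tau>"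
  shows "\<sigma> = \<tau>"
proof (rule ccontr)
  assume ne: "\<sigma> \<noteq> \<tau>"
  note W = fibre_mono_weyl[OF assms(1)] fibre_mono_weyl[OF assms(2)]
  have outside: "\<sigma> z = \<tau> z" if "\<not> (z \<noteq> 0 \<and> \<bar>z\<bar> \<le> int d)" for z
  proof -
    have "\<sigma> permutes ({- int d..int d} - {0})" "\<tau> permutes ({- int d..int d} - {0})" using W by (auto simp: weyl_def)
    moreover have "z \<notin> {- int d..int d} - {0}" using that by auto
    ultimately show ?thesis by (simp add: permutes_not_in)
  qed
  define D where "D = {z. \<sigma> z \<noteq> \<tau> z}"
  have D: "z \<noteq> 0 \<and> \<bar>z\<bar> \<le> int d" if "z \<in> D" for z
    using outside[of z] that unfolding D_def by blast
  have "D \<subseteq> {- int d..int d}"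
  proof
    fix z assume "z \<in> D"
    from D[OF this] show "z \<in> {- int d..int d}" by auto
  qed
  hence fin: "finite D" by (rule finite_subset) simp
  have "D \<noteq> {}" using ne by (auto simp: D_def)
  define z where "z = Min D"
  have zD: "z \<in> D" unfolding z_def by (rule Min_in[OF fin \<open>D \<noteq> {}\<close>])
  hence z: "z \<noteq> 0" "\<bar>z\<bar> \<le> int d" using D by blast+
  have least: "\<sigma> y = \<tau> y" if "y < z" for y
    using Min_le[OF fin, of y] that by (auto simp: z_def D_def)
  have False if r: "\<rho> z < \<rho>' z" and \<rho>: "fibre_mono r m d f \<rho>" "fibre_mono r m d f \<rho>'"
    and eq: "weyl_act r m d f \<rho> = weyl_act r m d f \<rho>'" and le: "\<And>y. y < z \<Longrightarrow> \<rho> y = \<rho>' y" for \<rho> \<rho>'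
  proof -
    note V = fibre_mono_weyl[OF \<rho>(1)] fibre_mono_weyl[OF \<rho>(2)]
    have "\<rho>' permutes ({- int d..int d} - {0})" using V by (simp add: weyl_def)
    then obtain y where y: "\<rho>' y = \<rho> z" using permutes_surj by (metis surjD)
    have yA: "y \<noteq> 0 \<and> \<bar>y\<bar> \<le> int d" using weylD(4)[OF V(1), of z] weylD(4)[OF V(2), of y] z y by simp
    have ext: "ext_tuple r m f (\<rho> z) = ext_tuple r m f (\<rho>' z)" using weyl_act_eq_iff[OF V] eq z by blast
    have "\<not> z \<le> y"
    proof
      assume "z \<le> y"
      hence "z < y" using r y by (cases "z = y") auto
      hence "\<rho>' z < \<rho>' y" using z yA ext y by (intro fibre_monoD[OF \<rho>(2)]) auto
      thus False using r y by simp
    qed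
    hence "\<rho> y = \<rho>' y" "y \<noteq> z" using le by auto
    thus False using y weylD(1)[OF V(1)] by (metis injD)
  qed
  note contra = this
  have "\<sigma> z \<noteq> \<tau> z" using zD by (simp add: D_def)
  then consider "\<sigma> z < \<tau> z" | "\<tau> z < \<sigma> z" by linarith
  thus False
  proof cases
    case 1
    show False by (rule contra[OF 1 assms(1,2,3) least])
  next
    case 2
    show False by (rule contra[OF 2 assms(2,1) assms(3)[symmetric] least[symmetric]])
  qed
qed

lemma ext_tuple_signed_swap:
  assumes "\<sigma> \<in> carrier (weyl d)" "ext_tuple r m f (\<sigma> a) = ext_tuple r m f (\<sigma> b)" "a \<noteq> 0" "b \<noteq> 0"
  shows "ext_tuple r m f (\<sigma> (signed_swap a b z)) = ext_tuple r m f (\<sigma> z)"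
proof -
  have "\<sigma> a \<noteq> 0" "\<sigma> b \<noteq> 0" using assms weylD(3)[OF assms(1)] by auto
  thus ?thesis using assms(2) weylD(2)[OF assms(1)] by (auto simp: signed_swap_def ext_tuple_uminus)
qed

text \<open>
  If \<open>\<sigma>\<close> reverses a pair in a fibre, multiplying by the corresponding reflection keeps the coset and
  decreases the length. Conversely, the coset of a fibrewise increasing \<open>\<sigma>\<close> has some element of minimal
  length, which is again fibrewise increasing and hence equal to \<open>\<sigma>\<close>.
\<close>

lemma min_reps_eq:
  assumes f: "f \<in> tuples r m d" and d: "0 < d"
  shows "\<sigma> \<in> min_reps r m d f \<longleftrightarrow> fibre_mono r m d f \<sigma>"
proof -
  have fwd: "fibre_mono r m d f \<sigma>" if \<sigma>: "\<sigma> \<in> min_reps r m d f" for \<sigma>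
  proof -
    have W: "\<sigma> \<in> carrier (weyl d)" using \<sigma> by (simp add: min_reps_def)
    have "\<sigma> a < \<sigma> b" if ab: "a \<noteq> 0" "b \<noteq> 0" "\<bar>a\<bar> \<le> int d" "\<bar>b\<bar> \<le> int d" "a < b"
        and ext: "ext_tuple r m f (\<sigma> a) = ext_tuple r m f (\<sigma> b)" for a b
    proof (rule ccontr)
      assume "\<not> \<sigma> a < \<sigma> b"
      moreover have ne: "\<sigma> a \<noteq> \<sigma> b" using weylD(1)[OF W] ab(5) by (metis injD less_irrefl)
      ultimately have len: "weyl_length d (\<sigma> \<circ> signed_swap a b) < weyl_length d \<sigma>"
        using ab d by (intro weyl_length_swap_less[OF W]) auto
      define t where "t = signed_swap (\<sigma> a) (\<sigma> b)"
      have nz: "\<sigma> a \<noteq> 0 \<and> \<bar>\<sigma> a\<bar> \<le> int d" "\<sigma> b \<noteq> 0 \<and> \<bar>\<sigma> b\<bar> \<le> int d" using weylD(4)[OF W] ab by blast+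
      have t: "t \<in> carrier (weyl d)" unfolding t_def using ne nz by (intro signed_swap_weyl) auto
      have "weyl_act r m d f t = weyl_act r m d f id"
        unfolding weyl_act_eq_iff[OF t weyl_id]
        using ext_tuple_signed_swap[OF weyl_id, of r m f "\<sigma> a" "\<sigma> b"] ext nz by (simp add: t_def)
      hence "t \<in> stabilizer r m d f" using t weyl_act_id[OF f] by (simp add: stabilizer_def)
      hence "t \<circ> \<sigma> \<in> stabilizer r m d f #>\<^bsub>weyl d\<^esub> \<sigma>" by (auto simp: r_coset_def)
      hence "weyl_length d \<sigma> \<le> weyl_length d (t \<circ> \<sigma>)" using \<sigma> by (simp add: min_reps_def)
      thus False using len weyl_signed_swap[OF W, of a b] by (simp add: t_def)
    qed
    thus ?thesis using W by (simp add: fibre_mono_def)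
  qed
  show ?thesis
  proof
    assume \<sigma>: "fibre_mono r m d f \<sigma>"
    note W = fibre_mono_weyl[OF \<sigma>]
    have "id \<in> stabilizer r m d f" using weyl_id weyl_act_id[OF f] by (simp add: stabilizer_def)
    hence "\<sigma> \<in> stabilizer r m d f #>\<^bsub>weyl d\<^esub> \<sigma>" by (auto simp: r_coset_def intro!: bexI[of _ id])
    then obtain \<tau> where \<tau>: "\<tau> \<in> stabilizer r m d f #>\<^bsub>weyl d\<^esub> \<sigma>"
      and least: "\<And>\<rho>. \<rho> \<in> stabilizer r m d f #>\<^bsub>weyl d\<^esub> \<sigma> \<Longrightarrow> weyl_length d \<tau> \<le> weyl_length d \<rho>"
      using ex_has_least_nat[of "\<lambda>\<tau>. \<tau> \<in> stabilizer r m d f #>\<^bsub>weyl d\<^esub> \<sigma>" \<sigma> "weyl_length d"] by blast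
    from \<tau> obtain h where h: "h \<in> carrier (weyl d)" "weyl_act r m d f h = f" "\<tau> = h \<circ> \<sigma>"
      by (auto simp: r_coset_def stabilizer_def)
    have mult: "weyl_act r m d f (h \<circ> y) = weyl_act r m d f y" if "y \<in> carrier (weyl d)" for y
      using weyl_act_mult[OF h(1) that, of r m f] h(2) by simp
    have "\<tau> \<in> min_reps r m d f"
    proof -
      have "\<rho> \<in> stabilizer r m d f #>\<^bsub>weyl d\<^esub> \<sigma>" if "\<rho> \<in> stabilizer r m d f #>\<^bsub>weyl d\<^esub> \<tau>" for \<rho>
      proof -
        from that obtain h' where h': "h' \<in> carrier (weyl d)" "weyl_act r m d f h' = f" "\<rho> = h' \<circ> \<tau>"
          by (auto simp: r_coset_def stabilizer_def)
        have "weyl_act r m d f (h' \<circ> h) = f"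
          using weyl_act_mult[OF h'(1) h(1), of r m f] h'(2) h(2) by simp
        hence "h' \<circ> h \<in> stabilizer r m d f" using weyl_comp[OF h'(1) h(1)] by (simp add: stabilizer_def)
        moreover have "\<rho> = (h' \<circ> h) \<otimes>\<^bsub>weyl d\<^esub> \<sigma>" by (simp add: h'(3) h(3) comp_assoc)
        ultimately show ?thesis unfolding r_coset_def by blast
      qed
      thus ?thesis using least weyl_comp[OF h(1) W] h(3) by (simp add: min_reps_def)
    qed
    hence "fibre_mono r m d f \<tau>" by (rule fwd)
    moreover have "weyl_act r m d f \<tau> = weyl_act r m d f \<sigma>" using mult[OF W] h(3) by simp
    ultimately have "\<tau> = \<sigma>" using fibre_mono_unique \<sigma> by blast
    thus "\<sigma> \<in> min_reps r m d f" using \<open>\<tau> \<in> min_reps r m d f\<close> by simp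
  qed (rule fwd)
qed

lemma fixed_iff: "fixed r m d g i \<longleftrightarrow> i < d \<and> simple_act r m g i = g"
proof (cases "i = 0")
  case True
  have "flip r m (g 1) = g 1 \<longleftrightarrow> g 1 \<notin> wt_pos r m \<and> - g 1 \<notin> wt_pos r m"
    using wt_pos_gt0[of "g 1" r m] wt_pos_gt0[of "- g 1" r m] by (auto simp: flip_def wt_neg_iff)
  moreover have "simple_act r m g 0 = g \<longleftrightarrow> flip r m (g 1) = g 1"
  proof -
    have "g(1 := c) = g \<longleftrightarrow> c = g 1" for c by (metis fun_upd_same fun_upd_triv)
    from this[of "flip r m (g 1)"] show ?thesis by (simp only: simple_act_def if_True refl)
  qed
  ultimately show ?thesis using True by (simp only: fixed_def if_True refl)
next
  case False
  have "g(i := g (Suc i), Suc i := g i) = g \<longleftrightarrow> g i = g (Suc i)"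
  proof
    assume "g(i := g (Suc i), Suc i := g i) = g"
    from fun_cong[OF this, of i] show "g i = g (Suc i)" by simp
  next
    assume *: "g i = g (Suc i)"
    show "g(i := g (Suc i), Suc i := g i) = g" using * by (intro ext) simp
  qed
  thus ?thesis using False by (simp add: fixed_def simple_act_pos)
qed

lemma descent_trichotomy:
  assumes "i < d"
  obtains "descent r m d g i" | "descent r m d (simple_act r m g i) i" | "fixed r m d g i"
proof (cases "i = 0")
  case True
  have "simple_act r m g 0 1 = - g 1" if "- g 1 \<in> wt_pos r m"
    using that by (simp add: simple_act_def flip_def wt_neg_iff)
  thus ?thesis using that assms True unfolding descent_def fixed_def by metis
next
  case False
  thus ?thesis using that assms
    by (cases "g i" "g (Suc i)" rule: linorder_cases) (simp_all add: descent_def fixed_def simple_act_pos)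
qed

context
  fixes r m d :: nat and k :: int and f :: "nat \<Rightarrow> real"
  assumes f: "f \<in> tuples r m d" and anti: "antidominant m d f" and d: "0 < d"
begin

private abbreviation "F \<equiv> ext_tuple r m f"
private abbreviation "act \<equiv> weyl_act r m d f"
private abbreviation "inc \<equiv> fibre_mono r m d f"
private abbreviation "P \<equiv> min_reps r m d f"
private abbreviation "M \<equiv> \<lambda>\<sigma>. std (weyl_act r m d f \<sigma>)"
private abbreviation "Low \<equiv> \<lambda>\<sigma>. {w \<in> min_reps r m d f. bruhat_less d w \<sigma>}"
private abbreviation "\<psi> \<equiv> tensor_bar r m d k"

lemma antidominant_antimono:
  assumes "1 \<le> i" "i \<le> j" "j \<le> d"
  shows "f j \<le> f i"
  using assms(2,3)
proof (induction j rule: dec_induct)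
  case (step n)
  hence "f (n + 1) \<le> f n" using anti assms(1) by (auto simp: antidominant_def)
  thus ?case using step by simp
qed simp

lemma antidominant_not_pos: "1 \<le> i \<Longrightarrow> i \<le> d \<Longrightarrow> f i \<notin> wt_pos r m"
  using antidominant_antimono[of 1 i] anti wt_pos_bounds[of "f i" r m]
  by (auto simp: antidominant_def field_simps)

lemma ext_tuple_sign:
  assumes "z \<noteq> 0" "\<bar>z\<bar> \<le> int d"
  shows "F z \<in> wt_pos r m \<Longrightarrow> z < 0" "- F z \<in> wt_pos r m \<Longrightarrow> 0 < z"
proof -
  show "z < 0" if "F z \<in> wt_pos r m"
  proof (rule ccontr)
    assume "\<not> z < 0"
    thus False using that antidominant_not_pos[of "nat z"] assms by (simp add: ext_tuple_def)
  qed
  show "0 < z" if "- F z \<in> wt_pos r m"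
  proof (rule ccontr)
    assume z: "\<not> 0 < z"
    hence "f (nat (- z)) \<notin> wt_pos r m" using antidominant_not_pos[of "nat (- z)"] assms by (simp add: Suc_le_eq)
    thus False using that z wt_pos_not_neg[OF that]
      by (auto simp: ext_tuple_def flip_def wt_neg_iff split: if_splits)
  qed
qed

lemma ext_tuple_wt: "z \<noteq> 0 \<Longrightarrow> \<bar>z\<bar> \<le> int d \<Longrightarrow> F z \<in> wt r m"
proof -
  assume z: "z \<noteq> 0" "\<bar>z\<bar> \<le> int d"
  have "f n \<in> wt r m" if "1 \<le> n" "n \<le> d" for n using f that by (auto simp: tuples_def)
  from this[of "nat z"] this[of "nat (- z)"] show ?thesis
    using z by (auto simp: ext_tuple_def Suc_le_eq intro!: flip_wt)
qed

lemma ext_tuple_mid: "F z \<in> wt_mid m \<Longrightarrow> z \<noteq> 0 \<Longrightarrow> F (- z) = F z"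
  using mid_not_pos[of "F z" m r] by (auto simp: ext_tuple_uminus flip_def wt_neg_iff)

text \<open>
  The extension of an antidominant tuple to negative indices decreases from the positive weights on the
  left to the negative weights on the right. Exceptions arise only from middle weights, which
  occur again, in reverse order, at the negatives of their indices.
\<close>

lemma ext_tuple_less:
  assumes "a \<noteq> 0" "b \<noteq> 0" "\<bar>a\<bar> \<le> int d" "\<bar>b\<bar> \<le> int d" "F a < F b"
    and "F a \<in> wt_mid m \<Longrightarrow> F b \<in> wt_mid m \<Longrightarrow> 0 < a \<and> 0 < b"
  shows "b < a"
proof -
  have pp: "b < a" if "0 < a" "0 < b"
  proof (rule ccontr)
    assume "\<not> b < a"
    hence "1 \<le> nat a" "nat a \<le> nat b" "nat b \<le> d" using that assms(4) by linarith+
    from antidominant_antimono[OF this] show False using that assms(5) by (simp add: ext_tuple_def)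
  qed
  consider "F a \<in> wt_mid m" "F b \<in> wt_mid m" | "F a \<in> wt_mid m" "F b \<notin> wt_mid m"
    | "F a \<notin> wt_mid m" "F b \<in> wt_mid m" | "F a \<notin> wt_mid m" "F b \<notin> wt_mid m" by blast
  thus ?thesis
  proof cases
    case 1
    thus ?thesis using assms(6) pp by blast
  next
    case 2
    have "- F b \<notin> wt_pos r m" using wt_pos_bounds[of "- F b" r m] wt_mid_bounds[OF 2(1)] assms(5) by auto
    hence b: "F b \<in> wt_pos r m" using wt_cases[OF ext_tuple_wt[of b]] assms(1-5) 2 by (auto simp: wt_neg_iff)
    hence b0: "b < 0" using ext_tuple_sign assms(1-5) by blast
    show ?thesis
    proof (cases "0 < a")
      case False
      have "F (- b) = - F b" using b b0 by (simp add: ext_tuple_uminus flip_def)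
      hence "F (- b) < F (- a)"
        using ext_tuple_mid[OF 2(1) assms(1)] wt_pos_bounds[OF b] wt_mid_bounds[OF 2(1)] by auto
      hence "f (nat (- b)) < f (nat (- a))" using False b0 assms(1) by (simp add: ext_tuple_def)
      thus ?thesis using antidominant_antimono[of "nat (- b)" "nat (- a)"] assms(1-5) b0 False by fastforce
    qed (use b0 in simp)
  next
    case 3
    have "F a \<notin> wt_pos r m" using wt_pos_bounds[of "F a" r m] wt_mid_bounds[OF 3(2)] assms(5) by auto
    hence "- F a \<in> wt_pos r m" using wt_cases[OF ext_tuple_wt[of a]] assms(1-5) 3 by (auto simp: wt_neg_iff)
    hence "0 < a" using ext_tuple_sign assms(1-5) by blast
    thus ?thesis using pp assms(2) by (cases "0 < b") auto
  next
    case 4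
    have cases: "F z \<in> wt_pos r m \<and> z < 0 \<or> - F z \<in> wt_pos r m \<and> 0 < z"
      if "z = a \<or> z = b" for z
      using that wt_cases[OF ext_tuple_wt[of z]] ext_tuple_sign[of z] 4 assms(1-5) by (auto simp: wt_neg_iff)
    consider "0 < a" "0 < b" | "0 < a" "b < 0" | "a < 0" "0 < b" | "a < 0" "b < 0" using assms(1-5) by linarith
    thus ?thesis
    proof cases
      case 1
      thus ?thesis using pp by blast
    next
      case 3
      hence "F a \<in> wt_pos r m" "- F b \<in> wt_pos r m" using cases[of a] cases[of b] by auto
      hence "0 < F a" "0 < - F b" by (blast intro: wt_pos_gt0)+
      thus ?thesis using assms(5) by simp
    next
      case 4
      hence p: "F a \<in> wt_pos r m" "F b \<in> wt_pos r m" using cases[of a] cases[of b] by auto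
      hence "F (- b) < F (- a)" using assms(1-5) by (simp add: ext_tuple_uminus flip_def)
      hence "f (nat (- b)) < f (nat (- a))" using 4 by (simp add: ext_tuple_def)
      thus ?thesis using antidominant_antimono[of "nat (- b)" "nat (- a)"] assms(1-5) 4 by fastforce
    qed simp
  qed
qed

text \<open>
  Opposite indices lie in the same fibre if the weight is a middle one.
\<close>

lemma fibre_mono_mid_pos:
  assumes "inc \<sigma>" "0 < z" "z \<le> int d" "F (\<sigma> z) \<in> wt_mid m"
  shows "0 < \<sigma> z"
proof -
  note W = fibre_mono_weyl[OF assms(1)]
  have "F (\<sigma> (- z)) = F (\<sigma> z)"
    using ext_tuple_mid[OF assms(4)] weylD(2)[OF W] weylD(3)[OF W] assms(2) by simp
  hence "\<sigma> (- z) < \<sigma> z" using assms by (intro fibre_monoD[OF assms(1)]) auto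
  thus ?thesis using weylD(2)[OF W] by simp
qed

lemma fibre_mono_less:
  assumes "inc \<sigma>" "0 < y" "y \<le> int d" "0 < z" "z \<le> int d" "F (\<sigma> y) < F (\<sigma> z)"
  shows "\<sigma> z < \<sigma> y"
proof -
  note W = fibre_mono_weyl[OF assms(1)]
  have "\<sigma> y \<noteq> 0 \<and> \<bar>\<sigma> y\<bar> \<le> int d" "\<sigma> z \<noteq> 0 \<and> \<bar>\<sigma> z\<bar> \<le> int d"
    using weylD(4)[OF W, of y] weylD(4)[OF W, of z] assms by auto
  thus ?thesis using assms fibre_mono_mid_pos[OF assms(1)] by (intro ext_tuple_less) auto
qed

text \<open>
  By \<open>fibre_mono_less\<close>, different adjacent entries of \<open>f \<cdot> \<sigma>\<close> are ordered oppositely to the values of \<open>\<sigma>\<close>;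
  equal ones lie in a fibre and give no descent of \<open>\<sigma>\<close>. For \<open>i = 0\<close>, the signs are compared instead.
\<close>

lemma fibre_mono_descent_iff:
  assumes \<sigma>: "inc \<sigma>" and i: "i < d"
  shows "word_descent d \<sigma> i \<longleftrightarrow> descent r m d (act \<sigma>) i"
proof -
  note W = fibre_mono_weyl[OF \<sigma>]
  define g where "g = act \<sigma>"
  have g: "g j = F (\<sigma> (int j))" if "1 \<le> j" "j \<le> d" for j
    unfolding g_def using that by (simp only: weyl_act_ext_tuple[of j d] atLeastAtMost_iff)
  have s1: "\<sigma> 1 \<noteq> 0" "\<bar>\<sigma> 1\<bar> \<le> int d" using weylD(4)[OF W, of 1] d by auto
  have "word_descent d \<sigma> i" if D: "descent r m d g i"
  proof (cases "i = 0")
    case True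
    hence "F (\<sigma> 1) \<in> wt_pos r m" using D g[of 1] d by (simp add: descent_def)
    thus ?thesis using ext_tuple_sign(1) s1 True d by (simp add: word_descent_def)
  next
    case False
    hence "F (\<sigma> (int i)) < F (\<sigma> (int i + 1))" using D g[of i] g[of "Suc i"] i by (simp add: descent_def add.commute)
    thus ?thesis using fibre_mono_less[OF \<sigma>, of "int i" "int i + 1"] False i by (simp add: word_descent_def)
  qed
  moreover have "\<not> word_descent d \<sigma> i" if D: "descent r m d (simple_act r m g i) i"
  proof (cases "i = 0")
    case True
    hence "- F (\<sigma> 1) \<in> wt_pos r m" using D g[of 1] d
      by (auto simp: descent_def simple_act_def flip_def wt_neg_iff split: if_splits)
    thus ?thesis using ext_tuple_sign(2)[OF s1] True by (simp add: word_descent_def)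
  next
    case False
    hence "F (\<sigma> (int i + 1)) < F (\<sigma> (int i))" using D g[of i] g[of "Suc i"] i
      by (simp add: descent_def simple_act_pos add.commute)
    thus ?thesis using fibre_mono_less[OF \<sigma>, of "int i + 1" "int i"] False i by (simp add: word_descent_def)
  qed
  moreover have "\<not> word_descent d \<sigma> i" if D: "fixed r m d g i"
  proof (cases "i = 0")
    case True
    hence "F (\<sigma> 1) \<notin> wt_pos r m" "- F (\<sigma> 1) \<notin> wt_pos r m" using D g[of 1] d by (auto simp: fixed_def)
    hence "F (\<sigma> 1) \<in> wt_mid m" using wt_cases[OF ext_tuple_wt[OF s1]] by (auto simp: wt_neg_iff)
    thus ?thesis using fibre_mono_mid_pos[OF \<sigma>, of 1] True d by (simp add: word_descent_def)
  next
    case False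
    hence "F (\<sigma> (int i)) = F (\<sigma> (int i + 1))" using D g[of i] g[of "Suc i"] i by (simp add: fixed_def add.commute)
    hence "\<sigma> (int i) < \<sigma> (int i + 1)" using False i by (intro fibre_monoD[OF \<sigma>]) auto
    thus ?thesis using False by (simp add: word_descent_def)
  qed
  ultimately show ?thesis using descent_trichotomy[OF i, of r m g] unfolding g_def by blast
qed

lemma weyl_act_mult_simple:
  assumes "\<sigma> \<in> carrier (weyl d)" "i < d"
  shows "act (\<sigma> \<circ> simple_refl i) = simple_act r m (act \<sigma>) i"
  using weyl_act_mult[OF assms(1) simple_refl_weyl[OF assms(2)], of r m f]
    weyl_act_simple[OF weyl_act_tuples[OF f assms(1)] assms(2)] by simp

text \<open>
  The simple reflection reverses only its own pair, and this pair lies in a fibre only if the tuple is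
  fixed.
\<close>

lemma fibre_mono_mult_simple:
  assumes \<sigma>: "inc \<sigma>" and i: "i < d" and nf: "\<not> fixed r m d (act \<sigma>) i"
  shows "inc (\<sigma> \<circ> simple_refl i)"
proof -
  note W = fibre_mono_weyl[OF \<sigma>] and s = simple_refl_weyl[OF i]
  have "(\<sigma> \<circ> simple_refl i) a < (\<sigma> \<circ> simple_refl i) b"
    if ab: "a \<noteq> 0" "b \<noteq> 0" "\<bar>a\<bar> \<le> int d" "\<bar>b\<bar> \<le> int d" "a < b"
      "F ((\<sigma> \<circ> simple_refl i) a) = F ((\<sigma> \<circ> simple_refl i) b)" for a b
  proof (cases "simple_refl i a < simple_refl i b")
    case True
    thus ?thesis using ab weylD(4)[OF s, of a] weylD(4)[OF s, of b] fibre_monoD[OF \<sigma>] by simp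
  next
    case False
    hence eq: "signed_swap a b = simple_refl i" using simple_refl_order ab by blast
    hence "simple_refl i a = b" "simple_refl i b = a" using ab(5) by (auto simp flip: eq simp: signed_swap_def)
    hence "F (\<sigma> a) = F (\<sigma> b)" using ab(6) by simp
    hence "F (\<sigma> (simple_refl i z)) = F (\<sigma> z)" for z
      using ext_tuple_signed_swap[OF W _ ab(1,2)] eq by simp
    hence "act (\<sigma> \<circ> simple_refl i) = act \<sigma>" using weyl_act_eq_iff[OF weyl_comp[OF W s] W] by simp
    thus ?thesis using nf weyl_act_mult_simple[OF W i] by (simp add: fixed_iff i)
  qed
  thus ?thesis using weyl_comp[OF W s] unfolding fibre_mono_def by blast
qed

lemma fibre_mono_id: "inc id"
  by (simp add: fibre_mono_def weyl_id)

text \<open>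
  Every fibrewise increasing element is reached from the identity by a sequence of ascents through
  elements of the same kind.
\<close>

lemma fibre_mono_induct [consumes 1, case_names id ascent]:
  assumes "inc \<sigma>" and "Q id"
    and "\<And>\<sigma> i. inc \<sigma> \<Longrightarrow> i < d \<Longrightarrow> \<not> word_descent d \<sigma> i \<Longrightarrow> \<not> fixed r m d (act \<sigma>) i \<Longrightarrow>
           inc (\<sigma> \<circ> simple_refl i) \<Longrightarrow> Q \<sigma> \<Longrightarrow> Q (\<sigma> \<circ> simple_refl i)"
  shows "Q \<sigma>"
  using assms(1)
proof (induction "weyl_length d \<sigma>" arbitrary: \<sigma> rule: less_induct)
  case less
  note W = fibre_mono_weyl[OF less.prems]
  show ?case
  proof (cases "\<sigma> = id")
    case False
    then obtain i where i: "word_descent d \<sigma> i" using word_descent_ex W d by blast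
    have id: "i < d" using i by (simp add: word_descent_def)
    define \<tau> where "\<tau> = \<sigma> \<circ> simple_refl i"
    have \<tau>\<sigma>: "\<tau> \<circ> simple_refl i = \<sigma>" by (simp add: \<tau>_def comp_assoc simple_refl_invol)
    have D: "descent r m d (act \<sigma>) i" using fibre_mono_descent_iff[OF less.prems id] i by simp
    have nf: "\<not> fixed r m d (act \<sigma>) i" using D by (auto simp: fixed_def descent_def)
    have \<tau>: "inc \<tau>" unfolding \<tau>_def by (rule fibre_mono_mult_simple[OF less.prems id nf])
    have act\<tau>: "act \<tau> = simple_act r m (act \<sigma>) i" unfolding \<tau>_def by (rule weyl_act_mult_simple[OF W id])
    have len: "weyl_length d \<tau> < weyl_length d \<sigma>" unfolding \<tau>_def by (rule word_descent_length(1)[OF W id i])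
    have "\<not> word_descent d \<tau> i"
      using word_descent_length(1)[OF fibre_mono_weyl[OF \<tau>] id] len \<tau>\<sigma> by auto
    moreover have "\<not> fixed r m d (act \<tau>) i" using nf unfolding fixed_iff act\<tau> simple_act_simple_act by metis
    ultimately have "Q (\<tau> \<circ> simple_refl i)"
      using assms(3)[OF \<tau> id] less.hyps[OF len \<tau>] less.prems \<tau>\<sigma> by simp
    thus ?thesis using \<tau>\<sigma> by simp
  qed (use assms(2) in simp)
qed

section \<open>The canonical basis of the permutation module\<close>

lemma gen_act_min_reps_cases:
  assumes \<sigma>: "inc \<sigma>" and i: "i < d"
  obtains (desc) "word_descent d \<sigma> i" "inc (\<sigma> \<circ> simple_refl i)"
      "gen_act r m k i (M \<sigma>) = M (\<sigma> \<circ> simple_refl i) +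
         smult (hecke_param k i - inverse (hecke_param k i)) (M \<sigma>)"
    | (asc) "\<not> word_descent d \<sigma> i" "inc (\<sigma> \<circ> simple_refl i)"
      "gen_act r m k i (M \<sigma>) = M (\<sigma> \<circ> simple_refl i)"
    | (const) "fixed r m d (act \<sigma>) i" "gen_act r m k i (M \<sigma>) = smult (hecke_param k i) (M \<sigma>)"
proof -
  note W = fibre_mono_weyl[OF \<sigma>]
  have act: "act (\<sigma> \<circ> simple_refl i) = simple_act r m (act \<sigma>) i"
    by (rule weyl_act_mult_simple[OF W i])
  have desc_iff: "word_descent d \<sigma> i \<longleftrightarrow> descent r m d (act \<sigma>) i"
    by (rule fibre_mono_descent_iff[OF \<sigma> i])
  have move: "inc (\<sigma> \<circ> simple_refl i)" if "\<not> fixed r m d (act \<sigma>) i"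
    by (rule fibre_mono_mult_simple[OF \<sigma> i that])
  from i show ?thesis
  proof (cases rule: gen_act_std_cases[where r = r and m = m and g = "act \<sigma>" and k = k])
    case desc
    moreover have "\<not> fixed r m d (act \<sigma>) i" using desc(1) by (auto simp: descent_def fixed_def)
    ultimately show ?thesis using that(1) desc_iff move act by simp
  next
    case asc
    have "\<not> fixed r m d (act \<sigma>) i"
    proof
      assume fx: "fixed r m d (act \<sigma>) i"
      hence "descent r m d (act \<sigma>) i" using asc(1) by (simp add: fixed_iff)
      thus False using fx by (cases "i = 0") (simp_all add: descent_def fixed_def)
    qed
    moreover have "\<not> descent r m d (act \<sigma>) i"
      using asc(1) wt_pos_not_neg[of "act \<sigma> 1" r m]
      by (auto simp: descent_def simple_act_def flip_def split: if_splits)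
    ultimately show ?thesis using that(2) desc_iff move act asc(2) by simp
  next
    case const
    thus ?thesis using that(3) by blast
  qed
qed

lemma act_id: "act id = f"
  using weyl_act_id[OF f] by (simp only: weyl_simps)

lemma inc_min_reps: "\<sigma> \<in> P \<longleftrightarrow> inc \<sigma>"
  by (rule min_reps_eq[OF f d])

lemma finite_min_reps: "finite P"
proof (rule finite_subset)
  show "P \<subseteq> {\<sigma>. \<sigma> permutes ({- int d..int d} - {0})}" by (auto simp: min_reps_def weyl_def)
qed (simp add: finite_permutations)

lemma weyl_act_inj: "inj_on act P"
  using fibre_mono_unique by (auto simp: inj_on_def inc_min_reps)

lemma std_min_reps_perm_module:
  assumes "inc \<sigma>"
  shows "M \<sigma> \<in> perm_module r m d k f"
  using assms
proof (induction rule: fibre_mono_induct)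
  case id
  show ?case unfolding act_id by (rule perm_module_std[OF f])
next
  case (ascent \<sigma> i)
  from ascent(1,2) have gen: "gen_act r m k i (M \<sigma>) = M (\<sigma> \<circ> simple_refl i)"
    by (cases rule: gen_act_min_reps_cases) (use ascent(3,4) in auto)
  from perm_module_gen_act[OF f ascent(6,2)] show ?case unfolding gen .
qed

text \<open>
  The span contains \<open>std f\<close> and is stable under the generators. Conversely, ascents are given by the
  action of single generators.
\<close>

lemma perm_module_span: "perm_module r m d k f = tensor.span (M ` P)"
proof
  have gen: "gen_act r m k i x \<in> tensor.span (M ` P)" if x: "x \<in> tensor.span (M ` P)" and i: "i < d" for x i
    using x
  proof (induction rule: tensor.span_induct_alt)
    case (step c b y)
    then obtain \<sigma> where \<sigma>: "inc \<sigma>" "b = M \<sigma>" by (auto simp: inc_min_reps)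
    have base: "M \<tau> \<in> tensor.span (M ` P)" if "inc \<tau>" for \<tau>
      using that by (intro tensor.span_base imageI) (simp add: inc_min_reps)
    from \<sigma>(1) i have "gen_act r m k i (M \<sigma>) \<in> tensor.span (M ` P)"
      by (cases rule: gen_act_min_reps_cases)
         (simp_all add: base \<sigma>(1) tensor.span_add tensor.span_scale)
    thus ?case using step by (simp add: gen_act_add gen_act_smult tensor.span_add tensor.span_scale \<sigma>(2))
  qed (simp add: tensor.span_zero)
  have word: "fold (gen_act r m k) ws x \<in> tensor.span (M ` P)"
    if "x \<in> tensor.span (M ` P)" "set ws \<subseteq> {..<d}" for ws x
    using that by (induction ws arbitrary: x) (simp_all add: gen)
  have "id \<in> P" unfolding inc_min_reps by (rule fibre_mono_id)
  hence "M id \<in> tensor.span (M ` P)" by (intro tensor.span_base imageI)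
  hence std: "std f \<in> tensor.span (M ` P)" by (simp only: act_id)
  have "free_act r m k (std f) a \<in> tensor.span (M ` P)" if "a \<in> carrier (free_alg d)" for a
    using that
    by (induction rule: free_alg_induct)
       (simp_all add: free_act_single free_act_add_right word std tensor.span_scale tensor.span_zero tensor.span_add)
  thus "perm_module r m d k f \<subseteq> tensor.span (M ` P)" by (auto simp: perm_module_eq[OF f])
  show "tensor.span (M ` P) \<subseteq> perm_module r m d k f"
    using std_min_reps_perm_module
    by (intro tensor.span_minimal perm_module_subspace[OF f]) (auto simp: inc_min_reps)
qed

text \<open>
  The induction step multiplies by an inverse generator. For \<open>w\<close> below \<open>\<sigma>\<close>, the tuples that can arise are
  those of \<open>w\<close> and of \<open>w\<close> times the simple reflection, and the latter stays below by
  \<open>bruhat_less_mult_simple\<close>.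
\<close>

lemma tensor_bar_triangular:
  assumes "inc \<sigma>"
  shows "\<psi> (M \<sigma>) - M \<sigma> \<in> laurent_span act (Low \<sigma>)"
  using assms
proof (induction rule: fibre_mono_induct)
  case id
  have "\<psi> (M id) - M id = 0" unfolding act_id using tensor_bar_antidominant[OF f anti] by simp
  thus ?case by (simp only: coeff_span_0 laurent.zero)
next
  case (ascent \<sigma> i)
  define \<tau> where "\<tau> = \<sigma> \<circ> simple_refl i"
  define p where "p = hecke_param k i"
  have W: "\<sigma> \<in> carrier (weyl d)" by (rule fibre_mono_weyl[OF ascent(1)])
  have fin: "finite (Low v)" for v using finite_min_reps by simp
  have gen: "gen_act r m k i (M \<sigma>) = M \<tau>"
    using ascent(1,2) by (cases rule: gen_act_min_reps_cases) (use ascent(3,4) in \<open>auto simp: \<tau>_def\<close>)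
  have \<sigma>\<tau>: "bruhat_less d \<sigma> \<tau>"
    using bruhat_step_simple[OF W ascent(2,3)] by (auto simp: bruhat_less_def \<tau>_def)
  have low: "w \<in> Low \<tau>" if "w \<in> Low \<sigma> \<or> w = \<sigma>" for w
    using that \<sigma>\<tau> bruhat_less_trans ascent(1) inc_min_reps by blast
  have lowM: "smult c (M w) \<in> laurent_span act (Low \<tau>)" if "w \<in> Low \<sigma> \<or> w = \<sigma>" "c \<in> laurent" for w c
    by (rule coeff_span_std[OF laurent.zero that(2) low[OF that(1)] fin])
  have p: "p \<in> laurent" "inverse p \<in> laurent" using laurent_hecke_param by (auto simp: p_def)
  have inv_M: "inv_act r m k i (M w) \<in> laurent_span act (Low \<tau>)" if w: "w \<in> Low \<sigma>" for w
  proof -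
    have "inc w" using w inc_min_reps by blast
    have "w \<circ> simple_refl i \<in> Low \<tau>" if "inc (w \<circ> simple_refl i)"
      using bruhat_less_mult_simple[of d w \<sigma> i] w W ascent(2,3) that by (simp add: inc_min_reps \<tau>_def)
    hence up: "M (w \<circ> simple_refl i) \<in> laurent_span act (Low \<tau>)" if "inc (w \<circ> simple_refl i)"
      using coeff_span_std[OF laurent.zero laurent_power[of 0] _ fin, of "w \<circ> simple_refl i" \<tau> act] that by simp
    from \<open>inc w\<close> ascent(2) show ?thesis
    proof (cases rule: gen_act_min_reps_cases)
      case desc
      thus ?thesis using up by (simp add: inv_act_def)
    next
      case asc
      have "inv_act r m k i (M w) = M (w \<circ> simple_refl i) + smult (inverse p - p) (M w)"
        by (simp add: inv_act_def asc(3) tensor.scale_left_diff_distrib p_def)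
      thus ?thesis using lowM[of w "inverse p - p"] w p up asc
        by (simp add: coeff_span_add laurent_add laurent_diff)
    next
      case const
      have "inv_act r m k i (M w) = smult (inverse p) (M w)"
        by (simp add: inv_act_def const(2) p_def flip: tensor.scale_left_diff_distrib)
      thus ?thesis using lowM[of w "inverse p"] w p by simp
    qed
  qed
  have "inv_act r m k i (\<psi> (M \<sigma>) - M \<sigma>) \<in> laurent_span act (Low \<tau>)"
    by (rule laurent_span_semilinear[where \<beta> = id, OF inv_act_add inv_act_0 _ _ inv_M ascent(6) fin])
       (simp_all add: inv_act_smult)
  moreover have "\<psi> (M \<tau>) - M \<tau> = inv_act r m k i (\<psi> (M \<sigma>) - M \<sigma>) + smult (inverse p - p) (M \<sigma>)"
  proof -
    have "M \<sigma> \<in> tensor_space r m d" by (intro std_tensor_space weyl_act_tuples f W)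
    hence "\<psi> (M \<tau>) = inv_act r m k i (\<psi> (M \<sigma>))" using tensor_bar_gen_act ascent(2) gen by metis
    moreover have "inv_act r m k i (M \<sigma>) = M \<tau> + smult (inverse p - p) (M \<sigma>)"
      by (simp add: inv_act_def gen tensor.scale_left_diff_distrib p_def)
    moreover have "inv_act r m k i (\<psi> (M \<sigma>)) =
        inv_act r m k i (\<psi> (M \<sigma>) - M \<sigma>) + inv_act r m k i (M \<sigma>)"
      by (simp flip: inv_act_add)
    ultimately show ?thesis by simp
  qed
  ultimately show ?case
    using lowM[of \<sigma> "inverse p - p"] p unfolding \<tau>_def[symmetric]
    by (simp add: coeff_span_add laurent_add laurent_diff)
qed

lemma canonical_element:
  assumes "inc \<sigma>"
  obtains y where "y \<in> coeff_span qinv_int_polys act (Low \<sigma>)" "\<psi> (M \<sigma> + y) = M \<sigma> + y"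
proof -
  have invol: "\<psi> (\<psi> (M w)) = M w" if "inc w" for w
    by (rule tensor_bar_perm_module(2)[OF f anti std_min_reps_perm_module[OF that]])
  define x where "x = \<psi> (M \<sigma>) - M \<sigma>"
  have "\<exists>y \<in> coeff_span qinv_int_polys act (Low \<sigma>). x = y - \<psi> y"
  proof (rule bar_correction[where \<rho> = "weyl_length d", OF tensor_bar_add tensor_bar_smult])
    show "finite (Low \<sigma>)" using finite_min_reps by simp
    show "inj_on act (Low \<sigma>)" by (rule inj_on_subset[OF weyl_act_inj]) auto
    show "\<psi> (\<psi> (M w)) = M w" if "w \<in> Low \<sigma>" for w using that invol inc_min_reps by blast
    show "\<psi> (M w) - M w \<in> laurent_span act {v \<in> Low \<sigma>. weyl_length d v < weyl_length d w}"
      if w: "w \<in> Low \<sigma>" for w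
    proof (rule coeff_span_mono[OF laurent.zero _ _ tensor_bar_triangular])
      show "Low w \<subseteq> {v \<in> Low \<sigma>. weyl_length d v < weyl_length d w}"
        using w bruhat_less_trans bruhat_less_length by blast
      show "finite {v \<in> Low \<sigma>. weyl_length d v < weyl_length d w}" using finite_min_reps by simp
    qed (use w inc_min_reps in auto)
    show "x \<in> laurent_span act (Low \<sigma>)" unfolding x_def by (rule tensor_bar_triangular[OF assms])
    show "\<psi> x = - x" by (simp add: x_def tensor_bar_diff invol[OF assms])
  qed
  then obtain y where y: "y \<in> coeff_span qinv_int_polys act (Low \<sigma>)" "x = y - \<psi> y" by blast
  have "\<psi> (M \<sigma> + y) = M \<sigma> + x + \<psi> y" by (simp add: tensor_bar_add x_def)
  thus ?thesis using that y by simp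
qed

lemma canonical_basis:
  obtains C where "inj_on C P" "\<not> tensor.dependent (C ` P)" "tensor.span (C ` P) = perm_module r m d k f"
    "\<forall>\<sigma>\<in>P. \<psi> (C \<sigma>) = C \<sigma>"
    "\<forall>\<sigma>\<in>P. C \<sigma> - M \<sigma> \<in> coeff_span qinv_int_polys act (Low \<sigma>)"
proof -
  have "\<forall>\<sigma>\<in>P. \<exists>x. \<psi> x = x \<and> x - M \<sigma> \<in> coeff_span qinv_int_polys act (Low \<sigma>)"
  proof
    fix \<sigma> assume "\<sigma> \<in> P"
    then obtain y where "y \<in> coeff_span qinv_int_polys act (Low \<sigma>)" "\<psi> (M \<sigma> + y) = M \<sigma> + y"
      using canonical_element inc_min_reps by blast
    thus "\<exists>x. \<psi> x = x \<and> x - M \<sigma> \<in> coeff_span qinv_int_polys act (Low \<sigma>)"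
      by (intro exI[of _ "M \<sigma> + y"]) simp
  qed
  then obtain C where C: "\<And>\<sigma>. \<sigma> \<in> P \<Longrightarrow> \<psi> (C \<sigma>) = C \<sigma>"
    "\<And>\<sigma>. \<sigma> \<in> P \<Longrightarrow> C \<sigma> - M \<sigma> \<in> coeff_span qinv_int_polys act (Low \<sigma>)"
    using bchoice[of P "\<lambda>\<sigma> x. \<psi> x = x \<and> x - M \<sigma> \<in> coeff_span qinv_int_polys act (Low \<sigma>)"] by blast
  have tri: "C w - M w \<in> coeff_span qinv_int_polys act {v \<in> P. weyl_length d v < weyl_length d w}"
    if "w \<in> P" for w
    by (rule coeff_span_mono[OF qinv_0 _ _ C(2)[OF that]]) (use finite_min_reps bruhat_less_length in auto)
  note basis = unitriangular_basis[OF finite_min_reps weyl_act_inj tri]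
  show ?thesis
    using that[of C] basis C perm_module_span by simp
qed

end

theorem theoremA:
  fixes r m d :: nat and k :: int and f :: "nat \<Rightarrow> real"
  assumes "r \<noteq> 0 \<or> m \<noteq> 0" and "d \<ge> 1"
    and "f \<in> tuples r m d" and "antidominant m d f"
  shows "\<exists>\<psi>.
    \<psi> \<in> perm_module r m d k f \<rightarrow> perm_module r m d k f \<and>
    antilinear_on (perm_module r m d k f) \<psi> \<and>
    (\<forall>x\<in>perm_module r m d k f. \<psi> (\<psi> x) = x) \<and>
    \<psi> (std f) = std f \<and>
    (\<forall>x\<in>perm_module r m d k f. \<forall>h\<in>carrier (hecke d k).
       \<psi> (hecke_act r m k x h) = hecke_act r m k (\<psi> x) (hecke_bar d k h)) \<and>
    (\<exists>C.
       inj_on C (min_reps r m d f) \<and>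
       \<not> module.dependent smult (C ` min_reps r m d f) \<and>
       module.span smult (C ` min_reps r m d f) = perm_module r m d k f \<and>
       (\<forall>\<sigma>\<in>min_reps r m d f.
          \<psi> (C \<sigma>) = C \<sigma> \<and>
          (\<exists>c. (\<forall>w. c w \<in> qinv_int_polys) \<and>
               C \<sigma> = std (weyl_act r m d f \<sigma>) +
                 (\<Sum>w\<in>{w \<in> min_reps r m d f. bruhat_less d w \<sigma>}. smult (c w) (std (weyl_act r m d f w))))))"
proof -
  note f = assms(3,4)
  have d: "0 < d" using assms(2) by simp
  let ?\<psi> = "tensor_bar r m d k"
  obtain C where C: "inj_on C (min_reps r m d f)" "\<not> tensor.dependent (C ` min_reps r m d f)"
    "tensor.span (C ` min_reps r m d f) = perm_module r m d k f"
    "\<forall>\<sigma>\<in>min_reps r m d f. ?\<psi> (C \<sigma>) = C \<sigma>"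
    "\<forall>\<sigma>\<in>min_reps r m d f. C \<sigma> - std (weyl_act r m d f \<sigma>) \<in>
       coeff_span qinv_int_polys (weyl_act r m d f) {w \<in> min_reps r m d f. bruhat_less d w \<sigma>}"
    by (rule canonical_basis[OF f d])
  have expand: "\<exists>c. (\<forall>w. c w \<in> qinv_int_polys) \<and> C \<sigma> = std (weyl_act r m d f \<sigma>) +
      (\<Sum>w\<in>{w \<in> min_reps r m d f. bruhat_less d w \<sigma>}. smult (c w) (std (weyl_act r m d f w)))"
    if \<sigma>: "\<sigma> \<in> min_reps r m d f" for \<sigma>
  proof -
    from bspec[OF C(5) \<sigma>] obtain c where c: "\<forall>w. c w \<in> qinv_int_polys" "C \<sigma> - std (weyl_act r m d f \<sigma>) =
        (\<Sum>w\<in>{w \<in> min_reps r m d f. bruhat_less d w \<sigma>}. smult (c w) (std (weyl_act r m d f w)))"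
      unfolding coeff_span_def by blast
    thus ?thesis by (intro exI[of _ c]) (simp flip: c(2))
  qed
  have "?\<psi> \<in> perm_module r m d k f \<rightarrow> perm_module r m d k f"
    using tensor_bar_perm_module(1)[OF f] by blast
  moreover have "antilinear_on (perm_module r m d k f) ?\<psi>"
    by (simp add: antilinear_on_def tensor_bar_add tensor_bar_smult)
  moreover have "?\<psi> (hecke_act r m k x h) = hecke_act r m k (?\<psi> x) (hecke_bar d k h)"
    if "x \<in> perm_module r m d k f" "h \<in> carrier (hecke d k)" for x h
    using tensor_bar_hecke_act perm_module_tensor_space[OF f(1)] that by blast
  ultimately show ?thesis
    using tensor_bar_perm_module(2)[OF f] tensor_bar_antidominant[OF f] C(1-4) expand
    by (intro exI[of _ ?\<psi>] conjI ballI exI[of _ C]) auto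
qed

end
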